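(* Let $T>0$, let $E$ be a real Banach space, $\Omega\subset E$ a non-empty open subset, $\xi_0\in\Omega$, $U$ a Hausdorff topological space, $m,q\ge 1$ integers, and let $f:[0,T]\times\Omega\times U\to E$, $f^0:[0,T]\times\Omega\times U\to\mathbb R$, $g^\alpha:\Omega\to\mathbb R$ ($0\le\alpha\le m$), $h^\beta:\Omega\to\mathbb R$ ($1\le\beta\le q$) be functions. Let $(x_0,u_0)$ be a solution of the Bolza problem $(\mathcal B)$ (defined in the context). Assume: (1) $f^0\in C^0([0,T]\times\Omega\times U,\mathbb R)$; for all $(t,\xi,\zeta)\in[0,T]\times\Omega\times U$, $D_{G,2}f^0(t,\xi,\zeta)$ exists; for all $(t,\zeta)\in[0,T]\times U$, $D_{F,2}f^0(t,x_0(t),\zeta)$ exists, and $[(t,\zeta)\mapsto D_{F,2}f^0(t,x_0(t),\zeta)]\in C^0([0,T]\times U,E^* )$. (2) For all non-empty compact $K\subset\Omega$ and all non-empty compact $M\subset U$, $\sup_{(t,\xi,\zeta)\in[0,T]\times K\times M}\|D_{G,2}f^0(t,\xi,\zeta)\|<+\infty$. (3) $f\in C^0([0,T]\times\Omega\times U,E)$; for all $(t,\xi,\zeta)\in[0,T]\times\Omega\times U$, $D_{G,2}f(t,\xi,\zeta)$ exists; for all $(t,\zeta)\in[0,T]\times U$, $D_{F,2}f(t,x_0(t),\zeta)$ exists, and $[(t,\zeta)\mapsto D_{F,2}f(t,x_0(t),\zeta)]\in C^0([0,T]\times U,\mathcal L(E,E))$. (4) For all non-empty compact $K\subset\Omega$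 and all non-empty compact $M\subset U$, $\sup_{(t,\xi,\zeta)\in[0,T]\times K\times M}\|D_{G,2}f(t,\xi,\zeta)\|<+\infty$. (5) For all $\alpha\in\{0,\dots,m\}$, $g^\alpha$ is Hadamard differentiable at $x_0(T)$. (6) For all $\beta\in\{1,\dots,q\}$, $h^\beta$ is continuous on a neighborhood of $x_0(T)$ and Hadamard differentiable at $x_0(T)$. Then there exist $(\lambda_\alpha)_{0\le\alpha\le m}\in\mathbb R^{1+m}$, $(\mu_\beta)_{1\le\beta\le q}\in\mathbb R^q$ and $p\in PC^1([0,T],E^* )$ such that, with $H_B(t,\xi,\zeta,p,\lambda):=\lambda f^0(t,\xi,\zeta)+p\cdot f(t,\xi,\zeta)$: (i) $((\lambda_\alpha)_{0\le\alpha\le m},(\mu_\beta)_{1\le\beta\le q})$ is non-zero; (ii) $\lambda_\alpha\ge 0$ for all $\alpha\in\{0,\dots,m\}$; (iii) $\lambda_\alpha g^\alpha(x_0(T))=0$ for all $\alpha\in\{1,\dots,m\}$; (iv) $\sum_{\alpha=0}^m\lambda_\alpha D_Hg^\alpha(x_0(T))+\sum_{\beta=1}^q\mu_\beta D_Hh^\beta(x_0(T))=p(T)$; (v) $\underline d p(t)=-D_{F,2}H_B(t,x_0(t),u_0(t),p(t),\lambda_0)$ for all $t\in[0,T]$; (vi) for all $t\in[0,T]$ and all $\zeta\in U$, $H_B(t,x_0(t),u_0(t),p(t),\lambda_0)\ge H_B(t,x_0(t),\zeta,p(t),\lambda_0)$; (vii) $[t\mapsto H_B(t,x_0(t),u_0(t),p(t),\lambda_0)]\in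 C^0([0,T],\mathbb R)$.
   Context: Function spaces. For a Hausdorff topological space $W$, $PC^0([0,T],W)$ is the set of $x:[0,T]\to W$ which are continuous, or for which there is a subdivision $0=\tau_0<\tau_1<\dots<\tau_{k+1}=T$ such that $x$ is continuous at every $t\notin\{\tau_i\}$, the right limit $x(\tau_i+)$ exists in $W$ for $0\le i\le k$ and the left limit $x(\tau_i-)$ exists in $W$ for $1\le i\le k+1$. $NPC^0_R([0,T],W)$ is the set of $x\in PC^0([0,T],W)$ which are right-continuous on $[0,T[$ and left-continuous at $T$. For $W$ a subset of a real normed space, $PC^1([0,T],W)$ is the set of continuous $x:[0,T]\to W$ which are continuously differentiable, or for which there is a subdivision $0=\tau_0<\tau_1<\dots<\tau_{k+1}=T$ such that $x$ is continuously differentiable at every $t\notin\{\tau_i\}$, the right derivative $x'_R(\tau_i)=x'(\tau_i+)$ exists for $0\le i\le k$ and the left derivative $x'_L(\tau_i)=x'(\tau_i-)$ exists for $1\le i\le k+1$. The extended derivative is $\underline d x(t):=x'(t)$ if $t\notin\{\tau_i\}$, $\underline d x(\tau_i):=x'_R(\tau_i)$ for $0\le i\le k$, $\underline d x(T):=x'_L(T)$. Differentials. For a map $\mathfrak f$ from an open subset of a normed space into a normed space, $D_G\mathfrak f(x)$, $D_H\mathfrak f(x)$, $D_F\mathfrak f(x)$ are the Gâteaux, Hadamard, Fréchet differentials (continuous linear maps). $D_G\mathfrak f(x)\cdot v=\lim_{\theta\to0+}(\mathfrak f(x+\theta v)-\mathfrak f(x))/\theta$ for all $v$; $\mathfrak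 f$ is Hadamard differentiable at $x$ when moreover $\lim_{\theta\to0+,\,w\to v}(\mathfrak f(x+\theta w)-\mathfrak f(x))/\theta=D_H\mathfrak f(x)\cdot v$ for all $v$. A subscript $i$, as in $D_{G,i},D_{H,i},D_{F,i}$, denotes the partial differential with respect to the $i$-th variable. $E^*$ is the topological dual, $\mathcal L(E,E)$ the bounded linear operators. Problem $(\mathcal B)$: maximize $\int_0^Tf^0(t,x(t),u(t))\,dt+g^0(x(T))$ over the admissible processes, i.e. the pairs $(x,u)\in PC^1([0,T],\Omega)\times NPC^0_R([0,T],U)$ with $\underline d x(t)=f(t,x(t),u(t))$ for all $t\in[0,T]$, $x(0)=\xi_0$, $g^\alpha(x(T))\ge0$ for $1\le\alpha\le m$, and $h^\beta(x(T))=0$ for $1\le\beta\le q$. A solution is an admissible process attaining the maximum. *)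

theory Defs
  imports "HOL-Analysis.Analysis"
begin

section \<open>Piecewise continuous and piecewise continuously differentiable functions\<close>

text \<open>
  Functions on \<open>[0,T]\<close> are total functions on the reals; only their values on \<open>{0..T}\<close>
  matter below.  A subdivision \<open>0 = \<tau>\<^sub>0 < \<dots> < \<tau>\<^sub>k\<^sub>+\<^sub>1 = T\<close> is encoded by the finite set of its
  points.
\<close>

definition subdivision :: "real \<Rightarrow> real set \<Rightarrow> bool" where
  "subdivision T S \<longleftrightarrow> finite S \<and> {0, T} \<subseteq> S \<and> S \<subseteq> {0..T}"

definition PC0 :: "real \<Rightarrow> 'w::t2_space set \<Rightarrow> (real \<Rightarrow> 'w) set" where
  "PC0 T W = {x. x ` {0..T} \<subseteq> W \<and>
     (continuous_on {0..T} x \<or>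
      (\<exists>S. subdivision T S \<and>
           (\<forall>t\<in>{0..T} - S. isCont x t) \<and>
           (\<forall>s\<in>S - {T}. \<exists>l\<in>W. (x \<longlongrightarrow> l) (at_right s)) \<and>
           (\<forall>s\<in>S - {0}. \<exists>l\<in>W. (x \<longlongrightarrow> l) (at_left s))))}"

definition NPC0_R :: "real \<Rightarrow> 'w::t2_space set \<Rightarrow> (real \<Rightarrow> 'w) set" where
  "NPC0_R T W = {x \<in> PC0 T W.
     (\<forall>t\<in>{0..<T}. continuous (at_right t) x) \<and> continuous (at_left T) x}"

definition C1_on_Icc :: "real \<Rightarrow> (real \<Rightarrow> 'a::real_normed_vector) \<Rightarrow> bool" where
  "C1_on_Icc T x \<longleftrightarrow>
     (\<exists>x'. (\<forall>t\<in>{0..T}. (x has_vector_derivative x' t) (at t within {0..T})) \<and>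
           continuous_on {0..T} x')"

text \<open>
  The one-sided derivatives at the points of the subdivision are required both to exist and to
  coincide with the one-sided limits of the derivative.
\<close>

definition PC1_subdivision ::
    "real \<Rightarrow> (real \<Rightarrow> 'a::real_normed_vector) \<Rightarrow> real set \<Rightarrow> bool" where
  "PC1_subdivision T x S \<longleftrightarrow> subdivision T S \<and>
     (\<forall>t\<in>{0..T} - S. x differentiable (at t) \<and> isCont (\<lambda>s. vector_derivative x (at s)) t) \<and>
     (\<forall>s\<in>S - {T}. \<exists>d. (x has_vector_derivative d) (at_right s) \<and>
                       ((\<lambda>t. vector_derivative x (at t)) \<longlongrightarrow> d) (at_right s)) \<and>
     (\<forall>s\<in>S - {0}. \<exists>d. (x has_vector_derivative d) (at_left s) \<and>
                       ((\<lambda>t. vector_derivative x (at t)) \<longlongrightarrow> d) (at_left s))"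

definition PC1 :: "real \<Rightarrow> 'a::real_normed_vector set \<Rightarrow> (real \<Rightarrow> 'a) set" where
  "PC1 T W = {x. x ` {0..T} \<subseteq> W \<and> continuous_on {0..T} x \<and>
     (C1_on_Icc T x \<or> (\<exists>S. PC1_subdivision T x S))}"

text \<open>
  The extended derivative.  At a point where the function is differentiable the right derivative
  is the derivative, so no subdivision has to be mentioned; that this is the usual
  definition relative to an arbitrary subdivision is \<open>ext_deriv_subdivision\<close> below.
\<close>

definition ext_deriv :: "real \<Rightarrow> (real \<Rightarrow> 'a::real_normed_vector) \<Rightarrow> real \<Rightarrow> 'a" where
  "ext_deriv T x t =
     (if t = T then vector_derivative x (at_left T) else vector_derivative x (at_right t))"

lemma ext_deriv_subdivision:
  assumes "PC1_subdivision T x S" "t \<in> {0..T}"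
  shows "ext_deriv T x t =
     (if t \<notin> S then vector_derivative x (at t)
      else if t = T then vector_derivative x (at_left T)
      else vector_derivative x (at_right t))"
proof (cases "t \<in> S")
  case True
  then show ?thesis by (simp add: ext_deriv_def)
next
  case False
  then have "x differentiable (at t)" and "t \<noteq> T"
    using assms by (auto simp: PC1_subdivision_def subdivision_def)
  then have "(x has_vector_derivative vector_derivative x (at t)) (at_right t)"
    by (meson has_vector_derivative_at_within vector_derivative_works)
  then have "vector_derivative x (at_right t) = vector_derivative x (at t)"
    by (intro vector_derivative_within) auto
  then show ?thesis using False \<open>t \<noteq> T\<close> by (simp add: ext_deriv_def)
qed

lemma ext_deriv_C1:
  assumes "T > 0" "t \<in> {0..T}" "(x has_vector_derivative d) (at t within {0..T})"
  shows "ext_deriv T x t = d"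
proof (cases "t = T")
  case True
  then have "(x has_vector_derivative d) (at_left T)"
    using assms by (simp add: at_within_Icc_at_left)
  then show ?thesis using True by (auto simp: ext_deriv_def intro!: vector_derivative_within)
next
  case False
  then have "(x has_vector_derivative d) (at t within {t..T})"
    using assms by (auto intro: has_vector_derivative_within_subset)
  then have "(x has_vector_derivative d) (at_right t)"
    using False assms by (simp add: at_within_Icc_at_right)
  then show ?thesis using False by (auto simp: ext_deriv_def intro!: vector_derivative_within)
qed

lemma C1_on_Icc_subdivision:
  assumes "T > 0" "C1_on_Icc T x"
  shows "PC1_subdivision T x {0, T}"
proof -
  obtain x' where x': "\<And>t. t \<in> {0..T} \<Longrightarrow> (x has_vector_derivative x' t) (at t within {0..T})"
    and c: "continuous_on {0..T} x'"
    using assms unfolding C1_on_Icc_def by blast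
  have d: "(x has_vector_derivative x' t) (at t)" if "t \<in> {0<..<T}" for t
    using x'[of t] that by (simp add: at_within_Icc_at)
  then have diff: "x differentiable (at t)" if "t \<in> {0<..<T}" for t
    using that differentiableI_vector by blast
  have vd: "vector_derivative x (at t) = x' t" if "t \<in> {0<..<T}" for t
    using d that vector_derivative_at by blast
  have "isCont x' t" if "t \<in> {0<..<T}" for t
    using c that by (auto intro!: continuous_on_interior[where S="{0..T}"])
  then have cont: "isCont (\<lambda>s. vector_derivative x (at s)) t" if t: "t \<in> {0<..<T}" for t
  proof -
    have "\<forall>\<^sub>F s in nhds t. s \<in> {0<..<T}"
      using t by (intro eventually_nhds_in_open) auto
    then have "\<forall>\<^sub>F s in nhds t. vector_derivative x (at s) = x' s"
      by eventually_elim (use vd in blast)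
    then show ?thesis using \<open>\<And>t. t \<in> {0<..<T} \<Longrightarrow> isCont x' t\<close>[OF t] by (simp add: isCont_cong)
  qed
  have "(x' \<longlongrightarrow> x' 0) (at_right 0)"
    using c assms(1) by (auto simp: continuous_on_def at_within_Icc_at_right dest: bspec[of _ _ 0])
  moreover have "\<forall>\<^sub>F s in at_right 0. x' s = vector_derivative x (at s)"
    using eventually_at_right_real[OF assms(1)] by eventually_elim (simp add: vd)
  ultimately have r: "((\<lambda>t. vector_derivative x (at t)) \<longlongrightarrow> x' 0) (at_right 0)"
    by (rule Lim_transform_eventually)
  have "(x' \<longlongrightarrow> x' T) (at_left T)"
    using c assms(1) by (auto simp: continuous_on_def at_within_Icc_at_left dest: bspec[of _ _ T])
  moreover have "\<forall>\<^sub>F s in at_left T. x' s = vector_derivative x (at s)"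
    using eventually_at_left_real[OF assms(1)] by eventually_elim (simp add: vd)
  ultimately have l: "((\<lambda>t. vector_derivative x (at t)) \<longlongrightarrow> x' T) (at_left T)"
    by (rule Lim_transform_eventually)
  have "(x has_vector_derivative x' 0) (at_right 0)" "(x has_vector_derivative x' T) (at_left T)"
    using x'[of 0] x'[of T] assms(1)
    by (simp_all add: at_within_Icc_at_left at_within_Icc_at_right)
  then show ?thesis
    using assms(1) r l diff cont unfolding PC1_subdivision_def subdivision_def
    by auto
qed


section \<open>Gateaux, Hadamard and Frechet differentials\<close>

text \<open>
  All three notions are local, so a map on an open set is represented by any total extension.
\<close>

definition has_gateaux_diff ::
    "('a::real_normed_vector \<Rightarrow> 'b::real_normed_vector) \<Rightarrow> ('a \<Rightarrow>\<^sub>L 'b) \<Rightarrow> 'a \<Rightarrow> bool" where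
  "has_gateaux_diff F L x \<longleftrightarrow>
     (\<forall>v. ((\<lambda>\<theta>. (F (x + \<theta> *\<^sub>R v) - F x) /\<^sub>R \<theta>) \<longlongrightarrow> blinfun_apply L v) (at_right 0))"

definition has_hadamard_diff ::
    "('a::real_normed_vector \<Rightarrow> 'b::real_normed_vector) \<Rightarrow> ('a \<Rightarrow>\<^sub>L 'b) \<Rightarrow> 'a \<Rightarrow> bool" where
  "has_hadamard_diff F L x \<longleftrightarrow> has_gateaux_diff F L x \<and>
     (\<forall>v. ((\<lambda>(\<theta>, w). (F (x + \<theta> *\<^sub>R w) - F x) /\<^sub>R \<theta>) \<longlongrightarrow> blinfun_apply L v)
            (at_right 0 \<times>\<^sub>F nhds v))"

definition gateaux_differentiable ::
    "('a::real_normed_vector \<Rightarrow> 'b::real_normed_vector) \<Rightarrow> 'a \<Rightarrow> bool" where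
  "gateaux_differentiable F x \<longleftrightarrow> (\<exists>L. has_gateaux_diff F L x)"

definition hadamard_differentiable ::
    "('a::real_normed_vector \<Rightarrow> 'b::real_normed_vector) \<Rightarrow> 'a \<Rightarrow> bool" where
  "hadamard_differentiable F x \<longleftrightarrow> (\<exists>L. has_hadamard_diff F L x)"

definition D_G ::
    "('a::real_normed_vector \<Rightarrow> 'b::real_normed_vector) \<Rightarrow> 'a \<Rightarrow> 'a \<Rightarrow>\<^sub>L 'b" where
  "D_G F x = (THE L. has_gateaux_diff F L x)"

definition D_H ::
    "('a::real_normed_vector \<Rightarrow> 'b::real_normed_vector) \<Rightarrow> 'a \<Rightarrow> 'a \<Rightarrow>\<^sub>L 'b" where
  "D_H F x = (THE L. has_hadamard_diff F L x)"

definition D_F ::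
    "('a::real_normed_vector \<Rightarrow> 'b::real_normed_vector) \<Rightarrow> 'a \<Rightarrow> 'a \<Rightarrow>\<^sub>L 'b" where
  "D_F F x = (THE L. (F has_derivative blinfun_apply L) (at x))"

lemma has_gateaux_diff_unique:
  assumes "has_gateaux_diff F L x" "has_gateaux_diff F L' x"
  shows "L = L'"
proof (rule blinfun_eqI)
  fix v
  show "blinfun_apply L v = blinfun_apply L' v"
    using assms unfolding has_gateaux_diff_def
    by (meson tendsto_unique trivial_limit_at_right_real)
qed

lemma D_G_eq: "has_gateaux_diff F L x \<Longrightarrow> D_G F x = L"
  unfolding D_G_def using has_gateaux_diff_unique by blast

lemma D_H_eq: "has_hadamard_diff F L x \<Longrightarrow> D_H F x = L"
  unfolding D_H_def has_hadamard_diff_def using has_gateaux_diff_unique by blast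

lemma D_F_eq: "(F has_derivative blinfun_apply L) (at x) \<Longrightarrow> D_F F x = L"
  unfolding D_F_def using has_derivative_unique by (blast intro: blinfun_apply_inject[THEN iffD1])

lemma has_derivative_D_F:
  assumes "F differentiable (at x)"
  shows "(F has_derivative blinfun_apply (D_F F x)) (at x)"
proof -
  obtain F' where "(F has_derivative F') (at x)"
    using assms by (auto simp: differentiable_def)
  then have "(F has_derivative blinfun_apply (Blinfun F')) (at x)"
    by (simp add: bounded_linear_Blinfun_apply has_derivative_bounded_linear)
  then show ?thesis by (simp add: D_F_eq)
qed


section \<open>The Bolza problem\<close>

definition bolza_admissible ::
    "real \<Rightarrow> 'a::banach set \<Rightarrow> 'u::t2_space set \<Rightarrow> 'a \<Rightarrow> (real \<Rightarrow> 'a \<Rightarrow> 'u \<Rightarrow> 'a) \<Rightarrow>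
     nat \<Rightarrow> (nat \<Rightarrow> 'a \<Rightarrow> real) \<Rightarrow> nat \<Rightarrow> (nat \<Rightarrow> 'a \<Rightarrow> real) \<Rightarrow>
     (real \<Rightarrow> 'a) \<Rightarrow> (real \<Rightarrow> 'u) \<Rightarrow> bool" where
  "bolza_admissible T \<Omega> U \<xi>0 f m g q h x u \<longleftrightarrow>
     x \<in> PC1 T \<Omega> \<and> u \<in> NPC0_R T U \<and>
     (\<forall>t\<in>{0..T}. ext_deriv T x t = f t (x t) (u t)) \<and>
     x 0 = \<xi>0 \<and>
     (\<forall>\<alpha>\<in>{1..m}. g \<alpha> (x T) \<ge> 0) \<and>
     (\<forall>\<beta>\<in>{1..q}. h \<beta> (x T) = 0)"

definition bolza_objective ::
    "real \<Rightarrow> (real \<Rightarrow> 'a \<Rightarrow> 'u \<Rightarrow> real) \<Rightarrow> (nat \<Rightarrow> 'a \<Rightarrow> real) \<Rightarrow>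
     (real \<Rightarrow> 'a) \<Rightarrow> (real \<Rightarrow> 'u) \<Rightarrow> real" where
  "bolza_objective T f0 g x u = integral {0..T} (\<lambda>t. f0 t (x t) (u t)) + g 0 (x T)"

definition bolza_solution ::
    "real \<Rightarrow> 'a::banach set \<Rightarrow> 'u::t2_space set \<Rightarrow> 'a \<Rightarrow> (real \<Rightarrow> 'a \<Rightarrow> 'u \<Rightarrow> 'a) \<Rightarrow>
     (real \<Rightarrow> 'a \<Rightarrow> 'u \<Rightarrow> real) \<Rightarrow>
     nat \<Rightarrow> (nat \<Rightarrow> 'a \<Rightarrow> real) \<Rightarrow> nat \<Rightarrow> (nat \<Rightarrow> 'a \<Rightarrow> real) \<Rightarrow>
     (real \<Rightarrow> 'a) \<Rightarrow> (real \<Rightarrow> 'u) \<Rightarrow> bool" where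
  "bolza_solution T \<Omega> U \<xi>0 f f0 m g q h x0 u0 \<longleftrightarrow>
     bolza_admissible T \<Omega> U \<xi>0 f m g q h x0 u0 \<and>
     (\<forall>x u. bolza_admissible T \<Omega> U \<xi>0 f m g q h x u \<longrightarrow>
        bolza_objective T f0 g x u \<le> bolza_objective T f0 g x0 u0)"

definition H_B ::
    "(real \<Rightarrow> 'a::real_normed_vector \<Rightarrow> 'u \<Rightarrow> real) \<Rightarrow> (real \<Rightarrow> 'a \<Rightarrow> 'u \<Rightarrow> 'a) \<Rightarrow>
     real \<Rightarrow> 'a \<Rightarrow> 'u \<Rightarrow> ('a \<Rightarrow>\<^sub>L real) \<Rightarrow> real \<Rightarrow> real" where
  "H_B f0 f t \<xi> \<zeta> p l = l * f0 t \<xi> \<zeta> + blinfun_apply p (f t \<xi> \<zeta>)"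

end

theory Submission
  imports Defs
begin

text \<open>
  The theorem is proved with needle variations. The running reward is first absorbed into the
  state: with an additional real state \<open>y' = f0 t x u\<close> the objective becomes a function of the
  endpoint \<open>(x T, y T)\<close> only, and the costate of the new coordinate is a constant, the multiplier
  \<open>l 0\<close> (\<open>augmented_controlled_trajectory\<close>, \<open>costate_equation\<close>). So let \<open>F\<close> be the augmented dynamics,
  \<open>A\<close> its state derivative along the optimal trajectory, and \<open>P\<close> the solution of
  \<open>P' = - P o\<^sub>L A\<close>, \<open>P T = id_blinfun\<close>.

  A needle variation replaces the optimal control by a value \<open>\<zeta> i\<close> on an interval of length \<open>a i\<close>
  that starts near the instant \<open>\<tau> i\<close>. A function that is bounded on every compact set is bounded
  on a neighbourhood of a compact set, so the bounds on the Gateaux differentials make \<open>F\<close>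
  Lipschitz in the state, in a tube around the trajectory and uniformly over a compact set of
  control values (\<open>gateaux_tube_lipschitz\<close>). Hence short needles yield trajectories on the whole
  interval whose endpoint depends continuously on the lengths (\<open>perturbed_trajectory_exists\<close>,
  \<open>perturbed_endpoint_continuous\<close>). Integrating the derivative of \<open>P t (x t - x\<^sub>0 t)\<close> shows that
  the first-order change of the endpoint is the sum of \<open>a i *\<^sub>R P (\<tau> i) (F \<dots> (\<zeta> i) - F \<dots> (u\<^sub>0 (\<tau> i)))\<close>
  (\<open>perturbed_endpoint_derivative\<close>). The Frechet derivatives exist only along the
  trajectory and their remainders are not uniform in time, but they are dominated, and
  dominated convergence suffices.

  Consider the cone of first-order changes of the objective, the active inequality constraints
  and the equality constraints, enlarged by the directions that make an objective or an
  inequality worse. If it were the whole space, finitely many needles could move the equality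
  constraints in all directions while improving the other functions; the Poincare-Miranda theorem would
  solve the equality constraints exactly and contradict optimality. Differentiability at the single
  point together with continuity of the equality constraints is enough for this, and Hadamard
  differentiability is what is needed to compose with endpoints of the form
  \<open>x\<^sub>0 T + r *\<^sub>R (w + o(1))\<close>. So the cone has a supporting functional (\<open>multiplier_rule\<close>), whose
  coefficients are the multipliers. Pulling the functional back with \<open>P\<close> gives the costate; its
  sign on the needle directions is the maximum condition, and that condition forces the
  Hamiltonian to be continuous across the jumps of the control (\<open>maximized_along_control\<close>).
\<close>

section \<open>Piecewise continuous functions and their primitives\<close>

text \<open>
  One-sided limits make the function nearly constant on both sides of every point; a division
  fine for these neighbourhoods gives uniform approximations by integrable step functions.
\<close>

lemma regulated_integrable:
  fixes f :: "real \<Rightarrow> 'a::banach"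
  assumes right: "\<And>t. a \<le> t \<Longrightarrow> t < b \<Longrightarrow> \<exists>l. (f \<longlongrightarrow> l) (at_right t)"
    and left: "\<And>t. a < t \<Longrightarrow> t \<le> b \<Longrightarrow> \<exists>l. (f \<longlongrightarrow> l) (at_left t)"
  shows "f integrable_on {a..b}"
proof -
  have "f integrable_on cbox a b"
  proof (rule integrable_uniform_limit)
    fix e :: real assume e: "e > 0"
    have local_step: "\<exists>d>0. \<forall>u v. x \<in> {u..v} \<longrightarrow> {u..v} \<subseteq> ball x d \<inter> {a..b} \<longrightarrow>
        (\<exists>g. (\<forall>s\<in>{u..v}. norm (f s - g s) \<le> e) \<and> g integrable_on {u..v})" if x: "x \<in> {a..b}" for x
    proof -
      have "\<exists>d>0. \<exists>l. \<forall>s. x < s \<and> s < x + d \<and> s \<le> b \<longrightarrow> norm (f s - l) \<le> e"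
      proof (cases "x < b")
        case True
        then obtain l where "(f \<longlongrightarrow> l) (at_right x)" using right x by auto
        then have "\<forall>\<^sub>F s in at_right x. dist (f s) l < e" using e by (rule tendstoD)
        then obtain c where "c > x" "\<And>s. x < s \<Longrightarrow> s < c \<Longrightarrow> dist (f s) l < e"
          using True by (auto simp: eventually_at_right[of x b])
        then show ?thesis by (intro exI[of _ "c - x"] conjI exI[of _ l]) (auto simp: dist_norm less_imp_le)
      qed (use x in \<open>auto intro!: exI[of _ 1]\<close>)
      then obtain d1 l1 where d1: "d1 > 0" "\<And>s. x < s \<Longrightarrow> s < x + d1 \<Longrightarrow> s \<le> b \<Longrightarrow> norm (f s - l1) \<le> e"
        by blast
      have "\<exists>d>0. \<exists>l. \<forall>s. s < x \<and> x - d < s \<and> a \<le> s \<longrightarrow> norm (f s - l) \<le> e"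
      proof (cases "a < x")
        case True
        then obtain l where "(f \<longlongrightarrow> l) (at_left x)" using left x by auto
        then have "\<forall>\<^sub>F s in at_left x. dist (f s) l < e" using e by (rule tendstoD)
        then obtain c where "c < x" "\<And>s. c < s \<Longrightarrow> s < x \<Longrightarrow> dist (f s) l < e"
          using True by (auto simp: eventually_at_left[of a x])
        then show ?thesis by (intro exI[of _ "x - c"] conjI exI[of _ l]) (auto simp: dist_norm less_imp_le)
      qed (use x in \<open>auto intro!: exI[of _ 1]\<close>)
      then obtain d2 l2 where d2: "d2 > 0" "\<And>s. s < x \<Longrightarrow> x - d2 < s \<Longrightarrow> a \<le> s \<Longrightarrow> norm (f s - l2) \<le> e"
        by blast
      define g where "g s = (if s < x then l2 else if x < s then l1 else f x)" for s
      have "\<exists>g. (\<forall>s\<in>{u..v}. norm (f s - g s) \<le> e) \<and> g integrable_on {u..v}"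
        if uv: "x \<in> {u..v}" "{u..v} \<subseteq> ball x (min d1 d2) \<inter> {a..b}" for u v
      proof (intro exI[of _ g] conjI ballI)
        fix s assume "s \<in> {u..v}"
        then have "dist x s < min d1 d2" "a \<le> s" "s \<le> b" using uv(2) by auto
        then show "norm (f s - g s) \<le> e"
          using d1(2)[of s] d2(2)[of s] e unfolding g_def dist_real_def by auto
      next
        have "g integrable_on {u..x}"
          by (rule integrable_spike_finite[of "{x}" _ _ "\<lambda>_. l2"]) (auto simp: g_def)
        moreover have "g integrable_on {x..v}"
          by (rule integrable_spike_finite[of "{x}" _ _ "\<lambda>_. l1"]) (auto simp: g_def)
        ultimately show "g integrable_on {u..v}"
          using uv(1) by (intro Henstock_Kurzweil_Integration.integrable_combine[of u x v]) auto
      qed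
      then show ?thesis using d1(1) d2(1) by (intro exI[of _ "min d1 d2"]) auto
    qed
    have "\<forall>x. \<exists>d>0. x \<in> {a..b} \<longrightarrow> (\<forall>u v. x \<in> {u..v} \<longrightarrow> {u..v} \<subseteq> ball x d \<inter> {a..b} \<longrightarrow>
        (\<exists>g. (\<forall>s\<in>{u..v}. norm (f s - g s) \<le> e) \<and> g integrable_on {u..v}))"
      using local_step zero_less_one by blast
    then obtain d where d: "\<And>x. d x > 0"
      "\<And>x u v. x \<in> {a..b} \<Longrightarrow> x \<in> {u..v} \<Longrightarrow> {u..v} \<subseteq> ball x (d x) \<inter> {a..b} \<Longrightarrow>
        \<exists>g. (\<forall>s\<in>{u..v}. norm (f s - g s) \<le> e) \<and> g integrable_on {u..v}"
      by metis
    obtain p where p: "p tagged_division_of {a..b}" "(\<lambda>x. ball x (d x)) fine p"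
      by (rule fine_division_exists_real[of "\<lambda>x. ball x (d x)" a b]) (use d(1) in \<open>auto simp: gauge_def\<close>)
    have div: "(snd ` p) division_of cbox a b" using division_of_tagged_division[OF p(1)] by simp
    have approx: "\<exists>g. (\<forall>x\<in>i. norm (f x - g x) \<le> e) \<and> g integrable_on i" if i: "i \<in> snd ` p" for i
    proof -
      obtain x where xi: "(x, i) \<in> p" using i by auto
      then have "x \<in> i" "i \<subseteq> {a..b}" using tagged_division_ofD[OF p(1)] by blast+
      moreover obtain u v where uv: "i = {u..v}" using tagged_division_ofD(4)[OF p(1) xi] by auto
      moreover have "i \<subseteq> ball x (d x)" using p(2) xi by (auto simp: fine_def)
      ultimately show ?thesis unfolding uv by (intro d(2)) auto
    qed
    obtain g where "\<forall>x\<in>cbox a b. norm (f x - g x) \<le> e" "g integrable_on cbox a b"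
      by (rule approximable_on_division[OF less_imp_le[OF e] div ballI[OF approx]])
    then show "\<exists>g. (\<forall>x\<in>cbox a b. norm (f x - g x) \<le> e) \<and> g integrable_on cbox a b" by blast
  qed
  then show ?thesis by simp
qed

text \<open>
  A normal form of \<open>NPC0_R T W\<close>: the case distinction between continuous and piecewise
  continuous functions is gone, and the subdivision is visible because needle variations have
  to enlarge it.
\<close>

definition normal_pc :: "real \<Rightarrow> 'w::t2_space set \<Rightarrow> real set \<Rightarrow> (real \<Rightarrow> 'w) \<Rightarrow> bool" where
  "normal_pc T W S u \<longleftrightarrow> subdivision T S \<and> (\<forall>t\<in>{0..T}. u t \<in> W) \<and>
     (\<forall>t\<in>{0..T} - S. isCont u t) \<and> (\<forall>t\<in>{0..<T}. (u \<longlongrightarrow> u t) (at_right t)) \<and>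
     (\<forall>t\<in>{0<..T}. \<exists>l\<in>W. (u \<longlongrightarrow> l) (at_left t)) \<and> (u \<longlongrightarrow> u T) (at_left T)"

lemma normal_pcD:
  assumes "normal_pc T W S u"
  shows "finite S" "0 \<in> S" "T \<in> S" "S \<subseteq> {0..T}"
    and "t \<in> {0..T} \<Longrightarrow> u t \<in> W" "t \<in> {0..T} \<Longrightarrow> t \<notin> S \<Longrightarrow> isCont u t"
    and "0 \<le> t \<Longrightarrow> t < T \<Longrightarrow> (u \<longlongrightarrow> u t) (at_right t)"
    and "0 < t \<Longrightarrow> t \<le> T \<Longrightarrow> \<exists>l\<in>W. (u \<longlongrightarrow> l) (at_left t)"
    and "(u \<longlongrightarrow> u T) (at_left T)"
  using assms unfolding normal_pc_def subdivision_def by auto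

lemma at_right_le_within_Icc: "t < T \<Longrightarrow> 0 \<le> t \<Longrightarrow> at_right t \<le> at t within {0..T::real}"
  by (subst at_within_Icc_at_right[of t T, symmetric]) (auto intro: at_le)

lemma at_left_le_within_Icc: "0 < t \<Longrightarrow> t \<le> T \<Longrightarrow> at_left t \<le> at t within {0..T::real}"
  by (subst at_within_Icc_at_left[of 0 t, symmetric]) (auto intro: at_le)

lemma NPC0_R_iff_normal_pc:
  assumes T: "T > 0"
  shows "u \<in> NPC0_R T W \<longleftrightarrow> (\<exists>S. normal_pc T W S u)"
proof
  assume u: "u \<in> NPC0_R T W"
  then have W: "\<And>t. t \<in> {0..T} \<Longrightarrow> u t \<in> W"
    and r: "\<And>t. t \<in> {0..<T} \<Longrightarrow> (u \<longlongrightarrow> u t) (at_right t)" and l: "(u \<longlongrightarrow> u T) (at_left T)"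
    by (simp_all add: NPC0_R_def PC0_def continuous_within image_subset_iff)
  show "\<exists>S. normal_pc T W S u"
  proof (cases "continuous_on {0..T} u")
    case True
    then have lim: "(u \<longlongrightarrow> u t) (at t within {0..T})" if "t \<in> {0..T}" for t
      using that by (auto simp: continuous_on_def)
    have "normal_pc T W {0, T} u"
      unfolding normal_pc_def subdivision_def
    proof (intro conjI ballI)
      fix t assume "t \<in> {0..T} - {0, T}"
      then show "isCont u t" using lim[of t] by (auto simp: isCont_def at_within_Icc_at)
    next
      fix t assume t: "t \<in> {0<..T}"
      then have "(u \<longlongrightarrow> u t) (at_left t)" using at_left_le_within_Icc[of t T] lim[of t] by (auto intro: tendsto_mono)
      then show "\<exists>l\<in>W. (u \<longlongrightarrow> l) (at_left t)" using W[of t] t by auto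
    qed (use T W r l in auto)
    then show ?thesis by blast
  next
    case False
    then have "\<exists>S. subdivision T S \<and> (\<forall>t\<in>{0..T} - S. isCont u t) \<and>
        (\<forall>s\<in>S - {0}. \<exists>l\<in>W. (u \<longlongrightarrow> l) (at_left s))"
      using u unfolding NPC0_R_def PC0_def by auto
    then obtain S where S: "subdivision T S" "\<And>t. t \<in> {0..T} - S \<Longrightarrow> isCont u t"
        "\<And>s. s \<in> S - {0} \<Longrightarrow> \<exists>l\<in>W. (u \<longlongrightarrow> l) (at_left s)"
      by blast
    have "\<exists>l\<in>W. (u \<longlongrightarrow> l) (at_left t)" if t: "t \<in> {0<..T}" for t
    proof (cases "t \<in> S")
      case True
      then show ?thesis using S(3)[of t] t by auto
    next
      case False
      then have "(u \<longlongrightarrow> u t) (at_left t)" using S(2)[of t] t by (simp add: isCont_def filterlim_at_split)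
      then show ?thesis using W[of t] t by (intro bexI[of _ "u t"]) auto
    qed
    then have "normal_pc T W S u" unfolding normal_pc_def using S W r l by blast
    then show ?thesis by blast
  qed
next
  assume "\<exists>S. normal_pc T W S u"
  then obtain S where S: "normal_pc T W S u" by blast
  note D = normal_pcD[OF S]
  have "u \<in> PC0 T W"
    unfolding PC0_def
  proof (intro CollectI conjI disjI2 exI[of _ S])
    show "\<forall>s\<in>S - {T}. \<exists>l\<in>W. (u \<longlongrightarrow> l) (at_right s)"
    proof
      fix s assume "s \<in> S - {T}"
      then have "0 \<le> s" "s < T" using D(4) by (auto simp: less_le)
      then show "\<exists>l\<in>W. (u \<longlongrightarrow> l) (at_right s)" using D(5)[of s] D(7)[of s] by auto
    qed
    show "\<forall>s\<in>S - {0}. \<exists>l\<in>W. (u \<longlongrightarrow> l) (at_left s)"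
    proof
      fix s assume "s \<in> S - {0}"
      then have "0 < s" "s \<le> T" using D(4) by (auto simp: less_le)
      then show "\<exists>l\<in>W. (u \<longlongrightarrow> l) (at_left s)" by (rule D(8))
    qed
  qed (use S D in \<open>auto simp: normal_pc_def\<close>)
  then show "u \<in> NPC0_R T W"
    unfolding NPC0_R_def using D by (auto simp: continuous_within)
qed

text \<open>
  The filter \<open>F\<close> stands for a one-sided or two-sided approach to \<open>t\<close> and \<open>l\<close> for the
  corresponding limit of the control, so one statement covers continuity points and jumps.
\<close>

lemma tendsto_along_control:
  assumes F: "F \<le> at t within {0..T}" and t: "t \<in> {0..T}"
    and u: "(u \<longlongrightarrow> l) F" "l \<in> U" "\<And>s. s \<in> {0..T} \<Longrightarrow> u s \<in> U"
    and y: "continuous_on {0..T} y" "y ` {0..T} \<subseteq> W"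
    and \<Phi>: "continuous_on ({0..T} \<times> W \<times> U) \<Phi>"
  shows "((\<lambda>s. \<Phi> (s, y s, u s)) \<longlongrightarrow> \<Phi> (t, y t, l)) F"
proof (rule continuous_on_tendsto_compose[OF \<Phi>])
  have "(y \<longlongrightarrow> y t) (at t within {0..T})" using y(1) t by (simp add: continuous_on_def)
  then have "(y \<longlongrightarrow> y t) F" by (rule tendsto_mono[OF F])
  moreover have "((\<lambda>s. s) \<longlongrightarrow> t) F" using F by (auto intro: tendsto_mono tendsto_ident_at)
  ultimately show "((\<lambda>s. (s, y s, u s)) \<longlongrightarrow> (t, y t, l)) F" by (intro tendsto_Pair u(1))
  show "(t, y t, l) \<in> {0..T} \<times> W \<times> U" using t y(2) u(2) by auto
  have "\<forall>\<^sub>F s in at t within {0..T}. s \<in> {0..T}" by (simp add: eventually_at_filter)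
  then have "\<forall>\<^sub>F s in F. s \<in> {0..T}" by (rule filter_leD[OF F])
  then show "\<forall>\<^sub>F s in F. (s, y s, u s) \<in> {0..T} \<times> W \<times> U"
    by eventually_elim (use y(2) u(3) in auto)
qed

lemma normal_pc_compose:
  fixes \<Phi> :: "real \<times> 'a::topological_space \<times> 'u::t2_space \<Rightarrow> 'w::t2_space"
  assumes u: "normal_pc T U S u" and T: "T > 0"
    and y: "continuous_on {0..T} y" "y ` {0..T} \<subseteq> W"
    and \<Phi>: "continuous_on ({0..T} \<times> W \<times> U) \<Phi>"
  shows "normal_pc T UNIV S (\<lambda>s. \<Phi> (s, y s, u s))"
proof -
  note D = normal_pcD[OF u]
  note lim = tendsto_along_control[OF _ _ _ _ D(5) y \<Phi>]
  show ?thesis unfolding normal_pc_def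
  proof (intro conjI ballI)
    fix t assume t: "t \<in> {0..T} - S"
    then have t': "0 < t" "t < T" using D(2,3) by (auto simp: less_le)
    then have "at t \<le> at t within {0..T}" by (simp add: at_within_Icc_at)
    then show "isCont (\<lambda>s. \<Phi> (s, y s, u s)) t"
      unfolding isCont_def using t D(5)[of t] D(6)[of t] by (intro lim) (auto simp: isCont_def)
  next
    fix t assume "t \<in> {0..<T}"
    then show "((\<lambda>s. \<Phi> (s, y s, u s)) \<longlongrightarrow> \<Phi> (t, y t, u t)) (at_right t)"
      using D(5)[of t] D(7)[of t] by (intro lim at_right_le_within_Icc) auto
  next
    fix t assume t: "t \<in> {0<..T}"
    then obtain l where l: "l \<in> U" "(u \<longlongrightarrow> l) (at_left t)" using D(8)[of t] by auto
    have "((\<lambda>s. \<Phi> (s, y s, u s)) \<longlongrightarrow> \<Phi> (t, y t, l)) (at_left t)"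
      by (intro lim at_left_le_within_Icc) (use t l in auto)
    then show "\<exists>l\<in>UNIV. ((\<lambda>s. \<Phi> (s, y s, u s)) \<longlongrightarrow> l) (at_left t)" by blast
  next
    show "((\<lambda>s. \<Phi> (s, y s, u s)) \<longlongrightarrow> \<Phi> (T, y T, u T)) (at_left T)"
      using D(5)[of T] D(9) T by (intro lim at_left_le_within_Icc) auto
  qed (use u in \<open>auto simp: normal_pc_def\<close>)
qed

lemma normal_pc_integrable:
  fixes \<phi> :: "real \<Rightarrow> 'a::banach"
  assumes "normal_pc T UNIV S \<phi>" "0 \<le> a" "b \<le> T"
  shows "\<phi> integrable_on {a..b}"
proof (rule regulated_integrable)
  note D = normal_pcD[OF assms(1)]
  show "\<exists>l. (\<phi> \<longlongrightarrow> l) (at_right t)" if "a \<le> t" "t < b" for t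
    using D(7)[of t] that assms by force
  show "\<exists>l. (\<phi> \<longlongrightarrow> l) (at_left t)" if "a < t" "t \<le> b" for t
    using D(8)[of t] that assms by force
qed

text \<open>
  The interval \<open>{c..d}\<close> may have \<open>t\<close> as an endpoint, which gives one-sided derivatives.
  Redefining the integrand at \<open>t\<close> by its limit changes no integral and makes it continuous
  there.
\<close>

lemma primitive_one_sided_derivative:
  fixes \<phi> :: "real \<Rightarrow> 'a::banach"
  assumes \<phi>: "\<phi> integrable_on {0..T}" and x: "\<And>t. t \<in> {0..T} \<Longrightarrow> x t = x 0 + integral {0..t} \<phi>"
    and J: "{c..d} \<subseteq> {0..T}" "t \<in> {c..d}" and l: "(\<phi> \<longlongrightarrow> l) (at t within {c..d})"
  shows "(x has_vector_derivative l) (at t within {c..d})"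
proof -
  define \<phi>' where "\<phi>' = \<phi>(t := l)"
  have cT: "0 \<le> c" "d \<le> T" "c \<le> d" using J by auto
  have i: "\<phi> integrable_on {c..d}" using \<phi> J(1) by (rule integrable_on_subinterval)
  have "\<phi>' integrable_on {c..d}"
    by (rule integrable_spike_finite[OF _ _ i, of "{t}"]) (auto simp: \<phi>'_def)
  moreover have "(\<phi>' \<longlongrightarrow> \<phi>' t) (at t within {c..d})"
    using l by (auto simp: \<phi>'_def elim!: Lim_transform_eventually simp: eventually_at_filter)
  ultimately have "((\<lambda>u. integral {c..u} \<phi>') has_vector_derivative \<phi>' t) (at t within ({c..d} - {}))"
    using J(2) by (intro integral_has_vector_derivative_continuous_at) (auto simp: continuous_within)
  then have "((\<lambda>u. x c + integral {c..u} \<phi>') has_vector_derivative l) (at t within {c..d})"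
    by (auto simp: \<phi>'_def intro!: derivative_eq_intros)
  moreover have "x u = x c + integral {c..u} \<phi>'" if u: "u \<in> {c..d}" for u
  proof -
    have "\<phi> integrable_on {0..u}" using \<phi> u cT by (auto intro: integrable_on_subinterval)
    then have "integral {0..c} \<phi> + integral {c..u} \<phi> = integral {0..u} \<phi>"
      using u cT by (intro Henstock_Kurzweil_Integration.integral_combine) auto
    moreover have "integral {c..u} \<phi>' = integral {c..u} \<phi>"
      by (rule integral_spike[of "{t}"]) (auto simp: \<phi>'_def)
    ultimately show ?thesis
      using x[of u] x[of c] u cT by (auto simp: add.assoc)
  qed
  ultimately show ?thesis by (rule has_vector_derivative_transform[OF J(2), rotated])
qed

text \<open>
  Solutions of integral equations enter the problem through this lemma: both states and
  costates are primitives of normalized piecewise continuous functions, hence in the class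
  \<open>PC1\<close> with the integrand as extended derivative.
\<close>

lemma primitive_of_normal_pc:
  fixes \<phi> :: "real \<Rightarrow> 'a::banach"
  assumes \<phi>: "normal_pc T UNIV S \<phi>" and T: "T > 0"
    and x: "\<And>t. t \<in> {0..T} \<Longrightarrow> x t = x 0 + integral {0..t} \<phi>"
  shows "continuous_on {0..T} x" "PC1_subdivision T x S" "t \<in> {0..T} \<Longrightarrow> ext_deriv T x t = \<phi> t"
    and "t \<in> {0..T} - S \<Longrightarrow> (x has_vector_derivative \<phi> t) (at t)"
proof -
  note D = normal_pcD[OF \<phi>]
  have i: "\<phi> integrable_on {0..T}" by (rule normal_pc_integrable[OF \<phi>]) auto
  have "continuous_on {0..T} (\<lambda>t. x 0 + integral {0..t} \<phi>)"
    by (intro continuous_intros indefinite_integral_continuous_1 i)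
  then show "continuous_on {0..T} x" by (rule continuous_on_eq) (rule x[symmetric])
  note der = primitive_one_sided_derivative[where x = x, OF i x]
  have right: "(x has_vector_derivative \<phi> t) (at_right t)" if "0 \<le> t" "t < T" for t
    using der[of t T t "\<phi> t"] D(7)[of t] that by (simp add: at_within_Icc_at_right)
  have left: "(x has_vector_derivative l) (at_left t)" if "0 < t" "t \<le> T" "(\<phi> \<longlongrightarrow> l) (at_left t)" for t l
    using der[of 0 t t l] that by (simp add: at_within_Icc_at_left)
  have interior: "(x has_vector_derivative \<phi> t) (at t)" if t: "t \<in> {0..T} - S" for t
  proof -
    have t': "0 < t" "t < T" using t D(2,3) by (auto simp: less_le)
    then show ?thesis using der[of 0 T t "\<phi> t"] D(6)[of t] t
      by (simp add: isCont_def at_within_Icc_at)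
  qed
  then show "t \<in> {0..T} - S \<Longrightarrow> (x has_vector_derivative \<phi> t) (at t)" .
  have vd: "vector_derivative x (at t) = \<phi> t" if "t \<in> {0..T} - S" for t
    using interior[OF that] by (rule vector_derivative_at)
  have ev: "\<forall>\<^sub>F s in at t. s \<notin> S" for t
    using islimpt_finite[OF D(1), of t] by (simp add: islimpt_iff_eventually)
  have ev_r: "\<forall>\<^sub>F s in at_right t. \<phi> s = vector_derivative x (at s)" if t: "0 \<le> t" "t < T" for t
  proof -
    have "\<forall>\<^sub>F s in at_right t. s \<notin> S" using ev[of t] by (rule filter_leD[OF at_le, rotated]) simp
    moreover have "\<forall>\<^sub>F s in at_right t. s \<in> {t<..<T}" using t(2) by (rule eventually_at_right_real)
    ultimately show ?thesis by eventually_elim (use vd t in auto)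
  qed
  have ev_l: "\<forall>\<^sub>F s in at_left t. \<phi> s = vector_derivative x (at s)" if t: "0 < t" "t \<le> T" for t
  proof -
    have "\<forall>\<^sub>F s in at_left t. s \<notin> S" using ev[of t] by (rule filter_leD[OF at_le, rotated]) simp
    moreover have "\<forall>\<^sub>F s in at_left t. s \<in> {0<..<t}" using t(1) by (rule eventually_at_left_real)
    ultimately show ?thesis by eventually_elim (use vd t in auto)
  qed
  show "PC1_subdivision T x S"
    unfolding PC1_subdivision_def
  proof (intro conjI ballI)
    show "subdivision T S" using \<phi> by (simp add: normal_pc_def)
  next
    fix t assume t: "t \<in> {0..T} - S"
    then have t': "0 < t" "t < T" using D(2,3) by (auto simp: less_le)
    show "x differentiable (at t)" using interior[OF t] by (rule differentiableI_vector)
    have "\<forall>\<^sub>F s in at t. s \<in> {0<..<T}" using t' by (intro eventually_at_in_open') auto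
    with ev[of t] have "\<forall>\<^sub>F s in at t. \<phi> s = vector_derivative x (at s)"
      by eventually_elim (use vd in auto)
    moreover have "(\<phi> \<longlongrightarrow> \<phi> t) (at t)" using D(6)[of t] t by (simp add: isCont_def)
    ultimately have "((\<lambda>s. vector_derivative x (at s)) \<longlongrightarrow> \<phi> t) (at t)"
      by (rule Lim_transform_eventually[rotated])
    then show "isCont (\<lambda>s. vector_derivative x (at s)) t" using vd[OF t] by (simp add: isCont_def)
  next
    fix s assume "s \<in> S - {T}"
    then have s: "0 \<le> s" "s < T" using D(4) by (auto simp: less_le)
    show "\<exists>d. (x has_vector_derivative d) (at_right s) \<and>
        ((\<lambda>t. vector_derivative x (at t)) \<longlongrightarrow> d) (at_right s)"
      using right[OF s] Lim_transform_eventually[OF D(7)[OF s] ev_r[OF s]] by blast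
  next
    fix s assume "s \<in> S - {0}"
    then have s: "0 < s" "s \<le> T" using D(4) by (auto simp: less_le)
    obtain l where l: "(\<phi> \<longlongrightarrow> l) (at_left s)" using D(8)[OF s] by blast
    show "\<exists>d. (x has_vector_derivative d) (at_left s) \<and>
        ((\<lambda>t. vector_derivative x (at t)) \<longlongrightarrow> d) (at_left s)"
      using left[OF s l] Lim_transform_eventually[OF l ev_l[OF s]] by blast
  qed
  show "ext_deriv T x t = \<phi> t" if "t \<in> {0..T}" for t
  proof (cases "t = T")
    case True
    then show ?thesis using left[OF T order_refl D(9)]
      by (auto simp: ext_deriv_def intro!: vector_derivative_within)
  next
    case False
    then show ?thesis using right[of t] that
      by (auto simp: ext_deriv_def intro!: vector_derivative_within)
  qed
qed

text \<open>
  The converse passage, from the differential equation with extended derivative to the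
  integral equation: finitely many exceptional points do not disturb the fundamental theorem.
\<close>

lemma PC1_integral_ext_deriv:
  fixes x :: "real \<Rightarrow> 'a::banach"
  assumes T: "T > 0" and x: "x \<in> PC1 T W" and \<phi>: "\<And>t. t \<in> {0..T} \<Longrightarrow> ext_deriv T x t = \<phi> t"
    and t: "t \<in> {0..T}"
  shows "(\<phi> has_integral x t - x 0) {0..t}"
proof -
  obtain S where S: "PC1_subdivision T x S"
    using x C1_on_Icc_subdivision[OF T] unfolding PC1_def by blast
  show ?thesis
  proof (rule fundamental_theorem_of_calculus_interior_strong)
    show "finite S" using S by (simp add: PC1_subdivision_def subdivision_def)
    show "continuous_on {0..t} x" using x t by (auto simp: PC1_def intro: continuous_on_subset)
    fix s assume s: "s \<in> {0<..<t} - S"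
    then have s': "s \<in> {0..T}" "s \<notin> S" using t by auto
    then have "x differentiable (at s)" using S by (simp add: PC1_subdivision_def)
    then have "(x has_vector_derivative vector_derivative x (at s)) (at s)"
      by (simp add: vector_derivative_works)
    moreover have "vector_derivative x (at s) = \<phi> s"
      using ext_deriv_subdivision[OF S s'(1)] s'(2) \<phi>[OF s'(1)] by simp
    ultimately show "(x has_vector_derivative \<phi> s) (at s)" by simp
  qed (use t in auto)
qed

section \<open>Integral equations and Lipschitz bounds\<close>

lemma exp_weight_integral:
  fixes L :: real
  assumes "L > 0" "t \<ge> 0"
  shows "((\<lambda>s. L * exp (2 * L * s)) has_integral (exp (2 * L * t) - 1) / 2) {0..t}"
proof -
  have "((\<lambda>s. L * exp (2 * L * s)) has_integral exp (2 * L * t) / 2 - exp (2 * L * 0) / 2) {0..t}"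
    by (rule fundamental_theorem_of_calculus[OF assms(2)])
      (auto intro!: derivative_eq_intros simp flip: has_real_derivative_iff_has_vector_derivative)
  then show ?thesis by (simp add: diff_divide_distrib)
qed

text \<open>
  The maximum \<open>m\<close> of \<open>\<psi> t * exp (- 2 * L * t)\<close> satisfies \<open>m \<le> c + m / 2\<close>, because the
  weighted integral absorbs at most half of it.
\<close>

lemma gronwall_weak:
  fixes \<psi> :: "real \<Rightarrow> real"
  assumes L: "L > 0" and c: "c \<ge> 0" and \<psi>: "continuous_on {0..T} \<psi>"
    and le: "\<And>t. t \<in> {0..T} \<Longrightarrow> \<psi> t \<le> c + L * integral {0..t} \<psi>" and t: "t \<in> {0..T}"
  shows "\<psi> t \<le> 2 * c * exp (2 * L * t)"
proof -
  have "continuous_on {0..T} (\<lambda>t. exp (- (2 * L * t)) * \<psi> t)" by (intro continuous_intros \<psi>)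
  then obtain r where r: "r \<in> {0..T}"
    and max: "\<And>s. s \<in> {0..T} \<Longrightarrow> exp (- (2 * L * s)) * \<psi> s \<le> exp (- (2 * L * r)) * \<psi> r"
    using continuous_attains_sup[of "{0..T}" "\<lambda>t. exp (- (2 * L * t)) * \<psi> t"] t by force
  define m where "m = exp (- (2 * L * r)) * \<psi> r"
  have \<psi>_le: "\<psi> s \<le> m * exp (2 * L * s)" if "s \<in> {0..T}" for s
    using max[OF that] by (simp add: m_def exp_minus field_simps)
  have "m \<le> 2 * c"
  proof (cases "m \<le> 0")
    case False
    have w: "((\<lambda>s. m * (L * exp (2 * L * s))) has_integral m * ((exp (2 * L * r) - 1) / 2)) {0..r}"
      using r by (intro has_integral_mult_right exp_weight_integral L) auto
    have "L * integral {0..r} \<psi> = integral {0..r} (\<lambda>s. L * \<psi> s)" by simp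
    also have "\<dots> \<le> m * ((exp (2 * L * r) - 1) / 2)"
    proof (rule has_integral_le[OF integrable_integral w])
      have "continuous_on {0..r} \<psi>" using \<psi> by (rule continuous_on_subset) (use r in auto)
      then show "(\<lambda>s. L * \<psi> s) integrable_on {0..r}" by (intro integrable_continuous_real continuous_intros)
      fix s assume "s \<in> {0..r}"
      then show "L * \<psi> s \<le> m * (L * exp (2 * L * s))" using \<psi>_le[of s] r L by simp
    qed
    also have "\<dots> \<le> m * exp (2 * L * r) / 2" using False by simp
    finally have "\<psi> r \<le> c + m * exp (2 * L * r) / 2" using le[OF r] by simp
    moreover have "\<psi> r = m * exp (2 * L * r)" by (simp add: m_def exp_minus field_simps)
    ultimately have "m * exp (2 * L * r) \<le> 2 * c" by linarith
    moreover have "m * 1 \<le> m * exp (2 * L * r)" using False L r by (intro mult_left_mono) auto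
    ultimately show ?thesis by simp
  qed (use c in simp)
  then have "m * exp (2 * L * t) \<le> 2 * c * exp (2 * L * t)" by (intro mult_right_mono) auto
  with \<psi>_le[OF t] show ?thesis by (rule order_trans)
qed

text \<open>
  The same weight makes the integral operator a contraction with factor one half on the whole
  interval, however long it is.
\<close>

lemma integral_equation_solution:
  fixes G :: "real \<Rightarrow> 'b::banach \<Rightarrow> 'b"
  assumes T: "T \<ge> 0" and L: "L > 0"
    and lip: "\<And>t x y. t \<in> {0..T} \<Longrightarrow> norm (G t x - G t y) \<le> L * norm (x - y)"
    and int: "\<And>x. continuous_on {0..T} x \<Longrightarrow> (\<lambda>s. G s (x s)) integrable_on {0..T}"
  shows "\<exists>x. continuous_on {0..T} x \<and> (\<forall>t\<in>{0..T}. x t = \<xi> + integral {0..t} (\<lambda>s. G s (x s)))"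
proof -
  define E where "E y s = exp (2 * L * s) *\<^sub>R apply_bcontfun y s" for y :: "real \<Rightarrow>\<^sub>C 'b" and s
  have E: "continuous_on {0..T} (E y)" for y
    unfolding E_def by (intro continuous_intros) auto
  have int_t: "(\<lambda>s. G s (E y s)) integrable_on {0..t}" if "t \<in> {0..T}" for y t
    using int[OF E[of y]] by (rule integrable_on_subinterval) (use that in auto)
  \<comment>
    \<open>the fixed point is sought for the weighted function \<open>exp (- 2 * L * t) *\<^sub>R x t\<close>,
    whose supremum norm is the weighted norm of \<open>x\<close>\<close>
  define \<Psi> where "\<Psi> y t = exp (- (2 * L * t)) *\<^sub>R (\<xi> + integral {0..t} (\<lambda>s. G s (E y s)))" for y t
  have \<Psi>: "continuous_on (cbox 0 T) (\<Psi> y)" for y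
    unfolding \<Psi>_def box_real by (intro continuous_intros indefinite_integral_continuous_1 int E)
  have "\<exists>g :: real \<Rightarrow>\<^sub>C 'b. \<forall>t. apply_bcontfun g t = \<Psi> y (clamp 0 T t)" for y
    by (rule continuous_on_cbox_bcontfunE[OF \<Psi>[of y]]) blast
  then obtain \<Theta> where \<Theta>: "\<And>y t. apply_bcontfun (\<Theta> y) t = \<Psi> y (clamp 0 T t)" by metis
  have clamp: "clamp 0 T t \<in> {0..T}" for t
    using clamp_in_interval[of 0 T t] T by simp
  have "dist (\<Theta> y) (\<Theta> z) \<le> 1/2 * dist y z" for y z
  proof (rule dist_bound)
    fix t'
    define t where "t = clamp 0 T t'"
    have t: "t \<in> {0..T}" unfolding t_def by (rule clamp)
    have w: "((\<lambda>s. dist y z * (L * exp (2 * L * s))) has_integral dist y z * ((exp (2 * L * t) - 1) / 2)) {0..t}"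
      using t by (intro has_integral_mult_right exp_weight_integral L) auto
    have "norm (integral {0..t} (\<lambda>s. G s (E y s) - G s (E z s))) \<le> integral {0..t} (\<lambda>s. dist y z * (L * exp (2 * L * s)))"
    proof (rule Henstock_Kurzweil_Integration.integral_norm_bound_integral)
      fix s assume s: "s \<in> {0..t}"
      have "norm (G s (E y s) - G s (E z s)) \<le> L * norm (E y s - E z s)" using s t by (intro lip) auto
      also have "\<dots> = L * exp (2 * L * s) * dist (apply_bcontfun y s) (apply_bcontfun z s)"
        unfolding E_def by (simp add: dist_norm flip: scaleR_diff_right)
      also have "\<dots> \<le> L * exp (2 * L * s) * dist y z" using L by (intro mult_left_mono dist_bounded) auto
      finally show "norm (G s (E y s) - G s (E z s)) \<le> dist y z * (L * exp (2 * L * s))" by (simp add: mult_ac)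
    qed (use w t in \<open>auto intro!: integrable_diff int_t\<close>)
    also have "\<dots> = dist y z * ((exp (2 * L * t) - 1) / 2)" using w by (rule integral_unique)
    also have "\<dots> \<le> dist y z * (exp (2 * L * t) / 2)" by (intro mult_left_mono) auto
    finally have le: "norm (integral {0..t} (\<lambda>s. G s (E y s) - G s (E z s))) \<le> dist y z * (exp (2 * L * t) / 2)" .
    have "dist (apply_bcontfun (\<Theta> y) t') (apply_bcontfun (\<Theta> z) t')
        = exp (- (2 * L * t)) * norm (integral {0..t} (\<lambda>s. G s (E y s) - G s (E z s)))"
      unfolding \<Theta> t_def[symmetric] \<Psi>_def dist_norm using t
      by (simp add: int_t integral_diff flip: scaleR_diff_right)
    also have "\<dots> \<le> exp (- (2 * L * t)) * (dist y z * (exp (2 * L * t) / 2))"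
      using le by (intro mult_left_mono) auto
    also have "\<dots> = 1/2 * dist y z" by (simp add: exp_minus)
    finally show "dist (apply_bcontfun (\<Theta> y) t') (apply_bcontfun (\<Theta> z) t') \<le> 1/2 * dist y z" .
  qed
  then have "\<exists>!y. \<Theta> y = y" by (intro banach_fix_type[of "1/2"]) auto
  then obtain y where y: "\<Theta> y = y" by blast
  have "E y t = \<xi> + integral {0..t} (\<lambda>s. G s (E y s))" if t: "t \<in> {0..T}" for t
  proof -
    have "apply_bcontfun y t = \<Psi> y t"
      using \<Theta>[of y t] t by (simp add: y clamp_cancel_cbox)
    then have "E y t = exp (2 * L * t) *\<^sub>R \<Psi> y t" by (simp add: E_def)
    then show ?thesis by (simp add: \<Psi>_def flip: exp_add)
  qed
  then show ?thesis using E by blast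
qed

lemma has_integral_reverse_time:
  fixes f :: "real \<Rightarrow> 'b::banach"
  shows "((\<lambda>s. f (T - s)) has_integral i) {T - b..T - a} \<longleftrightarrow> (f has_integral i) {a..b}"
proof -
  have "((\<lambda>s. f (T - s)) has_integral i) {T - b..T - a}" if "(f has_integral i) {a..b}" for f :: "real \<Rightarrow> 'b" and a b
  proof (cases "a \<le> b")
    case True
    have "((\<lambda>x. f (- 1 *\<^sub>R x + T)) has_integral (1 / (\<bar>- 1::real\<bar> ^ DIM(real))) *\<^sub>R i)
        ((\<lambda>x. (1 / - 1) *\<^sub>R x + - ((1 / - 1) *\<^sub>R T)) ` cbox a b)"
      by (rule has_integral_affinity) (use that in auto)
    moreover have "(\<lambda>x. (1 / - 1) *\<^sub>R x + - ((1 / - 1) *\<^sub>R T)) ` cbox a b = {T - b..T - a}"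
    proof -
      have "(\<lambda>x. (1 / - 1) *\<^sub>R x + - ((1 / - 1) *\<^sub>R T)) = (\<lambda>x. T - x)" by auto
      then show ?thesis using True by (simp only: image_diff_atLeastAtMost box_real)
    qed
    ultimately show ?thesis by (simp add: algebra_simps)
  qed (use that in auto)
  from this[of f a b] this[of "\<lambda>s. f (T - s)" "T - b" "T - a"] show ?thesis by auto
qed

lemma integral_equation_solution_backward:
  fixes G :: "real \<Rightarrow> 'b::banach \<Rightarrow> 'b"
  assumes T: "T \<ge> 0" and L: "L > 0"
    and lip: "\<And>t x y. t \<in> {0..T} \<Longrightarrow> norm (G t x - G t y) \<le> L * norm (x - y)"
    and int: "\<And>x. continuous_on {0..T} x \<Longrightarrow> (\<lambda>s. G s (x s)) integrable_on {0..T}"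
  shows "\<exists>x. continuous_on {0..T} x \<and> (\<forall>t\<in>{0..T}. x t = \<xi> + integral {t..T} (\<lambda>s. G s (x s)))"
proof -
  have rev: "continuous_on {0..T} (\<lambda>s. x (T - s))" if "continuous_on {0..T} x" for x :: "real \<Rightarrow> 'b"
    by (rule continuous_on_compose2[OF that]) (auto intro!: continuous_intros)
  have "\<exists>y. continuous_on {0..T} y \<and> (\<forall>t\<in>{0..T}. y t = \<xi> + integral {0..t} (\<lambda>s. G (T - s) (y s)))"
  proof (rule integral_equation_solution[OF T L])
    fix x :: "real \<Rightarrow> 'b" assume "continuous_on {0..T} x"
    then have "(\<lambda>s. G s (x (T - s))) integrable_on {0..T}" by (intro int rev)
    then obtain i where "((\<lambda>s. G s (x (T - s))) has_integral i) {0..T}" by blast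
    then have "((\<lambda>s. G (T - s) (x (T - (T - s)))) has_integral i) {T - T..T - 0}"
      by (subst has_integral_reverse_time[of "\<lambda>s. G s (x (T - s))"])
    then show "(\<lambda>s. G (T - s) (x s)) integrable_on {0..T}" by auto
  qed (use lip in auto)
  then obtain y where y: "continuous_on {0..T} y" "\<And>t. t \<in> {0..T} \<Longrightarrow> y t = \<xi> + integral {0..t} (\<lambda>s. G (T - s) (y s))"
    by blast
  have "y (T - t) = \<xi> + integral {t..T} (\<lambda>s. G s (y (T - s)))" if t: "t \<in> {0..T}" for t
  proof -
    have "(\<lambda>s. G s (y (T - s))) integrable_on {t..T}"
      by (rule integrable_on_subinterval[OF int[OF rev[OF y(1)]]]) (use t in auto)
    then have "((\<lambda>s. G s (y (T - s))) has_integral integral {t..T} (\<lambda>s. G s (y (T - s)))) {t..T}"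
      by (rule integrable_integral)
    then have "((\<lambda>s. G (T - s) (y (T - (T - s)))) has_integral integral {t..T} (\<lambda>s. G s (y (T - s)))) {T - T..T - t}"
      by (subst has_integral_reverse_time[of "\<lambda>s. G s (y (T - s))"])
    then have "integral {0..T - t} (\<lambda>s. G (T - s) (y s)) = integral {t..T} (\<lambda>s. G s (y (T - s)))"
      by (simp add: integral_unique)
    then show ?thesis using y(2)[of "T - t"] t by simp
  qed
  then show ?thesis using rev[OF y(1)] by (intro exI[of _ "\<lambda>s. y (T - s)"]) auto
qed

text \<open>
  The bounds on the differentials are assumed for compact sets of control values. At every
  instant two open sets, around the value, which is also the right limit, and around the left
  limit, cover the nearby values; and outside the finite set \<open>S\<close> the left limits are
  themselves values, so adding the left limits on \<open>S\<close> suffices. (The closure of the range need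
  not be compact in a Hausdorff space that is not regular.)
\<close>

lemma normal_pc_compact_range:
  assumes u: "normal_pc T U S u"
  shows "\<exists>M. compact M \<and> M \<subseteq> U \<and> u ` {0..T} \<subseteq> M"
proof -
  note D = normal_pcD[OF u]
  have "\<forall>s. \<exists>l. s \<in> S - {0} \<longrightarrow> l \<in> U \<and> (u \<longlongrightarrow> l) (at_left s)"
    using D(4,8) by (metis DiffE atLeastAtMost_iff insertCI order_le_less subsetD)
  then obtain l where l: "\<And>s. s \<in> S - {0} \<Longrightarrow> l s \<in> U \<and> (u \<longlongrightarrow> l s) (at_left s)" by metis
  define M where "M = u ` {0..T} \<union> l ` (S - {0})"
  have left: "\<exists>k\<in>M. (u \<longlongrightarrow> k) (at_left t)" if t: "0 < t" "t \<le> T" for t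
  proof (cases "t \<in> S")
    case True
    then show ?thesis using l[of t] t unfolding M_def by auto
  next
    case False
    then have "(u \<longlongrightarrow> u t) (at_left t)" using D(6)[of t] t by (simp add: isCont_def filterlim_at_split)
    then show ?thesis using t unfolding M_def by auto
  qed
  have "compact M"
  proof (rule compactI)
    fix C assume op: "\<forall>t\<in>C. open t" and cov: "M \<subseteq> \<Union>C"
    define good where "good t N C' \<longleftrightarrow> open N \<and> t \<in> N \<and> C' \<subseteq> C \<and> finite C' \<and> u ` (N \<inter> {0..T}) \<subseteq> \<Union>C'"
      for t and N :: "real set" and C'
    have "\<exists>N C'. t \<in> {0..T} \<longrightarrow> good t N C'" for t
    proof (cases "t \<in> {0..T}")
      case t: True
      then obtain O1 where O1: "O1 \<in> C" "u t \<in> O1" using cov unfolding M_def by blast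
      have "\<exists>O2\<in>C. \<forall>\<^sub>F s in at_left t. s \<in> {0..T} \<longrightarrow> u s \<in> O2"
      proof (cases "0 < t")
        case True
        then obtain k where k: "k \<in> M" "(u \<longlongrightarrow> k) (at_left t)" using left[of t] t by auto
        then obtain O2 where "O2 \<in> C" "k \<in> O2" using cov by blast
        then have "\<forall>\<^sub>F s in at_left t. u s \<in> O2" using k(2) op by (auto dest: topological_tendstoD)
        then show ?thesis using \<open>O2 \<in> C\<close> by (auto elim: eventually_mono)
      next
        case False
        have "\<forall>\<^sub>F s in at_left t. s \<in> {0..T} \<longrightarrow> u s \<in> O1"
          using False by (auto simp: eventually_at_filter)
        then show ?thesis using O1 by blast
      qed
      then obtain O2 where O2: "O2 \<in> C" "\<forall>\<^sub>F s in at_left t. s \<in> {0..T} \<longrightarrow> u s \<in> O2" by blast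
      have right: "\<forall>\<^sub>F s in at_right t. s \<in> {0..T} \<longrightarrow> u s \<in> O1"
      proof (cases "t < T")
        case True
        then have "\<forall>\<^sub>F s in at_right t. u s \<in> O1"
          using D(7)[of t] t O1 op by (auto dest: topological_tendstoD)
        then show ?thesis by (rule eventually_mono) auto
      next
        case False
        then show ?thesis using t by (auto simp: eventually_at_filter)
      qed
      have "\<forall>\<^sub>F s in at t. s \<in> {0..T} \<longrightarrow> u s \<in> O1 \<union> O2"
        unfolding eventually_at_split using O2(2) right by (auto elim: eventually_mono)
      then have "\<forall>\<^sub>F s in nhds t. s \<in> {0..T} \<longrightarrow> u s \<in> O1 \<union> O2"
        using O1 by (simp add: eventually_nhds_conv_at)
      then obtain N where "open N" "t \<in> N" "\<forall>s\<in>N. s \<in> {0..T} \<longrightarrow> u s \<in> O1 \<union> O2"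
        unfolding eventually_nhds by blast
      then show ?thesis using O1 O2 unfolding good_def by (intro exI[of _ N] exI[of _ "{O1, O2}"]) auto
    qed blast
    then obtain N C' where "\<And>t. t \<in> {0..T} \<Longrightarrow> good t (N t) (C' t)" by metis
    then have N: "\<And>t. t \<in> {0..T} \<Longrightarrow> open (N t) \<and> t \<in> N t \<and> C' t \<subseteq> C \<and> finite (C' t) \<and>
        u ` (N t \<inter> {0..T}) \<subseteq> \<Union>(C' t)"
      unfolding good_def .
    obtain D' where D': "D' \<subseteq> {0..T}" "finite D'" "{0..T} \<subseteq> (\<Union>t\<in>D'. N t)"
      by (rule compactE_image[of "{0..T}" "{0..T}" N]) (use N in auto)
    have "l s \<in> M" if "s \<in> S - {0}" for s using that unfolding M_def by blast
    then have "\<exists>Q. s \<in> S - {0} \<longrightarrow> Q \<in> C \<and> l s \<in> Q" for s using cov by blast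
    then obtain Q where Q: "\<And>s. s \<in> S - {0} \<Longrightarrow> Q s \<in> C \<and> l s \<in> Q s" by metis
    have "M \<subseteq> \<Union>((\<Union>t\<in>D'. C' t) \<union> Q ` (S - {0}))"
    proof
      fix v assume "v \<in> M"
      then consider t where "t \<in> {0..T}" "v = u t" | s where "s \<in> S - {0}" "v = l s"
        unfolding M_def by blast
      then show "v \<in> \<Union>((\<Union>t\<in>D'. C' t) \<union> Q ` (S - {0}))"
      proof cases
        case 1
        then obtain r where r: "r \<in> D'" "t \<in> N r" using D'(3) by blast
        then have "v \<in> u ` (N r \<inter> {0..T})" using 1 by auto
        moreover have "u ` (N r \<inter> {0..T}) \<subseteq> \<Union>(C' r)" 
          using N[OF subsetD[OF D'(1) r(1)]] by (elim conjE)
        ultimately have "v \<in> \<Union>(C' r)" by (rule subsetD[rotated])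
        then obtain P where "P \<in> C' r" "v \<in> P" by blast
        then show ?thesis using r(1) by (intro UnionI[of P]) auto
      next
        case 2
        then show ?thesis using Q[of s] by (intro UnionI[of "Q s"]) auto
      qed
    qed
    moreover have C': "C' t \<subseteq> C" "finite (C' t)" if "t \<in> D'" for t
      using N[OF subsetD[OF D'(1) that]] by simp_all
    moreover have "(\<Union>t\<in>D'. C' t) \<union> Q ` (S - {0}) \<subseteq> C"
      by (intro Un_least UN_least image_subsetI C') (use Q in auto)
    moreover have "finite ((\<Union>t\<in>D'. C' t) \<union> Q ` (S - {0}))"
      by (intro finite_UnI finite_UN_I finite_imageI finite_Diff C' D'(2) D(1))
    ultimately show "\<exists>C'. C' \<subseteq> C \<and> finite C' \<and> M \<subseteq> \<Union>C'" by blast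
  qed
  moreover have "M \<subseteq> U" using D(5) l unfolding M_def by auto
  ultimately show ?thesis unfolding M_def by blast
qed

text \<open>
  A sequence approaching \<open>K\<close> along which the values explode would, with its limit, form a
  compact set on which \<open>V\<close> is unbounded. This transfers bounds on compact sets to full
  neighbourhoods although bounded sets of the space need not be relatively compact.
\<close>

lemma bounded_on_tube:
  fixes V :: "'a::real_normed_vector \<Rightarrow> real set"
  assumes K: "compact K" "K \<noteq> {}" "K \<subseteq> \<Omega>" "open \<Omega>"
    and bdd: "\<And>K'. compact K' \<Longrightarrow> K' \<noteq> {} \<Longrightarrow> K' \<subseteq> \<Omega> \<Longrightarrow> bdd_above (\<Union>\<xi>\<in>K'. V \<xi>)"
  shows "\<exists>\<rho>>0. \<exists>B>0. \<forall>k\<in>K. \<forall>\<xi>\<in>cball k \<rho>. \<xi> \<in> \<Omega> \<and> (\<forall>v\<in>V \<xi>. v \<le> B)"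
proof (rule ccontr)
  assume neg: "\<not> ?thesis"
  obtain \<epsilon> where \<epsilon>: "\<epsilon> > 0" "(\<Union>x\<in>K. ball x \<epsilon>) \<subseteq> \<Omega>"
    by (rule compact_subset_open_imp_ball_epsilon_subset[OF K(1,4,3)])
  have "\<exists>k \<xi> v. k \<in> K \<and> \<xi> \<in> \<Omega> \<and> dist k \<xi> \<le> inverse (real (Suc n)) \<and> v \<in> V \<xi> \<and> real (Suc n) < v" for n
  proof -
    have "min (\<epsilon>/2) (inverse (real (Suc n))) > 0" "real (Suc n) > 0" using \<epsilon> by auto
    then have "\<not> (\<forall>k\<in>K. \<forall>\<xi>\<in>cball k (min (\<epsilon>/2) (inverse (real (Suc n)))). \<xi> \<in> \<Omega> \<and> (\<forall>v\<in>V \<xi>. v \<le> real (Suc n)))"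
      using neg by blast
    then obtain k \<xi> where k: "k \<in> K" "\<xi> \<in> cball k (min (\<epsilon>/2) (inverse (real (Suc n))))"
      "\<not> (\<xi> \<in> \<Omega> \<and> (\<forall>v\<in>V \<xi>. v \<le> real (Suc n)))"
      by blast
    then have "\<xi> \<in> ball k \<epsilon>" using \<epsilon> by auto
    then have "\<xi> \<in> \<Omega>" using k(1) \<epsilon>(2) by blast
    then show ?thesis using k by (auto simp: not_le)
  qed
  then obtain k \<xi> v where seq: "\<And>n. k n \<in> K" "\<And>n. \<xi> n \<in> \<Omega>" "\<And>n. dist (k n) (\<xi> n) \<le> inverse (real (Suc n))"
      "\<And>n. v n \<in> V (\<xi> n)" "\<And>n. real (Suc n) < v n"
    by metis
  obtain a r where a: "a \<in> K" "strict_mono (r :: nat \<Rightarrow> nat)" "(k \<circ> r) \<longlonglongrightarrow> a"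
    using K(1) seq(1) unfolding compact_eq_seq_compact_metric by (auto elim!: seq_compactE)
  have "(\<lambda>n. inverse (real (Suc (r n)))) \<longlonglongrightarrow> 0"
    using LIMSEQ_subseq_LIMSEQ[OF LIMSEQ_inverse_real_of_nat a(2)] by (simp add: o_def)
  then have "(\<lambda>n. \<xi> (r n) - k (r n)) \<longlonglongrightarrow> 0"
    by (rule Lim_null_comparison[rotated]) (use seq(3) in \<open>auto simp: dist_norm norm_minus_commute\<close>)
  from tendsto_add[OF this a(3)] have lim: "(\<lambda>n. \<xi> (r n)) \<longlonglongrightarrow> a" by (simp add: o_def)
  have "compactin euclidean (insert a (range (\<lambda>n. \<xi> (r n))))"
    by (rule compactin_sequence_with_limit[where \<sigma> = "\<lambda>n. \<xi> (r n)"]) (use lim in \<open>auto simp: limitin_canonical_iff\<close>)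
  then have "compact (insert a (range (\<lambda>n. \<xi> (r n))))" by (simp add: compactin_euclidean_iff)
  then have "bdd_above (\<Union>\<xi>\<in>insert a (range (\<lambda>n. \<xi> (r n))). V \<xi>)"
    using a(1) K(3) seq(2) by (intro bdd) auto
  then obtain B where B: "\<And>n w. w \<in> V (\<xi> (r n)) \<Longrightarrow> w \<le> B" unfolding bdd_above_def by blast
  obtain n where "real n > B" using reals_Archimedean2 by blast
  moreover have "real n \<le> real (Suc (r n))" using seq_suble[OF a(2), of n] by simp
  ultimately show False using B[OF seq(4)[of "r n"]] seq(5)[of "r n"] by linarith
qed

text \<open>
  The definition has only right limits; the left ones come from the direction \<open>- v\<close> and
  linearity.
\<close>

lemma gateaux_line_derivative:
  assumes L: "has_gateaux_diff F L (y + s *\<^sub>R v)"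
  shows "((\<lambda>s. F (y + s *\<^sub>R v)) has_vector_derivative blinfun_apply L v) (at s)"
proof -
  define \<phi> where "\<phi> s = F (y + s *\<^sub>R v)" for s
  have right: "((\<lambda>h. (\<phi> (s + h) - \<phi> s) /\<^sub>R h) \<longlongrightarrow> blinfun_apply L v) (at_right 0)"
    using L unfolding has_gateaux_diff_def \<phi>_def by (simp add: algebra_simps)
  have "((\<lambda>h. (\<phi> (s + - h) - \<phi> s) /\<^sub>R h) \<longlongrightarrow> blinfun_apply L (- v)) (at_right 0)"
    using L[unfolded has_gateaux_diff_def, rule_format, of "- v"] unfolding \<phi>_def by (simp add: algebra_simps)
  from tendsto_minus[OF this]
  have "((\<lambda>h. (\<phi> (s + - h) - \<phi> s) /\<^sub>R (- h)) \<longlongrightarrow> blinfun_apply L v) (at_right 0)"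
    by (simp add: blinfun.minus_right)
  then have left: "((\<lambda>h. (\<phi> (s + h) - \<phi> s) /\<^sub>R h) \<longlongrightarrow> blinfun_apply L v) (at_left 0)"
    by (simp add: filterlim_at_left_to_right)
  have lim: "((\<lambda>h. (\<phi> (s + h) - \<phi> s) /\<^sub>R h - blinfun_apply L v) \<longlongrightarrow> 0) (at 0)"
    using left right by (simp add: filterlim_at_split LIM_zero)
  have "((\<lambda>h. norm (\<phi> (s + h) - \<phi> s - h *\<^sub>R blinfun_apply L v) / norm h) \<longlongrightarrow> 0) (at 0)"
  proof (rule Lim_transform_eventually[OF tendsto_norm_zero[OF lim]])
    have "norm ((\<phi> (s + h) - \<phi> s) /\<^sub>R h - blinfun_apply L v) =
        norm (\<phi> (s + h) - \<phi> s - h *\<^sub>R blinfun_apply L v) / norm h" if "h \<noteq> 0" for h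
    proof -
      have "(\<phi> (s + h) - \<phi> s) /\<^sub>R h - blinfun_apply L v = (\<phi> (s + h) - \<phi> s - h *\<^sub>R blinfun_apply L v) /\<^sub>R h"
        using that by (simp add: scaleR_diff_right)
      then show ?thesis by (simp add: divide_inverse_commute)
    qed
    then show "\<forall>\<^sub>F h in at 0. norm ((\<phi> (s + h) - \<phi> s) /\<^sub>R h - blinfun_apply L v) =
        norm (\<phi> (s + h) - \<phi> s - h *\<^sub>R blinfun_apply L v) / norm h"
      by (auto simp: eventually_at_filter)
  qed
  then have "(\<phi> has_vector_derivative blinfun_apply L v) (at s)"
    unfolding has_vector_derivative_def has_derivative_at by (simp add: bounded_linear_scaleR_left)
  then show ?thesis unfolding \<phi>_def .
qed

lemma gateaux_lipschitz:
  assumes C: "convex C" "x \<in> C" "y \<in> C"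
    and F: "\<And>\<xi>. \<xi> \<in> C \<Longrightarrow> gateaux_differentiable F \<xi>" "\<And>\<xi>. \<xi> \<in> C \<Longrightarrow> norm (D_G F \<xi>) \<le> B"
  shows "norm (F x - F y) \<le> B * norm (x - y)"
proof -
  define v where "v = x - y"
  have seg: "y + s *\<^sub>R v \<in> C" if "s \<in> {0..1}" for s
  proof -
    have "(1 - s) *\<^sub>R y + s *\<^sub>R x \<in> C" using C that by (auto simp: convex_alt)
    moreover have "y + s *\<^sub>R v = (1 - s) *\<^sub>R y + s *\<^sub>R x" by (simp add: v_def algebra_simps)
    ultimately show ?thesis by simp
  qed
  have "norm (F (y + 1 *\<^sub>R v) - F (y + 0 *\<^sub>R v)) \<le> B * norm v * norm (1 - 0 :: real)"
  proof (rule differentiable_bound[of "{0..1}" "\<lambda>s. F (y + s *\<^sub>R v)" "\<lambda>s h. h *\<^sub>R blinfun_apply (D_G F (y + s *\<^sub>R v)) v"])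
    fix s :: real assume s: "s \<in> {0..1}"
    have "has_gateaux_diff F (D_G F (y + s *\<^sub>R v)) (y + s *\<^sub>R v)"
      using F(1)[OF seg[OF s]] D_G_eq unfolding gateaux_differentiable_def by metis
    from gateaux_line_derivative[OF this]
    show "((\<lambda>s. F (y + s *\<^sub>R v)) has_derivative (\<lambda>h. h *\<^sub>R blinfun_apply (D_G F (y + s *\<^sub>R v)) v)) (at s within {0..1})"
      unfolding has_vector_derivative_def by (rule has_derivative_at_withinI)
    have "norm (blinfun_apply (D_G F (y + s *\<^sub>R v)) v) \<le> B * norm v"
      using norm_blinfun[of "D_G F (y + s *\<^sub>R v)" v] F(2)[OF seg[OF s]] mult_right_mono norm_ge_zero order_trans by metis
    then show "onorm (\<lambda>h. h *\<^sub>R blinfun_apply (D_G F (y + s *\<^sub>R v)) v) \<le> B * norm v"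
      by (intro onorm_le) (simp add: mult.commute[of "B * norm v"] mult_left_mono)
  qed auto
  then show ?thesis by (simp add: v_def)
qed

section \<open>Regulated functions, radial retraction and stability\<close>

definition regulated :: "real \<Rightarrow> (real \<Rightarrow> 'a::topological_space) \<Rightarrow> bool" where
  "regulated T \<phi> \<longleftrightarrow> (\<forall>t. 0 \<le> t \<longrightarrow> t < T \<longrightarrow> (\<exists>l. (\<phi> \<longlongrightarrow> l) (at_right t))) \<and>
     (\<forall>t. 0 < t \<longrightarrow> t \<le> T \<longrightarrow> (\<exists>l. (\<phi> \<longlongrightarrow> l) (at_left t)))"

lemma normal_pc_regulated: "normal_pc T W S u \<Longrightarrow> regulated T u"
  unfolding regulated_def by (blast dest: normal_pcD(7,8))

lemma continuous_on_regulated: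
  assumes "continuous_on {0..T} \<phi>"
  shows "regulated T \<phi>"
proof -
  have lim: "(\<phi> \<longlongrightarrow> \<phi> t) (at t within {0..T})" if "t \<in> {0..T}" for t
    using assms that by (simp add: continuous_on_def)
  have "(\<phi> \<longlongrightarrow> \<phi> t) (at_right t)" if "0 \<le> t" "t < T" for t
    using tendsto_mono[OF at_right_le_within_Icc lim] that by auto
  moreover have "(\<phi> \<longlongrightarrow> \<phi> t) (at_left t)" if "0 < t" "t \<le> T" for t
    using tendsto_mono[OF at_left_le_within_Icc lim] that by auto
  ultimately show ?thesis unfolding regulated_def by blast
qed

text \<open>
  Closure of the regulated functions under an operation is the limit law of that operation,
  applied at every one-sided limit.
\<close>

lemma regulated_map2:
  assumes "regulated T \<phi>" "regulated T \<psi>"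
    and g: "\<And>F a b. (\<phi> \<longlongrightarrow> a) F \<Longrightarrow> (\<psi> \<longlongrightarrow> b) F \<Longrightarrow> \<exists>l. (g \<longlongrightarrow> l) F"
  shows "regulated T g"
  unfolding regulated_def
proof (intro conjI allI impI)
  fix t assume "0 \<le> t" "t < T"
  then obtain a b where "(\<phi> \<longlongrightarrow> a) (at_right t)" "(\<psi> \<longlongrightarrow> b) (at_right t)"
    using assms(1,2) unfolding regulated_def by blast
  then show "\<exists>l. (g \<longlongrightarrow> l) (at_right t)" by (rule g)
next
  fix t assume "0 < t" "t \<le> T"
  then obtain a b where "(\<phi> \<longlongrightarrow> a) (at_left t)" "(\<psi> \<longlongrightarrow> b) (at_left t)"
    using assms(1,2) unfolding regulated_def by blast
  then show "\<exists>l. (g \<longlongrightarrow> l) (at_left t)" by (rule g)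
qed

lemma regulated_diff:
  fixes \<phi> \<psi> :: "real \<Rightarrow> 'a::real_normed_vector"
  shows "regulated T \<phi> \<Longrightarrow> regulated T \<psi> \<Longrightarrow> regulated T (\<lambda>s. \<phi> s - \<psi> s)"
  by (erule (1) regulated_map2) (blast intro: tendsto_diff)

lemma regulated_norm:
  fixes \<phi> :: "real \<Rightarrow> 'a::real_normed_vector"
  shows "regulated T \<phi> \<Longrightarrow> regulated T (\<lambda>s. norm (\<phi> s))"
  by (rule regulated_map2[of T \<phi> \<phi>]) (blast intro: tendsto_norm)+

lemma regulated_blinfun_apply:
  fixes \<phi> :: "real \<Rightarrow> 'a::real_normed_vector \<Rightarrow>\<^sub>L 'b::real_normed_vector"
  shows "regulated T \<phi> \<Longrightarrow> regulated T \<psi> \<Longrightarrow> regulated T (\<lambda>s. blinfun_apply (\<phi> s) (\<psi> s))"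
  by (erule (1) regulated_map2) (blast intro: blinfun.tendsto)

lemma regulated_integrable_on:
  fixes \<phi> :: "real \<Rightarrow> 'a::banach"
  assumes "regulated T \<phi>" "0 \<le> a" "b \<le> T"
  shows "\<phi> integrable_on {a..b}"
  by (rule regulated_integrable) (use assms in \<open>auto simp: regulated_def\<close>)

text \<open>
  Composing the dynamics with this map turns a Lipschitz bound in a tube into a global one. In
  a general Banach space nearest points of a ball need not be unique, but this choice of them
  is 2-Lipschitz.
\<close>

definition radial_retraction :: "real \<Rightarrow> 'a::real_normed_vector \<Rightarrow> 'a" where
  "radial_retraction \<rho> v = (if norm v \<le> \<rho> then v else (\<rho> / norm v) *\<^sub>R v)"

lemma norm_radial_retraction: "\<rho> > 0 \<Longrightarrow> norm (radial_retraction \<rho> v) \<le> \<rho>"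
  by (auto simp: radial_retraction_def)

lemma radial_retraction_lipschitz:
  assumes \<rho>: "\<rho> > 0"
  shows "norm (radial_retraction \<rho> v - radial_retraction \<rho> w) \<le> 2 * norm (v - w)"
proof -
  have in_out: "norm (v - (\<rho> / norm w) *\<^sub>R w) \<le> 2 * norm (v - w)"
    if "norm v \<le> \<rho>" "\<not> norm w \<le> \<rho>" for v w :: 'a
  proof -
    have "norm (v - (\<rho> / norm w) *\<^sub>R w) = norm ((v - w) + (1 - \<rho> / norm w) *\<^sub>R w)"
      by (simp add: algebra_simps)
    also have "\<dots> \<le> norm (v - w) + norm ((1 - \<rho> / norm w) *\<^sub>R w)" by (rule norm_triangle_ineq)
    also have "norm ((1 - \<rho> / norm w) *\<^sub>R w) = norm w - \<rho>"
    proof -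
      have w: "norm w > 0" using that \<rho> by linarith
      then have "\<bar>1 - \<rho> / norm w\<bar> = 1 - \<rho> / norm w" using that by simp
      then show ?thesis using w by (simp add: left_diff_distrib)
    qed
    also have "norm w - \<rho> \<le> norm (v - w)"
      using that(1) norm_triangle_ineq2[of w v] by (simp add: norm_minus_commute)
    finally show ?thesis by simp
  qed
  consider "norm v \<le> \<rho>" "norm w \<le> \<rho>" | "norm v \<le> \<rho>" "\<not> norm w \<le> \<rho>"
    | "\<not> norm v \<le> \<rho>" "norm w \<le> \<rho>" | "\<not> norm v \<le> \<rho>" "\<not> norm w \<le> \<rho>" by blast
  then show ?thesis
  proof cases
    case 2
    then show ?thesis using in_out[of v w] by (simp add: radial_retraction_def)
  next
    case 3
    then show ?thesis using in_out[of w v] by (simp add: radial_retraction_def norm_minus_commute)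
  next
    case 4
    have pos: "norm v > 0" "norm w > 0" using 4 \<rho> by linarith+
    have "(\<rho> / norm v) *\<^sub>R v - (\<rho> / norm w) *\<^sub>R w = (\<rho> / norm v) *\<^sub>R ((v - w) + ((norm w - norm v) / norm w) *\<^sub>R w)"
      using pos by (simp add: scaleR_diff_right scaleR_add_right diff_divide_distrib scaleR_diff_left)
    then have "norm ((\<rho> / norm v) *\<^sub>R v - (\<rho> / norm w) *\<^sub>R w) = (\<rho> / norm v) * norm ((v - w) + ((norm w - norm v) / norm w) *\<^sub>R w)"
      using pos \<rho> by simp
    also have "\<dots> \<le> 1 * norm ((v - w) + ((norm w - norm v) / norm w) *\<^sub>R w)"
      using pos 4 by (intro mult_right_mono) auto
    also have "\<dots> \<le> norm (v - w) + norm (((norm w - norm v) / norm w) *\<^sub>R w)"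
      unfolding mult_1 by (rule norm_triangle_ineq)
    also have "norm (((norm w - norm v) / norm w) *\<^sub>R w) = \<bar>norm w - norm v\<bar>" using pos by simp
    also have "\<bar>norm w - norm v\<bar> \<le> norm (v - w)" using norm_triangle_ineq3[of w v] by (simp add: norm_minus_commute)
    finally show ?thesis using 4 by (simp add: radial_retraction_def)
  qed (auto simp: radial_retraction_def)
qed

lemma continuous_on_radial_retraction: "\<rho> > 0 \<Longrightarrow> continuous_on A (radial_retraction \<rho>)"
  by (rule lipschitz_on_continuous_on[of 2]) (auto intro!: lipschitz_onI simp: dist_norm radial_retraction_lipschitz)

text \<open>
  The term \<open>d\<close> carries the difference of two right-hand sides along the second solution. It is
  used for the distance to the reference trajectory and for continuous dependence on the
  needles.
\<close>

lemma integral_equation_stability: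
  fixes x y :: "real \<Rightarrow> 'b::banach"
  assumes L: "L > 0" and x: "continuous_on {0..T} x" "\<And>t. t \<in> {0..T} \<Longrightarrow> x t = \<xi> + integral {0..t} \<phi>"
    and y: "continuous_on {0..T} y" "\<And>t. t \<in> {0..T} \<Longrightarrow> y t = \<xi> + integral {0..t} \<psi>"
    and int: "\<phi> integrable_on {0..T}" "\<psi> integrable_on {0..T}" "d integrable_on {0..T}"
    and le: "\<And>s. s \<in> {0..T} \<Longrightarrow> norm (\<phi> s - \<psi> s) \<le> L * norm (x s - y s) + d s"
    and d: "\<And>s. s \<in> {0..T} \<Longrightarrow> 0 \<le> d s" and t: "t \<in> {0..T}"
  shows "norm (x t - y t) \<le> 2 * integral {0..T} d * exp (2 * L * T)"
proof -
  have I: "0 \<le> integral {0..T} d" using d by (intro integral_nonneg int) auto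
  have "norm (x t - y t) \<le> 2 * integral {0..T} d * exp (2 * L * t)"
  proof (rule gronwall_weak[OF L _ _ _ t])
    show "continuous_on {0..T} (\<lambda>t. norm (x t - y t))" by (intro continuous_intros x y)
    fix t assume t: "t \<in> {0..T}"
    have sub: "f integrable_on {0..t}" if "f integrable_on {0..T}" for f :: "real \<Rightarrow> 'c::banach"
      using that by (rule integrable_on_subinterval) (use t in auto)
    have c: "continuous_on {0..t} (\<lambda>s. norm (x s - y s))"
      by (rule continuous_on_subset[of "{0..T}"]) (use t in \<open>auto intro!: continuous_intros x y\<close>)
    have i: "(\<lambda>s. L * norm (x s - y s)) integrable_on {0..t}"
      by (intro integrable_continuous_real continuous_intros c)
    have "norm (x t - y t) = norm (integral {0..t} (\<lambda>s. \<phi> s - \<psi> s))"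
      using x(2)[OF t] y(2)[OF t] by (simp add: integral_diff sub int)
    also have "\<dots> \<le> integral {0..t} (\<lambda>s. L * norm (x s - y s) + d s)"
      using t by (intro Henstock_Kurzweil_Integration.integral_norm_bound_integral le
        integrable_diff integrable_add sub int i) auto
    also have "\<dots> = L * integral {0..t} (\<lambda>s. norm (x s - y s)) + integral {0..t} d"
      by (subst integral_add[OF i sub[OF int(3)]]) simp
    also have "integral {0..t} d \<le> integral {0..T} d"
      using t d by (intro integral_subset_le sub int) auto
    finally show "norm (x t - y t) \<le> integral {0..T} d + L * integral {0..t} (\<lambda>s. norm (x s - y s))" by simp
  qed (use I in auto)
  also have "\<dots> \<le> 2 * integral {0..T} d * exp (2 * L * T)" using I L t by (intro mult_left_mono) auto
  finally show ?thesis .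
qed

section \<open>Needle variations of a control\<close>

text \<open>
  The needle number \<open>n\<close> starts at \<open>\<tau> n + sum a {..<n}\<close>: shifting it by the total length
  of the earlier needles keeps needles with a common instant disjoint.
\<close>

primrec needle_control :: "(nat \<Rightarrow> real) \<Rightarrow> (nat \<Rightarrow> 'u) \<Rightarrow> (real \<Rightarrow> 'u) \<Rightarrow> (nat \<Rightarrow> real) \<Rightarrow> nat \<Rightarrow> real \<Rightarrow> 'u" where
  "needle_control \<tau> \<zeta> u a 0 = u"
| "needle_control \<tau> \<zeta> u a (Suc n) = (\<lambda>s. if \<tau> n + sum a {..<n} \<le> s \<and> s < \<tau> n + sum a {..<Suc n}
     then \<zeta> n else needle_control \<tau> \<zeta> u a n s)"

definition in_needle :: "(nat \<Rightarrow> real) \<Rightarrow> (nat \<Rightarrow> real) \<Rightarrow> nat \<Rightarrow> real \<Rightarrow> real" where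
  "in_needle \<tau> a n s = (if \<tau> n + sum a {..<n} \<le> s \<and> s < \<tau> n + sum a {..<Suc n} then 1 else 0)"

lemma normal_pc_needle:
  assumes u: "normal_pc T U S u" and cd: "0 \<le> c" "c \<le> d" "d < T" and \<zeta>: "\<zeta> \<in> U"
  shows "normal_pc T U (S \<union> {c, d}) (\<lambda>s. if c \<le> s \<and> s < d then \<zeta> else u s)"
proof -
  note D = normal_pcD[OF u]
  let ?v = "\<lambda>s. if c \<le> s \<and> s < d then \<zeta> else u s"
  have transfer: "(?v \<longlongrightarrow> l) F" if "(w \<longlongrightarrow> l) F" "\<forall>\<^sub>F s in F. w s = ?v s" for w l F
    using that by (rule Lim_transform_eventually)
  have right: "(?v \<longlongrightarrow> ?v t) (at_right t)" if t: "0 \<le> t" "t < T" for t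
  proof -
    consider "t < c" | "c \<le> t" "t < d" | "d \<le> t" using cd by linarith
    then show ?thesis
    proof cases
      case 1
      have "\<forall>\<^sub>F s in at_right t. u s = ?v s"
        using eventually_at_right_real[OF 1] by eventually_elim auto
      then show ?thesis using transfer[OF D(7)[OF t]] 1 by auto
    next
      case 2
      have "\<forall>\<^sub>F s in at_right t. \<zeta> = ?v s"
        using eventually_at_right_real[OF 2(2)] by eventually_elim (use 2 in auto)
      then show ?thesis using transfer[OF tendsto_const] 2 by auto
    next
      case 3
      have "\<forall>\<^sub>F s in at_right t. u s = ?v s"
        using eventually_at_right_real[OF t(2)] by eventually_elim (use 3 in auto)
      then show ?thesis using transfer[OF D(7)[OF t]] 3 by auto
    qed
  qed
  have left_u: "(?v \<longlongrightarrow> l) (at_left t)" if t: "0 < t" "t \<le> c \<or> d < t" "(u \<longlongrightarrow> l) (at_left t)" for t l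
  proof (rule transfer[OF t(3)])
    from t(2) show "\<forall>\<^sub>F s in at_left t. u s = ?v s"
    proof
      assume "t \<le> c"
      then show ?thesis using eventually_at_left_real[OF t(1)] by (auto elim: eventually_mono)
    next
      assume "d < t"
      then show ?thesis using eventually_at_left_real[of d t] by (auto elim: eventually_mono)
    qed
  qed
  have left: "\<exists>l\<in>U. (?v \<longlongrightarrow> l) (at_left t)" if t: "0 < t" "t \<le> T" for t
  proof (cases "t \<le> c \<or> d < t")
    case True
    then show ?thesis using left_u[OF t(1) True] D(8)[OF t] by blast
  next
    case False
    then have "\<forall>\<^sub>F s in at_left t. \<zeta> = ?v s"
      using eventually_at_left_real[of c t] by (auto elim: eventually_mono)
    then show ?thesis using transfer[OF tendsto_const] \<zeta> by blast
  qed
  have cont: "isCont ?v t" if t: "t \<in> {0..T}" "t \<notin> S \<union> {c, d}" for t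
  proof -
    consider "t < c" | "c < t" "t < d" | "d < t" using cd t by fastforce
    then show ?thesis
    proof cases
      case 1
      have "\<forall>\<^sub>F s in nhds t. s \<in> {..<c}" using 1 by (intro eventually_nhds_in_open) auto
      then have "\<forall>\<^sub>F s in nhds t. ?v s = u s" by eventually_elim auto
      then show ?thesis using D(6)[of t] t isCont_cong by fastforce
    next
      case 2
      have "\<forall>\<^sub>F s in nhds t. s \<in> {c<..<d}" using 2 by (intro eventually_nhds_in_open) auto
      then have "\<forall>\<^sub>F s in nhds t. ?v s = \<zeta>" by eventually_elim auto
      then have "isCont ?v t = isCont (\<lambda>_. \<zeta>) t" by (rule isCont_cong)
      then show ?thesis by simp
    next
      case 3
      have "\<forall>\<^sub>F s in nhds t. s \<in> {d<..}" using 3 by (intro eventually_nhds_in_open) auto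
      then have "\<forall>\<^sub>F s in nhds t. ?v s = u s" by eventually_elim auto
      then show ?thesis using D(6)[of t] t isCont_cong by fastforce
    qed
  qed
  have "(?v \<longlongrightarrow> ?v T) (at_left T)"
    using left_u[of T "u T"] D(9) cd by auto
  then show ?thesis
    unfolding normal_pc_def subdivision_def
    using D(1-5) cd \<zeta> right left cont by auto
qed

lemma needle_control_normal_pc:
  assumes "normal_pc T U S u"
    and "\<And>i. i < n \<Longrightarrow> 0 \<le> \<tau> i \<and> 0 \<le> a i \<and> \<zeta> i \<in> U \<and> \<tau> i + sum a {..<Suc i} < T"
  shows "\<exists>S'. normal_pc T U S' (needle_control \<tau> \<zeta> u a n)"
  using assms(2)
proof (induction n)
  case 0
  then show ?case using assms(1) by auto
next
  case (Suc n)
  then obtain S' where S': "normal_pc T U S' (needle_control \<tau> \<zeta> u a n)" by (meson less_SucI)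
  have "0 \<le> sum a {..<n}" by (intro sum_nonneg) (use Suc.prems in \<open>auto simp: less_Suc_eq\<close>)
  moreover have "0 \<le> \<tau> n" "0 \<le> a n" "\<zeta> n \<in> U" "\<tau> n + sum a {..<Suc n} < T"
    using Suc.prems[of n] by auto
  ultimately show ?case
    using normal_pc_needle[OF S', of "\<tau> n + sum a {..<n}" "\<tau> n + sum a {..<Suc n}" "\<zeta> n"]
    by (intro exI) auto
qed

lemma needle_control_range: "needle_control \<tau> \<zeta> u a n s \<in> insert (u s) (\<zeta> ` {..<n})"
  by (induction n) (auto simp: less_Suc_eq)

text \<open>
  For nondecreasing instants the needles are disjoint, so a nonlinear expression in the
  control changes by a sum over the single needles.
\<close>

lemma needle_control_diff:
  fixes Q :: "'u \<Rightarrow> 'b::real_vector"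
  assumes "\<And>i. i < n \<Longrightarrow> 0 \<le> a i" "\<And>i j. i \<le> j \<Longrightarrow> j < n \<Longrightarrow> \<tau> i \<le> \<tau> j"
  shows "Q (needle_control \<tau> \<zeta> u a n s) - Q (u s) = (\<Sum>i<n. in_needle \<tau> a i s *\<^sub>R (Q (\<zeta> i) - Q (u s)))"
  using assms
proof (induction n)
  case (Suc n)
  have IH: "Q (needle_control \<tau> \<zeta> u a n s) - Q (u s) = (\<Sum>i<n. in_needle \<tau> a i s *\<^sub>R (Q (\<zeta> i) - Q (u s)))"
    by (rule Suc.IH) (use Suc.prems in auto)
  show ?case
  proof (cases "in_needle \<tau> a n s = 0")
    case True
    then show ?thesis using IH by (auto simp: in_needle_def split: if_splits)
  next
    case False
    then have s: "\<tau> n + sum a {..<n} \<le> s" "s < \<tau> n + sum a {..<Suc n}"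
      by (auto simp: in_needle_def split: if_splits)
    have "in_needle \<tau> a i s = 0" if i: "i < n" for i
    proof -
      have "sum a {..<Suc i} \<le> sum a {..<n}"
        by (rule sum_mono2) (use i Suc.prems(1) in auto)
      moreover have "\<tau> i \<le> \<tau> n" using Suc.prems(2)[of i n] i by simp
      ultimately have "\<tau> i + sum a {..<Suc i} \<le> s" using s(1) by linarith
      then show ?thesis by (auto simp: in_needle_def)
    qed
    then have "(\<Sum>i<n. in_needle \<tau> a i s *\<^sub>R (Q (\<zeta> i) - Q (u s))) = 0" by simp
    moreover have "in_needle \<tau> a n s = 1" using s by (simp add: in_needle_def)
    moreover have "needle_control \<tau> \<zeta> u a (Suc n) s = \<zeta> n" using s by simp
    ultimately show ?thesis by simp
  qed
qed simp

lemma in_needle_integral: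
  fixes v :: "'b::banach"
  assumes "0 \<le> \<tau> n" "\<And>i. i \<le> n \<Longrightarrow> 0 \<le> a i" "\<tau> n + sum a {..<Suc n} \<le> T"
  shows "((\<lambda>s. in_needle \<tau> a n s *\<^sub>R v) has_integral a n *\<^sub>R v) {0..T}"
proof -
  define c d where "c = \<tau> n + sum a {..<n}" and "d = \<tau> n + sum a {..<Suc n}"
  have "0 \<le> sum a {..<n}" by (intro sum_nonneg) (use assms(2) in auto)
  then have cd: "0 \<le> c" "c \<le> d" "d \<le> T" "d - c = a n"
    using assms(1,3) assms(2)[of n] by (auto simp: c_def d_def)
  have "((\<lambda>_. v) has_integral a n *\<^sub>R v) {c..d}"
    using has_integral_const_real[of v c d] cd by simp
  then have "((\<lambda>s. if s \<in> {c..d} then v else 0) has_integral a n *\<^sub>R v) {0..T}"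
    using cd by (subst has_integral_restrict) auto
  then show ?thesis
    by (rule has_integral_spike_finite[of "{d}", rotated 2]) (auto simp: in_needle_def c_def d_def)
qed

text \<open>
  Pointwise stabilization outside finitely many instants is what dominated convergence needs
  in the proof that the endpoint depends continuously on the lengths.
\<close>

lemma needle_control_eventually_const:
  assumes b: "\<And>i. i < n \<Longrightarrow> (\<lambda>k. b k i) \<longlonglongrightarrow> a i"
    and s: "\<And>i. i < n \<Longrightarrow> s \<noteq> \<tau> i + sum a {..<i} \<and> s \<noteq> \<tau> i + sum a {..<Suc i}"
  shows "\<forall>\<^sub>F k in sequentially. needle_control \<tau> \<zeta> u (b k) n s = needle_control \<tau> \<zeta> u a n s"
  using assms
proof (induction n)
  case (Suc n)
  have threshold: "\<forall>\<^sub>F k in sequentially. c k < s \<longleftrightarrow> l < s" "\<forall>\<^sub>F k in sequentially. c k \<le> s \<longleftrightarrow> l \<le> s"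
    if "c \<longlonglongrightarrow> l" "s \<noteq> l" for c l
  proof -
    have "\<forall>\<^sub>F k in sequentially. (c k < s \<longleftrightarrow> l < s) \<and> (c k \<le> s \<longleftrightarrow> l \<le> s)"
    proof (cases "l < s")
      case True
      with order_tendstoD(2)[OF that(1)] have "\<forall>\<^sub>F k in sequentially. c k < s" by blast
      then show ?thesis by eventually_elim (use True in auto)
    next
      case False
      with that(2) order_tendstoD(1)[OF that(1), of s] have "\<forall>\<^sub>F k in sequentially. s < c k" by simp
      then show ?thesis by eventually_elim (use False that(2) in auto)
    qed
    then show "\<forall>\<^sub>F k in sequentially. c k < s \<longleftrightarrow> l < s" "\<forall>\<^sub>F k in sequentially. c k \<le> s \<longleftrightarrow> l \<le> s"
      by (auto elim: eventually_mono)
  qed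
  have lim: "(\<lambda>k. \<tau> n + sum (b k) {..<m}) \<longlonglongrightarrow> \<tau> n + sum a {..<m}" if "m \<le> Suc n" for m
    by (intro tendsto_intros Suc.prems(1)) (use that in auto)
  have "\<forall>\<^sub>F k in sequentially. \<tau> n + sum (b k) {..<n} \<le> s \<longleftrightarrow> \<tau> n + sum a {..<n} \<le> s"
    using Suc.prems(2)[of n] by (intro threshold lim) auto
  moreover have "\<forall>\<^sub>F k in sequentially. \<tau> n + sum (b k) {..<Suc n} \<le> s \<longleftrightarrow> \<tau> n + sum a {..<Suc n} \<le> s"
    using Suc.prems(2)[of n] by (intro threshold lim) auto
  moreover have "\<forall>\<^sub>F k in sequentially. needle_control \<tau> \<zeta> u (b k) n s = needle_control \<tau> \<zeta> u a n s"
    by (rule Suc.IH) (use Suc.prems in auto)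
  ultimately show ?case
  proof eventually_elim
    case (elim k)
    then have "s < \<tau> n + sum (b k) {..<Suc n} \<longleftrightarrow> s < \<tau> n + sum a {..<Suc n}" by (simp only: not_le[symmetric])
    with elim show ?case by simp
  qed
qed simp

section \<open>Trajectories near a reference trajectory\<close>

text \<open>
  A dynamics together with a reference trajectory. The Lipschitz hypothesis is stated for each
  compact set of control values, because the radius and the constant depend on the values used
  by the needles.
\<close>

locale controlled_trajectory =
  fixes T :: real and \<Omega> :: "'b::banach set" and U :: "'u::t2_space set"
    and F :: "real \<Rightarrow> 'b \<Rightarrow> 'u \<Rightarrow> 'b" and A :: "real \<Rightarrow> 'u \<Rightarrow> 'b \<Rightarrow>\<^sub>L 'b"
    and x\<^sub>0 :: "real \<Rightarrow> 'b" and u\<^sub>0 :: "real \<Rightarrow> 'u" and S\<^sub>0 :: "real set"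
  assumes T: "T > 0"
    and F_cont: "continuous_on ({0..T} \<times> \<Omega> \<times> U) (\<lambda>(t, \<xi>, \<zeta>). F t \<xi> \<zeta>)"
    and u0: "normal_pc T U S\<^sub>0 u\<^sub>0"
    and x0_cont: "continuous_on {0..T} x\<^sub>0" and x0_\<Omega>: "x\<^sub>0 ` {0..T} \<subseteq> \<Omega>"
    and x0_eq: "\<And>t. t \<in> {0..T} \<Longrightarrow> x\<^sub>0 t = x\<^sub>0 0 + integral {0..t} (\<lambda>s. F s (x\<^sub>0 s) (u\<^sub>0 s))"
    and A_deriv: "\<And>t \<zeta>. t \<in> {0..T} \<Longrightarrow> \<zeta> \<in> U \<Longrightarrow>
        ((\<lambda>\<xi>. F t \<xi> \<zeta>) has_derivative blinfun_apply (A t \<zeta>)) (at (x\<^sub>0 t))"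
    and A_cont: "continuous_on ({0..T} \<times> U) (\<lambda>(t, \<zeta>). A t \<zeta>)"
    and lip: "\<And>M. compact M \<Longrightarrow> M \<subseteq> U \<Longrightarrow> \<exists>\<rho>>0. \<exists>L>0. \<forall>t\<in>{0..T}. cball (x\<^sub>0 t) \<rho> \<subseteq> \<Omega> \<and>
        (\<forall>\<zeta>\<in>M. \<forall>\<xi>\<in>cball (x\<^sub>0 t) \<rho>. \<forall>\<eta>\<in>cball (x\<^sub>0 t) \<rho>. norm (F t \<xi> \<zeta> - F t \<eta> \<zeta>) \<le> L * norm (\<xi> - \<eta>))"
begin

lemma regulated_integrable_full: "regulated T \<phi> \<Longrightarrow> \<phi> integrable_on {0..T}" for \<phi> :: "real \<Rightarrow> 'c::banach"
  by (rule regulated_integrable_on) auto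

definition trajectory :: "(real \<Rightarrow> 'b) \<Rightarrow> (real \<Rightarrow> 'u) \<Rightarrow> bool" where
  "trajectory x u \<longleftrightarrow> (\<exists>S. normal_pc T U S u) \<and> continuous_on {0..T} x \<and> x ` {0..T} \<subseteq> \<Omega> \<and>
     (\<forall>t\<in>{0..T}. x t = x\<^sub>0 0 + integral {0..t} (\<lambda>s. F s (x s) (u s)))"

lemma velocity_normal_pc:
  assumes "normal_pc T U S u" "continuous_on {0..T} x" "x ` {0..T} \<subseteq> \<Omega>"
  shows "normal_pc T UNIV S (\<lambda>s. F s (x s) (u s))"
  using normal_pc_compose[OF assms(1) T assms(2,3) F_cont] by simp

lemma velocity_regulated:
  assumes "normal_pc T U S u" "continuous_on {0..T} x" "x ` {0..T} \<subseteq> \<Omega>"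
  shows "regulated T (\<lambda>s. F s (x s) (u s))"
  using velocity_normal_pc[OF assms] by (rule normal_pc_regulated)

lemma linearization_normal_pc: "normal_pc T UNIV S\<^sub>0 (\<lambda>s. A s (u\<^sub>0 s))"
proof -
  have "continuous_on ({0..T} \<times> UNIV \<times> U) (\<lambda>p. (\<lambda>(t, \<zeta>). A t \<zeta>) (fst p, snd (snd p)))"
    by (rule continuous_on_compose2[OF A_cont]) (auto intro!: continuous_intros)
  from normal_pc_compose[OF u0 T x0_cont _ this] show ?thesis by simp
qed

lemma normal_pc_bounded:
  fixes \<phi> :: "real \<Rightarrow> 'c::real_normed_vector"
  assumes "normal_pc T UNIV S \<phi>"
  obtains B where "B > 0" "\<And>s. s \<in> {0..T} \<Longrightarrow> norm (\<phi> s) \<le> B"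
proof -
  obtain M where "compact M" "\<phi> ` {0..T} \<subseteq> M" using normal_pc_compact_range[OF assms] by blast
  then have "bounded (\<phi> ` {0..T})" using compact_imp_bounded bounded_subset by blast
  then show ?thesis using that unfolding bounded_pos by auto
qed

text \<open>
  \<open>P t\<close> maps a state deviation at time \<open>t\<close> to the deviation that the linearized equation
  yields at time \<open>T\<close>. It is operator-valued so that the endpoint deviation is controlled in
  norm and not only after application of a functional.
\<close>

lemma transition_operator:
  obtains P :: "real \<Rightarrow> 'b \<Rightarrow>\<^sub>L 'b" where "continuous_on {0..T} P" "P T = id_blinfun"
    "\<And>t. t \<in> {0..T} \<Longrightarrow> P t = P 0 + integral {0..t} (\<lambda>s. - (P s o\<^sub>L A s (u\<^sub>0 s)))"
proof -
  obtain B where B: "B > 0" "\<And>s. s \<in> {0..T} \<Longrightarrow> norm (A s (u\<^sub>0 s)) \<le> B"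
    using normal_pc_bounded[OF linearization_normal_pc] by blast
  have reg: "regulated T (\<lambda>s. P s o\<^sub>L A s (u\<^sub>0 s))" if "continuous_on {0..T} P" for P :: "real \<Rightarrow> 'b \<Rightarrow>\<^sub>L 'b"
    by (rule regulated_map2[OF continuous_on_regulated[OF that] normal_pc_regulated[OF linearization_normal_pc]],
      rule exI, erule (1) bounded_bilinear.tendsto[OF bounded_bilinear_blinfun_compose])
  have "\<exists>P. continuous_on {0..T} P \<and> (\<forall>t\<in>{0..T}. P t = id_blinfun + integral {t..T} (\<lambda>s. P s o\<^sub>L A s (u\<^sub>0 s)))"
  proof (rule integral_equation_solution_backward)
    fix t and P Q :: "'b \<Rightarrow>\<^sub>L 'b" assume "t \<in> {0..T}"
    have "norm ((P o\<^sub>L A t (u\<^sub>0 t)) - (Q o\<^sub>L A t (u\<^sub>0 t))) = norm ((P - Q) o\<^sub>L A t (u\<^sub>0 t))"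
      by (simp add: bounded_bilinear.diff_left[OF bounded_bilinear_blinfun_compose])
    also have "\<dots> \<le> norm (P - Q) * norm (A t (u\<^sub>0 t))" by (rule norm_blinfun_compose)
    also have "\<dots> \<le> norm (P - Q) * B" using B(2)[OF \<open>t \<in> {0..T}\<close>] by (intro mult_left_mono) auto
    finally show "norm ((P o\<^sub>L A t (u\<^sub>0 t)) - (Q o\<^sub>L A t (u\<^sub>0 t))) \<le> B * norm (P - Q)" by (simp add: mult.commute)
  qed (use T B reg in \<open>auto intro: regulated_integrable_on\<close>)
  then obtain P where P: "continuous_on {0..T} P"
    "\<And>t. t \<in> {0..T} \<Longrightarrow> P t = id_blinfun + integral {t..T} (\<lambda>s. P s o\<^sub>L A s (u\<^sub>0 s))" by blast
  show ?thesis
  proof (rule that[of P, OF P(1)])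
    show "P T = id_blinfun" using P(2)[of T] T by simp
    fix t assume t: "t \<in> {0..T}"
    have "integral {0..t} (\<lambda>s. P s o\<^sub>L A s (u\<^sub>0 s)) + integral {t..T} (\<lambda>s. P s o\<^sub>L A s (u\<^sub>0 s))
        = integral {0..T} (\<lambda>s. P s o\<^sub>L A s (u\<^sub>0 s))"
      using t reg[OF P(1)] by (intro Henstock_Kurzweil_Integration.integral_combine regulated_integrable_on) auto
    then show "P t = P 0 + integral {0..t} (\<lambda>s. - (P s o\<^sub>L A s (u\<^sub>0 s)))"
      using P(2)[OF t] P(2)[of 0] T by (simp add: algebra_simps)
  qed
qed

lemma transition_operator_derivative:
  fixes P :: "real \<Rightarrow> 'b \<Rightarrow>\<^sub>L 'b"
  assumes P: "continuous_on {0..T} P" "\<And>t. t \<in> {0..T} \<Longrightarrow> P t = P 0 + integral {0..t} (\<lambda>s. - (P s o\<^sub>L A s (u\<^sub>0 s)))"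
  shows "t \<in> {0..T} - S\<^sub>0 \<Longrightarrow> (P has_vector_derivative - (P t o\<^sub>L A t (u\<^sub>0 t))) (at t)"
proof -
  have "continuous_on ({0..T} \<times> UNIV \<times> U) (\<lambda>p. - (fst (snd p) o\<^sub>L (\<lambda>(t, \<zeta>). A t \<zeta>) (fst p, snd (snd p))))"
    by (intro continuous_on_minus bounded_bilinear.continuous_on[OF bounded_bilinear_blinfun_compose]
        continuous_on_compose2[OF A_cont]) (auto intro!: continuous_intros)
  from normal_pc_compose[OF u0 T P(1) _ this]
  have "normal_pc T UNIV S\<^sub>0 (\<lambda>s. - (P s o\<^sub>L A s (u\<^sub>0 s)))" by simp
  from primitive_of_normal_pc(4)[where x = P, OF this T P(2)]
  show "t \<in> {0..T} - S\<^sub>0 \<Longrightarrow> (P has_vector_derivative - (P t o\<^sub>L A t (u\<^sub>0 t))) (at t)" by blast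
qed

text \<open>
  The derivative of \<open>P s (x s - x\<^sub>0 s)\<close> contains the linear term twice with opposite
  signs; what is left is the deviation of the velocities from the linearization.
\<close>

lemma endpoint_deviation:
  assumes P: "continuous_on {0..T} P" "P T = id_blinfun"
      "\<And>t. t \<in> {0..T} \<Longrightarrow> P t = P 0 + integral {0..t} (\<lambda>s. - (P s o\<^sub>L A s (u\<^sub>0 s)))"
    and x: "trajectory x u"
  shows "((\<lambda>s. blinfun_apply (P s) (F s (x s) (u s) - F s (x\<^sub>0 s) (u\<^sub>0 s) - blinfun_apply (A s (u\<^sub>0 s)) (x s - x\<^sub>0 s)))
    has_integral x T - x\<^sub>0 T) {0..T}"
proof -
  obtain S where S: "normal_pc T U S u" using x by (auto simp: trajectory_def)
  have xc: "continuous_on {0..T} x" and x_\<Omega>: "x ` {0..T} \<subseteq> \<Omega>"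
    and x_eq: "\<And>t. t \<in> {0..T} \<Longrightarrow> x t = x\<^sub>0 0 + integral {0..t} (\<lambda>s. F s (x s) (u s))"
    using x by (auto simp: trajectory_def)
  have start: "x 0 = x\<^sub>0 0" using x_eq[of 0] T by simp
  have dx: "(x has_vector_derivative F t (x t) (u t)) (at t)" if "t \<in> {0..T} - S" for t
    using primitive_of_normal_pc(4)[where x = x, OF velocity_normal_pc[OF S xc x_\<Omega>] T] x_eq start that by simp
  have dx0: "(x\<^sub>0 has_vector_derivative F t (x\<^sub>0 t) (u\<^sub>0 t)) (at t)" if "t \<in> {0..T} - S\<^sub>0" for t
    using primitive_of_normal_pc(4)[where x = x\<^sub>0, OF velocity_normal_pc[OF u0 x0_cont x0_\<Omega>] T x0_eq that] .
  have "((\<lambda>s. blinfun_apply (P s) (F s (x s) (u s) - F s (x\<^sub>0 s) (u\<^sub>0 s) - blinfun_apply (A s (u\<^sub>0 s)) (x s - x\<^sub>0 s)))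
    has_integral blinfun_apply (P T) (x T - x\<^sub>0 T) - blinfun_apply (P 0) (x 0 - x\<^sub>0 0)) {0..T}"
  proof (rule fundamental_theorem_of_calculus_interior_strong[of "S \<union> S\<^sub>0"])
    show "finite (S \<union> S\<^sub>0)" using normal_pcD(1)[OF S] normal_pcD(1)[OF u0] by simp
    show "continuous_on {0..T} (\<lambda>s. blinfun_apply (P s) (x s - x\<^sub>0 s))"
      by (intro continuous_intros P(1) xc x0_cont)
    fix t assume t: "t \<in> {0<..<T} - (S \<union> S\<^sub>0)"
    have "((\<lambda>s. blinfun_apply (P s) (x s - x\<^sub>0 s)) has_vector_derivative
        blinfun_apply (P t) (F t (x t) (u t) - F t (x\<^sub>0 t) (u\<^sub>0 t)) +
        blinfun_apply (- (P t o\<^sub>L A t (u\<^sub>0 t))) (x t - x\<^sub>0 t)) (at t)"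
      by (rule bounded_bilinear.has_vector_derivative[OF bounded_bilinear_blinfun_apply
            transition_operator_derivative[OF P(1,3)] has_vector_derivative_diff[OF dx dx0]]) (use t in auto)
    moreover have "blinfun_apply (P t) v + blinfun_apply (- (P t o\<^sub>L B)) w = blinfun_apply (P t) (v - blinfun_apply B w)"
      for v w and B :: "'b \<Rightarrow>\<^sub>L 'b" by (simp add: blinfun.diff_right blinfun.minus_left)
    ultimately show "((\<lambda>s. blinfun_apply (P s) (x s - x\<^sub>0 s)) has_vector_derivative
        blinfun_apply (P t) (F t (x t) (u t) - F t (x\<^sub>0 t) (u\<^sub>0 t) - blinfun_apply (A t (u\<^sub>0 t)) (x t - x\<^sub>0 t))) (at t)"
      by (simp only:)
  qed (use T in auto)
  then show ?thesis using P(2) start by simp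
qed

text \<open>
  The equation is solved for the retracted dynamics, which is globally Lipschitz with constant
  \<open>2 * L\<close>. The stability bound \<open>D\<close> does not exceed the radius, so the solution never feels the
  retraction.
\<close>

lemma perturbed_trajectory_exists:
  assumes M: "compact M" "M \<subseteq> U" and u0M: "u\<^sub>0 ` {0..T} \<subseteq> M"
    and \<rho>: "\<rho> > 0" and L: "L > 0" and tube: "\<And>t. t \<in> {0..T} \<Longrightarrow> cball (x\<^sub>0 t) \<rho> \<subseteq> \<Omega>"
    and lip: "\<And>t \<zeta> \<xi> \<eta>. t \<in> {0..T} \<Longrightarrow> \<zeta> \<in> M \<Longrightarrow> \<xi> \<in> cball (x\<^sub>0 t) \<rho> \<Longrightarrow> \<eta> \<in> cball (x\<^sub>0 t) \<rho> \<Longrightarrow>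
        norm (F t \<xi> \<zeta> - F t \<eta> \<zeta>) \<le> L * norm (\<xi> - \<eta>)"
    and u: "normal_pc T U S u" "u ` {0..T} \<subseteq> M"
    and D: "D = 2 * integral {0..T} (\<lambda>s. norm (F s (x\<^sub>0 s) (u s) - F s (x\<^sub>0 s) (u\<^sub>0 s))) * exp (2 * (2 * L) * T)"
    and small: "D \<le> \<rho>"
  shows "\<exists>x. trajectory x u \<and> (\<forall>t\<in>{0..T}. norm (x t - x\<^sub>0 t) \<le> D)"
proof -
  define G where "G s \<xi> = F s (x\<^sub>0 s + radial_retraction \<rho> (\<xi> - x\<^sub>0 s)) (u s)" for s \<xi>
  have in_tube: "x\<^sub>0 s + radial_retraction \<rho> v \<in> cball (x\<^sub>0 s) \<rho>" for s v
    using norm_radial_retraction[OF \<rho>, of v] by (simp add: dist_norm)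
  have G_lip: "norm (G t \<xi> - G t \<eta>) \<le> 2 * L * norm (\<xi> - \<eta>)" if "t \<in> {0..T}" for t \<xi> \<eta>
  proof -
    have "u t \<in> M" using u(2) that by auto
    then have "norm (G t \<xi> - G t \<eta>) \<le> L * norm (radial_retraction \<rho> (\<xi> - x\<^sub>0 t) - radial_retraction \<rho> (\<eta> - x\<^sub>0 t))"
      unfolding G_def using lip[OF that _ in_tube in_tube] by fastforce
    also have "\<dots> \<le> L * (2 * norm ((\<xi> - x\<^sub>0 t) - (\<eta> - x\<^sub>0 t)))"
      using L by (intro mult_left_mono radial_retraction_lipschitz \<rho>) auto
    finally show ?thesis by simp
  qed
  have G_reg: "regulated T (\<lambda>s. G s (x s))" if "continuous_on {0..T} x" for x
    unfolding G_def
  proof (rule velocity_regulated[OF u(1)])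
    show "continuous_on {0..T} (\<lambda>s. x\<^sub>0 s + radial_retraction \<rho> (x s - x\<^sub>0 s))"
      by (intro continuous_intros x0_cont that continuous_on_compose2[OF continuous_on_radial_retraction[OF \<rho>, of UNIV]]) auto
    show "(\<lambda>s. x\<^sub>0 s + radial_retraction \<rho> (x s - x\<^sub>0 s)) ` {0..T} \<subseteq> \<Omega>"
      using in_tube tube by blast
  qed
  have "\<exists>x. continuous_on {0..T} x \<and> (\<forall>t\<in>{0..T}. x t = x\<^sub>0 0 + integral {0..t} (\<lambda>s. G s (x s)))"
    using T L G_lip by (intro integral_equation_solution[where L = "2 * L"]) (auto intro!: regulated_integrable_on G_reg)
  then obtain x where x: "continuous_on {0..T} x" "\<And>t. t \<in> {0..T} \<Longrightarrow> x t = x\<^sub>0 0 + integral {0..t} (\<lambda>s. G s (x s))"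
    by blast
  have close: "norm (x t - x\<^sub>0 t) \<le> D" if t: "t \<in> {0..T}" for t
    unfolding D
  proof (rule integral_equation_stability[OF _ x x0_cont x0_eq _ _ _ _ _ t])
    show "(\<lambda>s. G s (x s)) integrable_on {0..T}"
      by (intro regulated_integrable_full G_reg x(1))
    show "(\<lambda>s. F s (x\<^sub>0 s) (u\<^sub>0 s)) integrable_on {0..T}"
      by (intro regulated_integrable_full velocity_regulated[OF u0] x0_cont x0_\<Omega>)
    show "(\<lambda>s. norm (F s (x\<^sub>0 s) (u s) - F s (x\<^sub>0 s) (u\<^sub>0 s))) integrable_on {0..T}"
      by (intro regulated_integrable_full regulated_norm regulated_diff velocity_regulated[OF u0]
          velocity_regulated[OF u(1)] x0_cont x0_\<Omega>)
    fix s assume s: "s \<in> {0..T}"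
    have "G s (x\<^sub>0 s) = F s (x\<^sub>0 s) (u s)" using \<rho> by (simp add: G_def radial_retraction_def)
    then have "G s (x s) - F s (x\<^sub>0 s) (u\<^sub>0 s) = (G s (x s) - G s (x\<^sub>0 s)) + (F s (x\<^sub>0 s) (u s) - F s (x\<^sub>0 s) (u\<^sub>0 s))"
      by simp
    then have "norm (G s (x s) - F s (x\<^sub>0 s) (u\<^sub>0 s)) \<le> norm (G s (x s) - G s (x\<^sub>0 s)) + norm (F s (x\<^sub>0 s) (u s) - F s (x\<^sub>0 s) (u\<^sub>0 s))"
      by (metis norm_triangle_ineq)
    with G_lip[OF s, of "x s" "x\<^sub>0 s"]
    show "norm (G s (x s) - F s (x\<^sub>0 s) (u\<^sub>0 s)) \<le> 2 * L * norm (x s - x\<^sub>0 s) + norm (F s (x\<^sub>0 s) (u s) - F s (x\<^sub>0 s) (u\<^sub>0 s))"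
      by linarith
  qed (use L in auto)
  have G_eq: "G s (x s) = F s (x s) (u s)" if "s \<in> {0..T}" for s
    using order_trans[OF close[OF that] small] by (simp add: G_def radial_retraction_def)
  have "x t = x\<^sub>0 0 + integral {0..t} (\<lambda>s. F s (x s) (u s))" if t: "t \<in> {0..T}" for t
  proof -
    have "integral {0..t} (\<lambda>s. G s (x s)) = integral {0..t} (\<lambda>s. F s (x s) (u s))"
      by (rule integral_cong) (use G_eq t in auto)
    then show ?thesis using x(2)[OF t] by simp
  qed
  moreover have "x ` {0..T} \<subseteq> \<Omega>"
  proof (rule image_subsetI)
    fix t assume t: "t \<in> {0..T}"
    have "x t \<in> cball (x\<^sub>0 t) \<rho>"
      using order_trans[OF close[OF t] small] by (simp add: dist_norm norm_minus_commute)
    then show "x t \<in> \<Omega>" using tube[OF t] by blast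
  qed
  ultimately have "trajectory x u" unfolding trajectory_def using u(1) x(1) by blast
  then show ?thesis using close by blast
qed

end

section \<open>Support functionals of cones and the Poincare-Miranda theorem\<close>

text \<open>
  The slices of the cone over \<open>I\<close> have a lower boundary in direction \<open>j\<close>, a sublinear
  function, and \<open>\<phi>\<close> is a linear function below it. As in the Hahn-Banach theorem one
  coordinate is treated at a time: the slope \<open>c\<close> in direction \<open>k\<close> fits between the values over
  \<open>1\<close> and over \<open>- 1\<close>, and subtracting it removes \<open>k\<close>. Coordinates range over a finite set
  instead of a type, since the number of constraints is a term.
\<close>

lemma sublinear_separation:
  fixes K :: "('i \<Rightarrow> real) set"
  assumes "finite I" and "j \<notin> I"
    and "\<And>x y. x \<in> K \<Longrightarrow> y \<in> K \<Longrightarrow> (\<lambda>i. x i + y i) \<in> K"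
    and "\<And>c x. c > 0 \<Longrightarrow> x \<in> K \<Longrightarrow> (\<lambda>i. c * x i) \<in> K"
    and "\<And>y. \<exists>x\<in>K. \<forall>i\<in>I. x i = y i"
    and "\<And>x. x \<in> K \<Longrightarrow> (\<forall>i\<in>I. x i = 0) \<Longrightarrow> x j \<ge> 0"
  shows "\<exists>\<phi>. \<forall>x\<in>K. (\<Sum>i\<in>I. \<phi> i * x i) \<le> x j"
  using assms
proof (induction I arbitrary: K rule: finite_induct)
  case empty
  then show ?case by auto
next
  case (insert k I)
  note add = insert.prems(2) and scale = insert.prems(3) and onto = insert.prems(4)
    and slice = insert.prems(5)
  let ?A = "{x j |x. x \<in> K \<and> (\<forall>i\<in>I. x i = 0) \<and> x k = 1}"
  define c where "c = Inf ?A"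
  have opp: "- b \<le> a" if "x \<in> K" "\<forall>i\<in>I. x i = 0" "x k = 1" "a = x j"
      "y \<in> K" "\<forall>i\<in>I. y i = 0" "y k = -1" "b = y j" for x y a b
    using slice[of "\<lambda>i. x i + y i"] add[of x y] that by force
  have eq_on: "\<exists>x\<in>K. (\<forall>i\<in>I. x i = 0) \<and> x k = s" for s
  proof -
    obtain x where "x \<in> K" "\<forall>i\<in>insert k I. x i = (if i = k then s else 0)"
      using onto[of "\<lambda>i. if i = k then s else 0"] by auto
    then have "x k = s" and "x i = 0" if "i \<in> I" for i
      using that insert.hyps by auto
    then have "\<forall>i\<in>I. x i = 0" "x k = s" using \<open>\<forall>i\<in>insert k I. _\<close> by auto
    then show ?thesis using \<open>x \<in> K\<close> by blast
  qed
  obtain y1 where y1: "y1 \<in> K" "\<forall>i\<in>I. y1 i = 0" "y1 k = -1"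
    using eq_on[of "-1"] by blast
  obtain x1 where x1: "x1 \<in> K" "\<forall>i\<in>I. x1 i = 0" "x1 k = 1"
    using eq_on[of 1] by blast
  have ne: "?A \<noteq> {}" using x1 by auto
  have bdd: "bdd_below ?A"
    unfolding bdd_below_def using opp y1 by (intro exI[of _ "- y1 j"]) auto
  have c_le: "c \<le> x j" if "x \<in> K" "\<forall>i\<in>I. x i = 0" "x k = 1" for x
    unfolding c_def using that by (intro cInf_lower bdd) auto
  have c_ge: "- y j \<le> c" if "y \<in> K" "\<forall>i\<in>I. y i = 0" "y k = -1" for y
    unfolding c_def using that opp by (intro cInf_greatest ne) auto
  have plane: "c * x k \<le> x j" if x: "x \<in> K" "\<forall>i\<in>I. x i = 0" for x
  proof (cases "x k = 0")
    case True
    then show ?thesis using slice[of x] x by auto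
  next
    case False
    define y where "y = (\<lambda>i. inverse \<bar>x k\<bar> * x i)"
    have y: "y \<in> K" unfolding y_def using False x by (intro scale) auto
    have y0: "\<forall>i\<in>I. y i = 0" unfolding y_def using x by auto
    have yj: "x j = \<bar>x k\<bar> * y j" unfolding y_def using False by simp
    show ?thesis
    proof (cases "x k > 0")
      case True
      then have "y k = 1" by (simp add: y_def)
      with c_le[OF y y0] True yj show ?thesis by (simp add: mult.commute)
    next
      case neg: False
      then have "y k = -1" using False by (simp add: y_def)
      from c_ge[OF y y0 this] have "\<bar>x k\<bar> * (- y j) \<le> \<bar>x k\<bar> * c" by (intro mult_left_mono) auto
      then show ?thesis using yj neg by (simp add: mult.commute)
    qed
  qed
  define K' where "K' = (\<lambda>x. x(j := x j - c * x k)) ` K"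
  have jk: "j \<noteq> k" "j \<notin> I" using insert.prems(1) by auto
  have "\<exists>\<phi>. \<forall>x\<in>K'. (\<Sum>i\<in>I. \<phi> i * x i) \<le> x j"
  proof (rule insert.IH)
    show "(\<lambda>i. x i + y i) \<in> K'" if xy: "x \<in> K'" "y \<in> K'" for x y
    proof -
      obtain u v where uv: "u \<in> K" "x = u(j := u j - c * u k)" "v \<in> K" "y = v(j := v j - c * v k)"
        using xy unfolding K'_def by blast
      show ?thesis unfolding K'_def
        by (rule image_eqI[OF _ add[OF uv(1,3)]]) (use uv jk in \<open>auto simp: algebra_simps\<close>)
    qed
    show "(\<lambda>i. d * x i) \<in> K'" if dx: "d > 0" "x \<in> K'" for d x
    proof -
      obtain u where u: "u \<in> K" "x = u(j := u j - c * u k)"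
        using dx unfolding K'_def by blast
      show ?thesis unfolding K'_def
        by (rule image_eqI[OF _ scale[OF dx(1) u(1)]]) (use u jk in \<open>auto simp: algebra_simps\<close>)
    qed
    show "\<exists>x\<in>K'. \<forall>i\<in>I. x i = y i" for y
    proof -
      obtain x where "x \<in> K" "\<forall>i\<in>insert k I. x i = y i" using onto by blast
      then show ?thesis unfolding K'_def using jk by (intro bexI[OF _ imageI[of x]]) auto
    qed
    show "0 \<le> x j" if xx: "x \<in> K'" "\<forall>i\<in>I. x i = 0" for x
    proof -
      obtain u where u: "u \<in> K" "x = u(j := u j - c * u k)" using xx unfolding K'_def by blast
      have "u i = 0" if "i \<in> I" for i
        using xx(2)[rule_format, OF that] that u(2) jk by (auto split: if_splits)
      then have "\<forall>i\<in>I. u i = 0" by blast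
      with plane[OF u(1)] u show ?thesis by simp
    qed
  qed (use jk in auto)
  then obtain \<phi> where \<phi>: "\<forall>x\<in>K'. (\<Sum>i\<in>I. \<phi> i * x i) \<le> x j" by blast
  have "(\<Sum>i\<in>insert k I. (\<phi>(k := c)) i * x i) \<le> x j" if "x \<in> K" for x
  proof -
    have "(\<Sum>i\<in>I. \<phi> i * (x(j := x j - c * x k)) i) \<le> x j - c * x k"
      using \<phi> that unfolding K'_def by auto
    moreover have "(\<Sum>i\<in>I. \<phi> i * (x(j := x j - c * x k)) i) = (\<Sum>i\<in>I. (\<phi>(k := c)) i * x i)"
      using jk insert.hyps by (intro sum.cong) auto
    ultimately show ?thesis using insert.hyps by simp
  qed
  then show ?case by blast
qed

text \<open>
  If the projection to \<open>I\<close> is not everything, a functional on \<open>I\<close> is extended by zero.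
  Otherwise the cone contains points over the origin of \<open>I\<close> on at most one side in direction
  \<open>j\<close>, and it lies on one side of the graph of a linear function.
\<close>

lemma cone_support_functional:
  fixes K :: "('i \<Rightarrow> real) set"
  assumes "finite I"
    and "\<And>x y. x \<in> K \<Longrightarrow> y \<in> K \<Longrightarrow> (\<lambda>i. x i + y i) \<in> K"
    and "\<And>c x. c > 0 \<Longrightarrow> x \<in> K \<Longrightarrow> (\<lambda>i. c * x i) \<in> K"
    and "K \<noteq> {}" and "\<not> (\<forall>y. \<exists>x\<in>K. \<forall>i\<in>I. x i = y i)"
  shows "\<exists>\<phi>. (\<exists>i\<in>I. \<phi> i \<noteq> 0) \<and> (\<forall>x\<in>K. (\<Sum>i\<in>I. \<phi> i * x i) \<le> 0)"
  using assms
proof (induction I rule: finite_induct)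
  case empty
  then show ?case by auto
next
  case (insert j I)
  note add = insert.prems(1) and scale = insert.prems(2)
  show ?case
  proof (cases "\<forall>y. \<exists>x\<in>K. \<forall>i\<in>I. x i = y i")
    case False
    then obtain \<phi> where \<phi>: "\<exists>i\<in>I. \<phi> i \<noteq> 0" "\<forall>x\<in>K. (\<Sum>i\<in>I. \<phi> i * x i) \<le> 0"
      using insert.IH insert.prems by blast
    have "(\<Sum>i\<in>insert j I. (\<phi>(j := 0)) i * x i) = (\<Sum>i\<in>I. \<phi> i * x i)" for x
    proof -
      have "(\<Sum>i\<in>I. (\<phi>(j := 0)) i * x i) = (\<Sum>i\<in>I. \<phi> i * x i)"
        by (intro sum.cong) (use insert.hyps in auto)
      then show ?thesis using insert.hyps by simp
    qed
    moreover have "\<exists>i\<in>insert j I. (\<phi>(j := 0)) i \<noteq> 0" using \<phi>(1) insert.hyps by fastforce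
    ultimately show ?thesis using \<phi>(2) by (intro exI[of _ "\<phi>(j := 0)"]) simp
  next
    case True
    have "\<exists>\<sigma>::real. \<bar>\<sigma>\<bar> = 1 \<and> (\<forall>x\<in>K. (\<forall>i\<in>I. x i = 0) \<longrightarrow> 0 \<le> \<sigma> * x j)"
    proof (rule ccontr)
      assume "\<not> ?thesis"
      then have no: "\<And>\<sigma>::real. \<bar>\<sigma>\<bar> = 1 \<Longrightarrow> \<exists>x\<in>K. (\<forall>i\<in>I. x i = 0) \<and> \<sigma> * x j < 0"
        by (meson not_less)
      obtain p where p: "p \<in> K" "\<forall>i\<in>I. p i = 0" "p j > 0" using no[of "-1"] by auto
      obtain n where n: "n \<in> K" "\<forall>i\<in>I. n i = 0" "n j < 0" using no[of 1] by auto
      have "\<exists>x\<in>K. \<forall>i\<in>insert j I. x i = y i" for y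
      proof -
        obtain x where x: "x \<in> K" "\<forall>i\<in>I. x i = y i" using True by blast
        define d where "d = y j - x j"
        consider "d = 0" | "d > 0" | "d < 0" by linarith
        then show ?thesis
        proof cases
          case 1
          then show ?thesis using x d_def by (intro bexI[of _ x]) auto
        next
          case 2
          then have "(\<lambda>i. x i + (d / p j) * p i) \<in> K" using x p by (intro add scale) auto
          then show ?thesis
            by (rule rev_bexI) (use x p 2 d_def in auto)
        next
          case 3
          then have "(\<lambda>i. x i + (d / n j) * n i) \<in> K" using x n by (intro add scale) (auto simp: divide_neg_neg)
          then show ?thesis
            by (rule rev_bexI) (use x n 3 d_def in auto)
        qed
      qed
      then show False using insert.prems by blast
    qed
    then obtain \<sigma> :: real where \<sigma>: "\<bar>\<sigma>\<bar> = 1" "\<And>x. x \<in> K \<Longrightarrow> \<forall>i\<in>I. x i = 0 \<Longrightarrow> 0 \<le> \<sigma> * x j"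
      by blast
    define K' where "K' = (\<lambda>x. x(j := \<sigma> * x j)) ` K"
    have "\<exists>\<phi>. \<forall>x\<in>K'. (\<Sum>i\<in>I. \<phi> i * x i) \<le> x j"
    proof (rule sublinear_separation)
      show "(\<lambda>i. x i + y i) \<in> K'" if xy: "x \<in> K'" "y \<in> K'" for x y
      proof -
        obtain u v where uv: "u \<in> K" "x = u(j := \<sigma> * u j)" "v \<in> K" "y = v(j := \<sigma> * v j)"
          using xy unfolding K'_def by blast
        show ?thesis unfolding K'_def
          by (rule image_eqI[OF _ add[OF uv(1,3)]]) (use uv in \<open>auto simp: algebra_simps\<close>)
      qed
      show "(\<lambda>i. d * x i) \<in> K'" if dx: "d > 0" "x \<in> K'" for d x
      proof -
        obtain u where u: "u \<in> K" "x = u(j := \<sigma> * u j)" using dx unfolding K'_def by blast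
        show ?thesis unfolding K'_def
          by (rule image_eqI[OF _ scale[OF dx(1) u(1)]]) (use u in \<open>auto simp: algebra_simps\<close>)
      qed
      show "\<exists>x\<in>K'. \<forall>i\<in>I. x i = y i" for y
      proof -
        obtain x where "x \<in> K" "\<forall>i\<in>I. x i = y i" using True by blast
        then show ?thesis unfolding K'_def using insert.hyps
          by (intro bexI[OF _ imageI[of x]]) auto
      qed
      show "0 \<le> x j" if xx: "x \<in> K'" "\<forall>i\<in>I. x i = 0" for x
      proof -
        obtain u where u: "u \<in> K" "x = u(j := \<sigma> * u j)" using xx unfolding K'_def by blast
        have "u i = 0" if "i \<in> I" for i
          using xx(2)[rule_format, OF that] that u(2) insert.hyps(2) by (auto split: if_splits)
        then have "\<forall>i\<in>I. u i = 0" by blast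
        with \<sigma>(2)[OF u(1)] u show ?thesis by simp
      qed
    qed (use insert.hyps in auto)
    then obtain \<phi> where \<phi>: "\<forall>x\<in>K'. (\<Sum>i\<in>I. \<phi> i * x i) \<le> x j" by blast
    have "(\<Sum>i\<in>insert j I. (\<phi>(j := - \<sigma>)) i * x i) \<le> 0" if "x \<in> K" for x
    proof -
      have "(\<Sum>i\<in>I. \<phi> i * (x(j := \<sigma> * x j)) i) \<le> \<sigma> * x j"
        using \<phi> that unfolding K'_def by auto
      moreover have "(\<Sum>i\<in>I. \<phi> i * (x(j := \<sigma> * x j)) i) = (\<Sum>i\<in>I. (\<phi>(j := - \<sigma>)) i * x i)"
        using insert.hyps by (intro sum.cong) auto
      ultimately show ?thesis using insert.hyps by simp
    qed
    moreover have "\<exists>i\<in>insert j I. (\<phi>(j := - \<sigma>)) i \<noteq> 0" using \<sigma>(1) by (intro bexI[of _ j]) auto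
    ultimately show ?thesis by blast
  qed
qed

lemma coordinatewise_subsequence:
  fixes z :: "nat \<Rightarrow> nat \<Rightarrow> real"
  assumes "\<And>k i. i < n \<Longrightarrow> \<bar>z k i\<bar> \<le> 1"
  shows "\<exists>r l. strict_mono r \<and> (\<forall>i<n. \<bar>l i\<bar> \<le> 1 \<and> (\<lambda>k. z (r k) i) \<longlonglongrightarrow> l i)"
  using assms
proof (induction n)
  case 0
  then show ?case by (auto intro!: exI[of _ id] strict_mono_id)
next
  case (Suc n)
  have "\<exists>r l. strict_mono r \<and> (\<forall>i<n. \<bar>l i\<bar> \<le> 1 \<and> (\<lambda>k. z (r k) i) \<longlonglongrightarrow> l i)"
    by (rule Suc.IH) (use Suc.prems in auto)
  then obtain r l where r: "strict_mono r" "\<forall>i<n. \<bar>l i\<bar> \<le> 1 \<and> (\<lambda>k. z (r k) i) \<longlonglongrightarrow> l i"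
    by blast
  have "seq_compact {-1..1::real}" by (simp add: compact_imp_seq_compact)
  moreover have "\<forall>k. z (r k) n \<in> {-1..1}" using Suc.prems[of n] by (auto simp: abs_le_iff minus_le_iff)
  ultimately obtain c s where s: "c \<in> {-1..1}" "strict_mono s" "((\<lambda>k. z (r k) n) \<circ> s) \<longlonglongrightarrow> c"
    by (rule seq_compactE)
  have "\<bar>(l(n := c)) i\<bar> \<le> 1 \<and> (\<lambda>k. z ((r \<circ> s) k) i) \<longlonglongrightarrow> (l(n := c)) i" if "i < Suc n" for i
  proof (cases "i = n")
    case True
    then show ?thesis using s by (auto simp: o_def)
  next
    case False
    then show ?thesis using that r(2) LIMSEQ_subseq_LIMSEQ[OF _ s(2), of "\<lambda>k. z (r k) i"]
      by (auto simp: o_def)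
  qed
  then show ?case using strict_mono_o[OF r(1) s(2)] by blast
qed

text \<open>
  The combinatorial lemma behind Brouwer's theorem, applied to the signs of the components,
  yields points of arbitrarily small distance between which each component changes sign.
  Continuity along coordinatewise convergent sequences makes the component vanish in the
  limit.
\<close>

lemma poincare_miranda:
  fixes H :: "(nat \<Rightarrow> real) \<Rightarrow> nat \<Rightarrow> real" and n :: nat
  defines "C \<equiv> {z. \<forall>i<n. \<bar>z i\<bar> \<le> 1}"
  assumes cont: "\<And>z z' i. (\<And>k. z k \<in> C) \<Longrightarrow> z' \<in> C \<Longrightarrow> (\<And>i. i < n \<Longrightarrow> (\<lambda>k. z k i) \<longlonglongrightarrow> z' i) \<Longrightarrow>
      i < n \<Longrightarrow> (\<lambda>k. H (z k) i) \<longlonglongrightarrow> H z' i"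
    and pos: "\<And>z i. z \<in> C \<Longrightarrow> i < n \<Longrightarrow> z i = 1 \<Longrightarrow> H z i > 0"
    and neg: "\<And>z i. z \<in> C \<Longrightarrow> i < n \<Longrightarrow> z i = -1 \<Longrightarrow> H z i < 0"
  shows "\<exists>z\<in>C. \<forall>i<n. H z i = 0"
proof -
  define grid where "grid p x i = -1 + 2 * real (x i) / real p" for p :: nat and x :: "nat \<Rightarrow> nat" and i :: nat
  have grid_C: "grid p x \<in> C" if "p > 0" "\<forall>i<n. x i \<le> p" for p x
  proof -
    have "0 \<le> real (x i) / real p" "real (x i) / real p \<le> 1" if "i < n" for i
      using that \<open>\<forall>i<n. x i \<le> p\<close> \<open>p > 0\<close> by auto
    then show ?thesis unfolding C_def grid_def by (fastforce simp: abs_le_iff)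
  qed
  \<comment> \<open>the Kuhn simplex at mesh \<open>2 / (k + 1)\<close> near \<open>z\<close> has vertices \<open>R\<close>, \<open>S\<close> between which \<open>H i\<close> changes sign\<close>
  define near where "near k z i R S \<longleftrightarrow> R \<in> C \<and> S \<in> C \<and> H R i \<le> 0 \<and> H S i \<ge> 0 \<and>
      (\<forall>j<n. \<bar>R j - z j\<bar> \<le> 2 / real (Suc k) \<and> \<bar>S j - z j\<bar> \<le> 2 / real (Suc k))"
    for k :: nat and z R S :: "nat \<Rightarrow> real" and i :: nat
  have ex: "\<exists>z\<in>C. \<forall>i. \<exists>R S. i < n \<longrightarrow> near k z i R S" for k
  proof -
    let ?p = "Suc k"
    define label :: "(nat \<Rightarrow> nat) \<Rightarrow> nat \<Rightarrow> nat" where "label x i = (if H (grid ?p x) i \<le> 0 then 0 else 1)" for x i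
    obtain c where c: "\<forall>i<n. c i < ?p"
      and rs: "\<forall>i<n. \<exists>r s. (\<forall>j<n. c j \<le> r j \<and> r j \<le> c j + 1) \<and>
          (\<forall>j<n. c j \<le> s j \<and> s j \<le> c j + 1) \<and> label r i \<noteq> label s i"
    proof (rule kuhn_lemma[of ?p n label])
      show "\<forall>x. (\<forall>i<n. x i \<le> ?p) \<longrightarrow> (\<forall>i<n. x i = 0 \<longrightarrow> label x i = 0)"
      proof (intro allI impI)
        fix x i assume "\<forall>i<n. x i \<le> ?p" "i < n" "x i = 0"
        then show "label x i = 0" using neg[OF grid_C[of ?p x], of i] by (simp add: label_def grid_def)
      qed
      show "\<forall>x. (\<forall>i<n. x i \<le> ?p) \<longrightarrow> (\<forall>i<n. x i = ?p \<longrightarrow> label x i = 1)"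
      proof (intro allI impI)
        fix x i assume x: "\<forall>i<n. x i \<le> ?p" "i < n" "x i = ?p"
        have "grid ?p x i = 1" unfolding grid_def x(3) by (simp del: of_nat_Suc)
        then show "label x i = 1" using pos[OF grid_C[of ?p x], of i] x by (simp add: label_def)
      qed
    qed (auto simp: label_def)
    have close: "\<bar>grid ?p r j - grid ?p c j\<bar> \<le> 2 / real ?p" if "c j \<le> r j" "r j \<le> c j + 1" for r j
    proof -
      have "grid ?p r j - grid ?p c j = 2 * (real (r j) - real (c j)) / real ?p"
        unfolding grid_def by (simp add: diff_divide_distrib right_diff_distrib)
      moreover have "\<bar>real (r j) - real (c j)\<bar> \<le> 1" using that by linarith
      ultimately show ?thesis by (simp add: abs_mult divide_right_mono)
    qed
    have "\<exists>R S. near k (grid ?p c) i R S" if i: "i < n" for i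
    proof -
      obtain r s where r: "\<forall>j<n. c j \<le> r j \<and> r j \<le> c j + 1"
        and s: "\<forall>j<n. c j \<le> s j \<and> s j \<le> c j + 1" and ne: "label r i \<noteq> label s i"
        using rs i by blast
      have "r j \<le> ?p" "s j \<le> ?p" if "j < n" for j
        using c[rule_format, OF that] r[rule_format, OF that] s[rule_format, OF that] by linarith+
      then have rC: "grid ?p r \<in> C" and sC: "grid ?p s \<in> C"
        by (auto intro!: grid_C)
      show ?thesis
      proof (cases "H (grid ?p r) i \<le> 0")
        case True
        then have "H (grid ?p s) i \<ge> 0" using ne by (auto simp: label_def split: if_splits)
        then show ?thesis using True rC sC close r s unfolding near_def by (intro exI[of _ "grid ?p r"] exI[of _ "grid ?p s"]) auto
      next
        case False
        then have "H (grid ?p s) i \<le> 0" using ne by (auto simp: label_def split: if_splits)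
        then show ?thesis using False rC sC close r s unfolding near_def by (intro exI[of _ "grid ?p s"] exI[of _ "grid ?p r"]) auto
      qed
    qed
    moreover have "grid ?p c \<in> C" using c by (intro grid_C) (simp_all add: less_imp_le)
    ultimately show ?thesis by blast
  qed
  then obtain z where z: "\<And>k. z k \<in> C" "\<And>k i. \<exists>R S. i < n \<longrightarrow> near k (z k) i R S"
    by metis
  have "\<exists>R. \<forall>k i. \<exists>S. i < n \<longrightarrow> near k (z k) i (R k i) S"
    by (rule choice, rule allI, rule choice, rule allI, rule z(2))
  then obtain R where R: "\<forall>k i. \<exists>S. i < n \<longrightarrow> near k (z k) i (R k i) S" by blast
  have "\<exists>S. \<forall>k i. i < n \<longrightarrow> near k (z k) i (R k i) (S k i)"
    by (rule choice, rule allI, rule choice, rule allI) (use R in blast)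
  then obtain S where "\<And>k i. i < n \<Longrightarrow> near k (z k) i (R k i) (S k i)" by blast
  then have RS: "R k i \<in> C" "S k i \<in> C" "H (R k i) i \<le> 0" "H (S k i) i \<ge> 0"
      "j < n \<Longrightarrow> \<bar>R k i j - z k j\<bar> \<le> 2 / real (Suc k)"
      "j < n \<Longrightarrow> \<bar>S k i j - z k j\<bar> \<le> 2 / real (Suc k)" if "i < n" for k i j
    using that unfolding near_def by blast+
  obtain r l where r: "strict_mono r" and l: "\<forall>i<n. \<bar>l i\<bar> \<le> 1 \<and> (\<lambda>k. z (r k) i) \<longlonglongrightarrow> l i"
    using coordinatewise_subsequence[of n z] z(1) unfolding C_def by blast
  have lC: "l \<in> C" using l by (auto simp: C_def)
  have "(\<lambda>k. 2 * inverse (real (Suc k))) \<longlonglongrightarrow> 2 * 0"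
    by (intro tendsto_mult_left LIMSEQ_inverse_real_of_nat)
  then have small: "(\<lambda>k. 2 / real (Suc (r k))) \<longlonglongrightarrow> 0"
    using LIMSEQ_subseq_LIMSEQ[OF _ r, of "\<lambda>k. 2 / real (Suc k)" 0] by (simp add: o_def divide_inverse)
  have conv: "(\<lambda>k. Q (r k) j) \<longlonglongrightarrow> l j" if "\<And>k. \<bar>Q k j - z k j\<bar> \<le> 2 / real (Suc k)" "j < n"
    for Q :: "nat \<Rightarrow> nat \<Rightarrow> real" and j
  proof -
    have "(\<lambda>k. Q (r k) j - z (r k) j) \<longlonglongrightarrow> 0"
      by (rule Lim_null_comparison[OF _ small]) (use that(1) in auto)
    from tendsto_add[OF this] l that(2) show ?thesis by fastforce
  qed
  have "H l i = 0" if "i < n" for i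
  proof (rule antisym)
    have "(\<lambda>k. H (R (r k) i) i) \<longlonglongrightarrow> H l i"
      by (intro cont lC RS conv[of "\<lambda>k. R k i"]) (use that in auto)
    then show "H l i \<le> 0" by (rule tendsto_upperbound) (use RS that in auto)
    have "(\<lambda>k. H (S (r k) i) i) \<longlonglongrightarrow> H l i"
      by (intro cont lC RS conv[of "\<lambda>k. S k i"]) (use that in auto)
    then show "0 \<le> H l i" by (rule tendsto_lowerbound) (use RS that in auto)
  qed
  then show ?thesis using lC by blast
qed

section \<open>The multiplier rule\<close>

text \<open>
  The sequential form in which Hadamard differentials are composed with endpoint variations.
\<close>

lemma has_hadamard_diff_sequentially:
  assumes F: "has_hadamard_diff F L x" and r: "\<And>k. r k > 0" "r \<longlonglongrightarrow> 0"
    and y: "(\<lambda>k. (y k - x) /\<^sub>R r k) \<longlonglongrightarrow> v"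
  shows "(\<lambda>k. (F (y k) - F x) /\<^sub>R r k) \<longlonglongrightarrow> blinfun_apply L v"
proof -
  have "filterlim r (at_right 0) sequentially"
    unfolding filterlim_at by (intro conjI always_eventually allI r) (use r(1) in \<open>auto simp: less_imp_neq[symmetric]\<close>)
  then have "filterlim (\<lambda>k. (r k, (y k - x) /\<^sub>R r k)) (at_right 0 \<times>\<^sub>F nhds v) sequentially"
    using y by (intro filterlim_Pair)
  moreover have "((\<lambda>(\<theta>, w). (F (x + \<theta> *\<^sub>R w) - F x) /\<^sub>R \<theta>) \<longlongrightarrow> blinfun_apply L v) (at_right 0 \<times>\<^sub>F nhds v)"
    using F by (simp add: has_hadamard_diff_def)
  ultimately have "((\<lambda>k. (\<lambda>(\<theta>, w). (F (x + \<theta> *\<^sub>R w) - F x) /\<^sub>R \<theta>) (r k, (y k - x) /\<^sub>R r k))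
      \<longlongrightarrow> blinfun_apply L v) sequentially"
    by (rule filterlim_compose[rotated])
  moreover have "x + r k *\<^sub>R ((y k - x) /\<^sub>R r k) = y k" for k
    using r(1)[of k] by simp
  ultimately show ?thesis by simp
qed

text \<open>
  The interface between trajectories and multipliers: \<open>e a\<close> is a reachable endpoint for
  lengths \<open>a\<close> in a box, \<open>e\<close> is continuous, and its one-sided directional derivative at \<open>0\<close> is
  \<open>\<Sum>n\<in>N. a n *\<^sub>R Y n\<close>, uniformly under perturbation of the direction.
\<close>

definition endpoint_map ::
    "'n set \<Rightarrow> ('n \<Rightarrow> 'b::real_normed_vector) \<Rightarrow> 'b set \<Rightarrow> 'b \<Rightarrow> real \<Rightarrow> (('n \<Rightarrow> real) \<Rightarrow> 'b) \<Rightarrow> bool" where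
  "endpoint_map N Y R e\<^sub>0 \<delta> e \<longleftrightarrow>
     (\<forall>a. (\<forall>n\<in>N. 0 \<le> a n \<and> a n \<le> \<delta>) \<longrightarrow> e a \<in> R) \<and>
     (\<forall>b a. (\<forall>k. \<forall>n\<in>N. 0 \<le> b k n \<and> b k n \<le> \<delta>) \<longrightarrow> (\<forall>n\<in>N. 0 \<le> a n \<and> a n \<le> \<delta>) \<longrightarrow>
        (\<forall>n\<in>N. (\<lambda>k. b k n) \<longlonglongrightarrow> a n) \<longrightarrow> (\<lambda>k. e (b k)) \<longlonglongrightarrow> e a) \<and>
     (\<forall>r b a. (\<forall>k::nat. r k > 0) \<longrightarrow> r \<longlonglongrightarrow> 0 \<longrightarrow> (\<forall>k. \<forall>n\<in>N. 0 \<le> b k n) \<longrightarrow>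
        (\<forall>n\<in>N. (\<lambda>k. b k n) \<longlonglongrightarrow> a n) \<longrightarrow>
        (\<lambda>k. (e (\<lambda>n. r k * b k n) - e\<^sub>0) /\<^sub>R r k) \<longlonglongrightarrow> (\<Sum>n\<in>N. a n *\<^sub>R Y n))"

text \<open>
  Coefficients are defined on the whole index type and vanish outside \<open>M\<close>, so that
  combinations with different supports can be added and compared on a common support.
\<close>

definition conic_combination ::
    "'n set \<Rightarrow> ('n \<Rightarrow> 'b::real_normed_vector) \<Rightarrow> 'n set \<Rightarrow> ('n \<Rightarrow> real) \<Rightarrow> 'b \<Rightarrow> bool" where
  "conic_combination N Y M \<alpha> w \<longleftrightarrow> finite M \<and> M \<subseteq> N \<and> (\<forall>n. 0 \<le> \<alpha> n) \<and> (\<forall>n. n \<notin> M \<longrightarrow> \<alpha> n = 0) \<and>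
     w = (\<Sum>n\<in>M. \<alpha> n *\<^sub>R Y n)"

lemma conic_combination_superset:
  assumes "conic_combination N Y M \<alpha> w" "finite M'" "M \<subseteq> M'"
  shows "(\<Sum>n\<in>M'. \<alpha> n *\<^sub>R Y n) = w"
  using assms unfolding conic_combination_def
  by (auto intro!: sum.mono_neutral_right)

lemma conic_combination_add:
  assumes "conic_combination N Y M \<alpha> w" "conic_combination N Y M' \<alpha>' w'"
  shows "conic_combination N Y (M \<union> M') (\<lambda>n. \<alpha> n + \<alpha>' n) (w + w')"
proof -
  have "w = (\<Sum>n\<in>M \<union> M'. \<alpha> n *\<^sub>R Y n)" "w' = (\<Sum>n\<in>M \<union> M'. \<alpha>' n *\<^sub>R Y n)"
    using assms
    by (intro conic_combination_superset[OF assms(1), symmetric] conic_combination_superset[OF assms(2), symmetric];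
      simp add: conic_combination_def)+
  then have "w + w' = (\<Sum>n\<in>M \<union> M'. (\<alpha> n + \<alpha>' n) *\<^sub>R Y n)"
    by (simp add: scaleR_add_left sum.distrib)
  then show ?thesis using assms by (auto simp: conic_combination_def)
qed

lemma conic_combination_scale:
  assumes "conic_combination N Y M \<alpha> w" "c \<ge> 0"
  shows "conic_combination N Y M (\<lambda>n. c * \<alpha> n) (c *\<^sub>R w)"
  using assms by (auto simp: conic_combination_def scaleR_sum_right)

text \<open>
  The directions \<open>wp j\<close> and \<open>wm j\<close> move the equality constraint number \<open>j\<close> up and down without
  loss for the inequalities, and \<open>w0\<close> improves the inequalities strictly. For \<open>z\<close> in the cube
  the direction \<open>w z\<close> has equality derivatives \<open>z\<close>, and it depends continuously on \<open>z\<close> with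
  nonnegative coefficients. For a small step \<open>r\<close> the scaled equality constraints are within
  \<open>1/2\<close> of the identity of the cube, so they vanish at some \<open>z\<close>.
\<close>

lemma multiplier_rule_regular_case:
  fixes \<phi> :: "'i \<Rightarrow> 'b::real_normed_vector \<Rightarrow> real" and \<psi> :: "nat \<Rightarrow> 'b \<Rightarrow> real"
  assumes I: "finite I"
    and family: "\<And>M. finite M \<Longrightarrow> M \<subseteq> N \<Longrightarrow> \<exists>\<delta>>0. \<exists>e. endpoint_map M Y R e\<^sub>0 \<delta> e"
    and d\<phi>: "\<And>i. i \<in> I \<Longrightarrow> has_hadamard_diff (\<phi> i) (D\<phi> i) e\<^sub>0"
    and d\<psi>: "\<And>i. i < q \<Longrightarrow> has_hadamard_diff (\<psi> i) (D\<psi> i) e\<^sub>0"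
    and V: "open V" "e\<^sub>0 \<in> V" "\<And>i. i < q \<Longrightarrow> continuous_on V (\<psi> i)"
    and onto: "\<And>s y. \<exists>M \<alpha> w. conic_combination N Y M \<alpha> w \<and>
        (\<forall>i\<in>I. s \<le> blinfun_apply (D\<phi> i) w) \<and> (\<forall>i<q. blinfun_apply (D\<psi> i) w = y i)"
  shows "\<exists>x\<in>R \<inter> V. (\<forall>i\<in>I. \<phi> i x > \<phi> i e\<^sub>0) \<and> (\<forall>i<q. \<psi> i x = \<psi> i e\<^sub>0)"
proof -
  obtain M0 \<alpha>0 w0 where w0: "conic_combination N Y M0 \<alpha>0 w0"
      "\<forall>i\<in>I. 1 \<le> blinfun_apply (D\<phi> i) w0" "\<forall>i<q. blinfun_apply (D\<psi> i) w0 = 0"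
    using onto[of 1 "\<lambda>_. 0"] by blast
  have "\<forall>j. \<exists>M \<alpha> w. conic_combination N Y M \<alpha> w \<and>
        (\<forall>i\<in>I. 0 \<le> blinfun_apply (D\<phi> i) w) \<and> (\<forall>i<q. blinfun_apply (D\<psi> i) w = (if i = j then 1 else 0))"
    by (rule allI) (rule onto)
  then obtain Mp \<alpha>p wp where wp: "\<And>j. conic_combination N Y (Mp j) (\<alpha>p j) (wp j)"
      "\<And>j i. i \<in> I \<Longrightarrow> 0 \<le> blinfun_apply (D\<phi> i) (wp j)"
      "\<And>j i. i < q \<Longrightarrow> blinfun_apply (D\<psi> i) (wp j) = (if i = j then 1 else 0)"
    by metis
  have "\<forall>j. \<exists>M \<alpha> w. conic_combination N Y M \<alpha> w \<and>
        (\<forall>i\<in>I. 0 \<le> blinfun_apply (D\<phi> i) w) \<and> (\<forall>i<q. blinfun_apply (D\<psi> i) w = (if i = j then -1 else 0))"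
    by (rule allI) (rule onto)
  then obtain Mm \<alpha>m wm where wm: "\<And>j. conic_combination N Y (Mm j) (\<alpha>m j) (wm j)"
      "\<And>j i. i \<in> I \<Longrightarrow> 0 \<le> blinfun_apply (D\<phi> i) (wm j)"
      "\<And>j i. i < q \<Longrightarrow> blinfun_apply (D\<psi> i) (wm j) = (if i = j then -1 else 0)"
    by metis
  define M where "M = M0 \<union> (\<Union>j<q. Mp j) \<union> (\<Union>j<q. Mm j)"
  have "finite (Mp j)" "finite (Mm j)" "Mp j \<subseteq> N" "Mm j \<subseteq> N" for j
    using wp(1)[of j] wm(1)[of j] by (auto simp: conic_combination_def)
  moreover have "finite M0" "M0 \<subseteq> N" using w0(1) by (auto simp: conic_combination_def)
  ultimately have M: "finite M" "M \<subseteq> N"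
    unfolding M_def by (simp_all add: UN_subset_iff)
  \<comment>
    \<open>positive and negative parts keep the lengths nonnegative and continuous in \<open>z\<close>\<close>
  define a where "a z n = \<alpha>0 n + (\<Sum>j<q. max (z j) 0 * \<alpha>p j n + max (- z j) 0 * \<alpha>m j n)"
    for z :: "nat \<Rightarrow> real" and n
  define w where "w z = (\<Sum>n\<in>M. a z n *\<^sub>R Y n)" for z
  have a_nonneg: "0 \<le> a z n" for z n
  proof -
    have "0 \<le> \<alpha>p j n" "0 \<le> \<alpha>m j n" for j
      using wp(1)[of j] wm(1)[of j] by (auto simp: conic_combination_def)
    moreover have "0 \<le> \<alpha>0 n" using w0(1) by (auto simp: conic_combination_def)
    ultimately show ?thesis unfolding a_def by (intro add_nonneg_nonneg sum_nonneg mult_nonneg_nonneg) auto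
  qed
  have w_eq: "w z = w0 + (\<Sum>j<q. max (z j) 0 *\<^sub>R wp j + max (- z j) 0 *\<^sub>R wm j)" for z
  proof -
    have "w z = (\<Sum>n\<in>M. \<alpha>0 n *\<^sub>R Y n) +
        (\<Sum>n\<in>M. \<Sum>j<q. max (z j) 0 *\<^sub>R (\<alpha>p j n *\<^sub>R Y n) + max (- z j) 0 *\<^sub>R (\<alpha>m j n *\<^sub>R Y n))"
      unfolding w_def a_def by (simp add: scaleR_add_left sum.distrib scaleR_sum_left)
    also have "\<dots> = (\<Sum>n\<in>M. \<alpha>0 n *\<^sub>R Y n) +
        (\<Sum>j<q. \<Sum>n\<in>M. max (z j) 0 *\<^sub>R (\<alpha>p j n *\<^sub>R Y n) + max (- z j) 0 *\<^sub>R (\<alpha>m j n *\<^sub>R Y n))"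
      by (subst sum.swap) (rule refl)
    also have "\<dots> = (\<Sum>n\<in>M. \<alpha>0 n *\<^sub>R Y n) +
        (\<Sum>j<q. max (z j) 0 *\<^sub>R (\<Sum>n\<in>M. \<alpha>p j n *\<^sub>R Y n) + max (- z j) 0 *\<^sub>R (\<Sum>n\<in>M. \<alpha>m j n *\<^sub>R Y n))"
      by (simp add: sum.distrib scaleR_sum_right del: scaleR_scaleR)
    also have "(\<Sum>n\<in>M. \<alpha>0 n *\<^sub>R Y n) = w0"
      by (rule conic_combination_superset[OF w0(1) M(1)]) (auto simp: M_def)
    also have "(\<Sum>j<q. max (z j) 0 *\<^sub>R (\<Sum>n\<in>M. \<alpha>p j n *\<^sub>R Y n) + max (- z j) 0 *\<^sub>R (\<Sum>n\<in>M. \<alpha>m j n *\<^sub>R Y n))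
        = (\<Sum>j<q. max (z j) 0 *\<^sub>R wp j + max (- z j) 0 *\<^sub>R wm j)"
    proof (rule sum.cong[OF refl])
      fix j assume "j \<in> {..<q}"
      then have "Mp j \<subseteq> M" "Mm j \<subseteq> M" by (auto simp: M_def)
      then show "max (z j) 0 *\<^sub>R (\<Sum>n\<in>M. \<alpha>p j n *\<^sub>R Y n) + max (- z j) 0 *\<^sub>R (\<Sum>n\<in>M. \<alpha>m j n *\<^sub>R Y n)
          = max (z j) 0 *\<^sub>R wp j + max (- z j) 0 *\<^sub>R wm j"
        using conic_combination_superset[OF wp(1) M(1)] conic_combination_superset[OF wm(1) M(1)] by simp
    qed
    finally show ?thesis .
  qed
  have w_\<phi>: "1 \<le> blinfun_apply (D\<phi> i) (w z)" if "i \<in> I" for i z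
  proof -
    have "0 \<le> (\<Sum>j<q. max (z j) 0 * blinfun_apply (D\<phi> i) (wp j) + max (- z j) 0 * blinfun_apply (D\<phi> i) (wm j))"
      using wp(2) wm(2) that by (intro sum_nonneg add_nonneg_nonneg mult_nonneg_nonneg) auto
    moreover have "1 \<le> blinfun_apply (D\<phi> i) w0" using w0(2) that by blast
    ultimately show ?thesis
      unfolding w_eq by (simp add: blinfun.add_right blinfun.sum_right blinfun.scaleR_right)
  qed
  have w_\<psi>: "blinfun_apply (D\<psi> i) (w z) = z i" if "i < q" for i z
  proof -
    have "(\<Sum>j<q. max (z j) 0 * blinfun_apply (D\<psi> i) (wp j) + max (- z j) 0 * blinfun_apply (D\<psi> i) (wm j))
        = (\<Sum>j<q. if j = i then z i else 0)"
      using wp(3) wm(3) that by (intro sum.cong) (auto simp: max_def)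
    also have "\<dots> = z i" using that by simp
    finally show ?thesis
      unfolding w_eq using w0(3) that by (simp add: blinfun.add_right blinfun.sum_right blinfun.scaleR_right)
  qed
  obtain \<delta> e where \<delta>: "\<delta> > 0" and e: "endpoint_map M Y R e\<^sub>0 \<delta> e"
    using family[OF M] by blast
  note e_R = e[unfolded endpoint_map_def, THEN conjunct1, rule_format]
    and e_cont = e[unfolded endpoint_map_def, THEN conjunct2, THEN conjunct1, rule_format]
    and e_deriv = e[unfolded endpoint_map_def, THEN conjunct2, THEN conjunct2, rule_format]
  define C where "C = {z :: nat \<Rightarrow> real. \<forall>i<q. \<bar>z i\<bar> \<le> 1}"
  have a_cont: "(\<lambda>k. a (z k) n) \<longlonglongrightarrow> a l n" if "\<And>j. j < q \<Longrightarrow> (\<lambda>k. z k j) \<longlonglongrightarrow> l j" for z :: "nat \<Rightarrow> nat \<Rightarrow> real" and l n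
    unfolding a_def by (intro tendsto_intros) (use that in auto)
  define x where "x r z = e (\<lambda>n. r * a z n)" for r z
  define good where "good r z \<longleftrightarrow> (\<forall>n\<in>M. r * a z n \<le> \<delta>) \<and> x r z \<in> V \<and> (\<forall>i\<in>I. \<phi> i (x r z) > \<phi> i e\<^sub>0) \<and>
      (\<forall>i<q. \<bar>(\<psi> i (x r z) - \<psi> i e\<^sub>0) / r - z i\<bar> < 1/2)" for r z
  have "\<exists>r>0. \<forall>z\<in>C. good r z"
  proof (rule ccontr)
    assume "\<not> ?thesis"
    then have "\<forall>k. \<exists>z. z \<in> C \<and> \<not> good (inverse (real (Suc k))) z"
      by (metis inverse_positive_iff_positive of_nat_0_less_iff zero_less_Suc)
    then obtain z where z: "\<And>k. z k \<in> C" "\<And>k. \<not> good (inverse (real (Suc k))) (z k)" by metis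
    obtain s l where s: "strict_mono s" and l: "\<forall>i<q. \<bar>l i\<bar> \<le> 1 \<and> (\<lambda>k. z (s k) i) \<longlonglongrightarrow> l i"
      using coordinatewise_subsequence[of q z] z(1) unfolding C_def by blast
    define r where "r k = inverse (real (Suc (s k)))" for k
    have r: "\<And>k. r k > 0" unfolding r_def by simp
    have r0: "r \<longlonglongrightarrow> 0"
      using LIMSEQ_subseq_LIMSEQ[OF LIMSEQ_inverse_real_of_nat s] unfolding r_def by (simp add: o_def)
    have a_lim: "(\<lambda>k. a (z (s k)) n) \<longlonglongrightarrow> a l n" for n
      using a_cont[of "\<lambda>k. z (s k)" l n] l by blast
    have x_lim: "(\<lambda>k. (x (r k) (z (s k)) - e\<^sub>0) /\<^sub>R r k) \<longlonglongrightarrow> w l"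
      unfolding x_def w_def by (rule e_deriv) (use r r0 a_nonneg a_lim in auto)
    have "(\<lambda>k. r k *\<^sub>R ((x (r k) (z (s k)) - e\<^sub>0) /\<^sub>R r k)) \<longlonglongrightarrow> 0 *\<^sub>R w l"
      by (intro tendsto_scaleR r0 x_lim)
    moreover have "r k *\<^sub>R ((x (r k) (z (s k)) - e\<^sub>0) /\<^sub>R r k) = x (r k) (z (s k)) - e\<^sub>0" for k
      using r[of k] by simp
    ultimately have "(\<lambda>k. x (r k) (z (s k)) - e\<^sub>0) \<longlonglongrightarrow> 0" by simp
    then have "(\<lambda>k. x (r k) (z (s k))) \<longlonglongrightarrow> e\<^sub>0" by (simp add: LIM_zero_iff)
    then have ev1: "\<forall>\<^sub>F k in sequentially. x (r k) (z (s k)) \<in> V"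
      using V topological_tendstoD by blast
    have "\<forall>\<^sub>F k in sequentially. \<forall>n\<in>M. r k * a (z (s k)) n < \<delta>"
    proof (intro eventually_ball_finite M ballI)
      fix n
      have "(\<lambda>k. r k * a (z (s k)) n) \<longlonglongrightarrow> 0 * a l n" by (intro tendsto_mult r0 a_lim)
      then show "\<forall>\<^sub>F k in sequentially. r k * a (z (s k)) n < \<delta>"
        using \<delta> by (auto dest: order_tendstoD(2))
    qed
    moreover have "\<forall>\<^sub>F k in sequentially. \<forall>i\<in>I. \<phi> i (x (r k) (z (s k))) > \<phi> i e\<^sub>0"
    proof (intro eventually_ball_finite I ballI)
      fix i assume i: "i \<in> I"
      have "\<forall>\<^sub>F k in sequentially. 0 < (\<phi> i (x (r k) (z (s k))) - \<phi> i e\<^sub>0) /\<^sub>R r k"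
        using has_hadamard_diff_sequentially[OF d\<phi>[OF i] r r0 x_lim] w_\<phi>[OF i, of l]
        by (auto dest!: order_tendstoD(1)[where a=0])
      then show "\<forall>\<^sub>F k in sequentially. \<phi> i (x (r k) (z (s k))) > \<phi> i e\<^sub>0"
      proof eventually_elim
        case (elim k)
        then show ?case using r[of k] by (auto simp: zero_less_mult_iff dest: less_asym)
      qed
    qed
    moreover have "\<forall>\<^sub>F k in sequentially. \<forall>i\<in>{..<q}. \<bar>(\<psi> i (x (r k) (z (s k))) - \<psi> i e\<^sub>0) / r k - z (s k) i\<bar> < 1/2"
    proof (intro eventually_ball_finite ballI)
      fix i assume "i \<in> {..<q}"
      then have i: "i < q" by simp
      have "(\<lambda>k. (\<psi> i (x (r k) (z (s k))) - \<psi> i e\<^sub>0) /\<^sub>R r k - z (s k) i) \<longlonglongrightarrow> l i - l i"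
        using has_hadamard_diff_sequentially[OF d\<psi>[OF i] r r0 x_lim] w_\<psi>[OF i, of l] l i
        by (intro tendsto_diff) auto
      then have "\<forall>\<^sub>F k in sequentially. \<bar>(\<psi> i (x (r k) (z (s k))) - \<psi> i e\<^sub>0) /\<^sub>R r k - z (s k) i\<bar> < 1/2"
        using order_tendstoD(2)[OF tendsto_rabs_zero, of _ sequentially "1/2"] by simp
      then show "\<forall>\<^sub>F k in sequentially. \<bar>(\<psi> i (x (r k) (z (s k))) - \<psi> i e\<^sub>0) / r k - z (s k) i\<bar> < 1/2"
        by (simp only: real_scaleR_def divide_inverse_commute)
    qed simp
    ultimately have "\<forall>\<^sub>F k in sequentially. good (r k) (z (s k))"
      using ev1 by eventually_elim (auto simp: good_def intro: less_imp_le)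
    then have "\<exists>k. good (r k) (z (s k))" by (rule eventually_happens'[rotated]) simp
    then show False using z(2) unfolding r_def by blast
  qed
  then obtain r where r: "r > 0" and good: "\<And>z. z \<in> C \<Longrightarrow> good r z" by blast
  define H where "H z i = (\<psi> i (x r z) - \<psi> i e\<^sub>0) / r" for z i
  have "\<exists>z\<in>C. \<forall>i<q. H z i = 0"
    unfolding C_def
  proof (rule poincare_miranda)
    fix z :: "nat \<Rightarrow> real" and i assume "z \<in> {z. \<forall>i<q. \<bar>z i\<bar> \<le> 1}" and i: "i < q"
    then have "\<bar>H z i - z i\<bar> < 1/2" using good[of z] unfolding C_def good_def H_def by blast
    then show "z i = 1 \<Longrightarrow> H z i > 0" "z i = -1 \<Longrightarrow> H z i < 0" by linarith+
  next
    fix z :: "nat \<Rightarrow> nat \<Rightarrow> real" and z' i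
    assume "\<And>k. z k \<in> {z. \<forall>i<q. \<bar>z i\<bar> \<le> 1}" "z' \<in> {z. \<forall>i<q. \<bar>z i\<bar> \<le> 1}"
      and lim: "\<And>i. i < q \<Longrightarrow> (\<lambda>k. z k i) \<longlonglongrightarrow> z' i" and i: "i < q"
    then have g: "\<And>k. good r (z k)" "good r z'" using good unfolding C_def by auto
    have "(\<lambda>k. x r (z k)) \<longlonglongrightarrow> x r z'"
      unfolding x_def
    proof (rule e_cont)
      show "(\<lambda>k. r * a (z k) n) \<longlonglongrightarrow> r * a z' n" for n
        by (intro tendsto_mult_left a_cont lim)
    qed (use g a_nonneg r in \<open>auto simp: good_def\<close>)
    then have "(\<lambda>k. \<psi> i (x r (z k))) \<longlonglongrightarrow> \<psi> i (x r z')"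
      by (rule continuous_on_tendsto_compose[OF V(3)[OF i]]) (use g in \<open>auto simp: good_def\<close>)
    then show "(\<lambda>k. H (z k) i) \<longlonglongrightarrow> H z' i"
      unfolding H_def by (intro tendsto_intros) (use r in auto)
  qed
  then obtain z where z: "z \<in> C" "\<forall>i<q. H z i = 0" by blast
  have g: "good r z" using good z by blast
  have "x r z \<in> R" unfolding x_def
    by (rule e_R) (use g a_nonneg r in \<open>auto simp: good_def\<close>)
  moreover have "\<forall>i<q. \<psi> i (x r z) = \<psi> i e\<^sub>0" using z r unfolding H_def by auto
  ultimately show ?thesis using g unfolding good_def by blast
qed

text \<open>
  The index set of the cone is the disjoint sum of the inequality and equality constraints.
  The first-order changes are lowered arbitrarily in the inequality coordinates; this forces
  the signs of the multipliers.
\<close>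

lemma multiplier_rule:
  fixes \<phi> :: "'i \<Rightarrow> 'b::real_normed_vector \<Rightarrow> real" and \<psi> :: "nat \<Rightarrow> 'b \<Rightarrow> real"
  assumes I: "finite I"
    and family: "\<And>M. finite M \<Longrightarrow> M \<subseteq> N \<Longrightarrow> \<exists>\<delta>>0. \<exists>e. endpoint_map M Y R e\<^sub>0 \<delta> e"
    and d\<phi>: "\<And>i. i \<in> I \<Longrightarrow> has_hadamard_diff (\<phi> i) (D\<phi> i) e\<^sub>0"
    and d\<psi>: "\<And>i. i < q \<Longrightarrow> has_hadamard_diff (\<psi> i) (D\<psi> i) e\<^sub>0"
    and V: "open V" "e\<^sub>0 \<in> V" "\<And>i. i < q \<Longrightarrow> continuous_on V (\<psi> i)"
    and opt: "\<And>x. x \<in> R \<inter> V \<Longrightarrow> \<forall>i\<in>I. \<phi> i x > \<phi> i e\<^sub>0 \<Longrightarrow> \<forall>i<q. \<psi> i x = \<psi> i e\<^sub>0 \<Longrightarrow> False"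
  shows "\<exists>l \<mu>. ((\<exists>i\<in>I. l i \<noteq> 0) \<or> (\<exists>i<q. \<mu> i \<noteq> 0)) \<and> (\<forall>i\<in>I. 0 \<le> l i) \<and>
    (\<forall>n\<in>N. (\<Sum>i\<in>I. l i * blinfun_apply (D\<phi> i) (Y n)) + (\<Sum>i<q. \<mu> i * blinfun_apply (D\<psi> i) (Y n)) \<le> 0)"
proof -
  \<comment> \<open>the coordinates in \<open>Inl ` I\<close> may be lowered, those in \<open>Inr\<close> are
    exact\<close>
  define K where "K = {c :: 'i + nat \<Rightarrow> real. \<exists>M \<alpha> w. conic_combination N Y M \<alpha> w \<and>
      (\<forall>i\<in>I. c (Inl i) \<le> blinfun_apply (D\<phi> i) w) \<and> (\<forall>i<q. c (Inr i) = blinfun_apply (D\<psi> i) w)}"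
  have K_I: "c \<in> K" if "conic_combination N Y M \<alpha> w" "\<And>i. i \<in> I \<Longrightarrow> c (Inl i) \<le> blinfun_apply (D\<phi> i) w"
      "\<And>i. i < q \<Longrightarrow> c (Inr i) = blinfun_apply (D\<psi> i) w" for c M \<alpha> w
    unfolding K_def using that by blast
  have cc0: "conic_combination N Y {} (\<lambda>_. 0) 0" by (simp add: conic_combination_def)
  have "\<exists>\<eta>. (\<exists>i\<in>I <+> {..<q}. \<eta> i \<noteq> 0) \<and> (\<forall>x\<in>K. (\<Sum>i\<in>I <+> {..<q}. \<eta> i * x i) \<le> 0)"
  proof (rule cone_support_functional)
    show "(\<lambda>i. x i + y i) \<in> K" if "x \<in> K" "y \<in> K" for x y
    proof -
      from that(1) obtain M \<alpha> w where x: "conic_combination N Y M \<alpha> w"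
        "\<forall>i\<in>I. x (Inl i) \<le> blinfun_apply (D\<phi> i) w" "\<forall>i<q. x (Inr i) = blinfun_apply (D\<psi> i) w"
        unfolding K_def by blast
      from that(2) obtain M' \<alpha>' w' where y: "conic_combination N Y M' \<alpha>' w'"
        "\<forall>i\<in>I. y (Inl i) \<le> blinfun_apply (D\<phi> i) w'" "\<forall>i<q. y (Inr i) = blinfun_apply (D\<psi> i) w'"
        unfolding K_def by blast
      show ?thesis
        by (rule K_I[OF conic_combination_add[OF x(1) y(1)]])
          (use x y in \<open>auto simp: blinfun.add_right intro: add_mono\<close>)
    qed
    show "(\<lambda>i. c * x i) \<in> K" if "c > 0" "x \<in> K" for c x
    proof -
      from that(2) obtain M \<alpha> w where x: "conic_combination N Y M \<alpha> w"
        "\<forall>i\<in>I. x (Inl i) \<le> blinfun_apply (D\<phi> i) w" "\<forall>i<q. x (Inr i) = blinfun_apply (D\<psi> i) w"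
        unfolding K_def by blast
      show ?thesis
        by (rule K_I[OF conic_combination_scale[OF x(1), of c]])
          (use x \<open>c > 0\<close> in \<open>auto simp: blinfun.scaleR_right\<close>)
    qed
    have "(\<lambda>_. 0) \<in> K" by (rule K_I[OF cc0]) auto
    then show "K \<noteq> {}" by blast
    show "\<not> (\<forall>y. \<exists>x\<in>K. \<forall>i\<in>I <+> {..<q}. x i = y i)"
    proof
      assume all: "\<forall>y. \<exists>x\<in>K. \<forall>i\<in>I <+> {..<q}. x i = y i"
      have "\<exists>x\<in>R \<inter> V. (\<forall>i\<in>I. \<phi> i x > \<phi> i e\<^sub>0) \<and> (\<forall>i<q. \<psi> i x = \<psi> i e\<^sub>0)"
      proof (rule multiplier_rule_regular_case[OF I family d\<phi> d\<psi> V])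
        fix s y
        obtain c where c: "c \<in> K" "\<forall>i\<in>I <+> {..<q}. c i = case_sum (\<lambda>_. s) y i"
          using all by blast
        then have c': "c (Inl i) = s" if "i \<in> I" for i using that by (auto dest!: bspec[of _ _ "Inl i"])
        have c'': "c (Inr i) = y i" if "i < q" for i using c(2) that by (auto dest!: bspec[of _ _ "Inr i"])
        obtain M \<alpha> w where "conic_combination N Y M \<alpha> w"
          "\<forall>i\<in>I. c (Inl i) \<le> blinfun_apply (D\<phi> i) w" "\<forall>i<q. c (Inr i) = blinfun_apply (D\<psi> i) w"
          using c(1) unfolding K_def by blast
        then show "\<exists>M \<alpha> w. conic_combination N Y M \<alpha> w \<and>
          (\<forall>i\<in>I. s \<le> blinfun_apply (D\<phi> i) w) \<and> (\<forall>i<q. blinfun_apply (D\<psi> i) w = y i)"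
          using c' c'' by (intro exI[of _ M] exI[of _ \<alpha>] exI[of _ w]) auto
      qed
      then show False using opt by blast
    qed
  qed (use I in simp)
  then obtain \<eta> where \<eta>: "\<exists>i\<in>I <+> {..<q}. \<eta> i \<noteq> 0" "\<And>x. x \<in> K \<Longrightarrow> (\<Sum>i\<in>I <+> {..<q}. \<eta> i * x i) \<le> 0"
    by blast
  have sum: "(\<Sum>i\<in>I. \<eta> (Inl i) * x (Inl i)) + (\<Sum>i<q. \<eta> (Inr i) * x (Inr i)) \<le> 0" if "x \<in> K" for x
    using \<eta>(2)[OF that] I by (simp add: sum.Plus)
  have "0 \<le> \<eta> (Inl i)" if i: "i \<in> I" for i
  proof -
    have "(\<lambda>j. if j = Inl i then -1 else 0) \<in> K" by (rule K_I[OF cc0]) auto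
    from sum[OF this] have "(\<Sum>j\<in>I. if j = i then - \<eta> (Inl i) else 0) \<le> 0"
      by (simp add: if_distrib[of "\<lambda>t. _ * t"] cong: if_cong)
    then show ?thesis using I i by simp
  qed
  moreover have "(\<Sum>i\<in>I. \<eta> (Inl i) * blinfun_apply (D\<phi> i) (Y n)) + (\<Sum>i<q. \<eta> (Inr i) * blinfun_apply (D\<psi> i) (Y n)) \<le> 0"
    if "n \<in> N" for n
  proof -
    have cc: "conic_combination N Y {n} (\<lambda>m. if m = n then 1 else 0) (Y n)"
      using that by (simp add: conic_combination_def)
    have "case_sum (\<lambda>i. blinfun_apply (D\<phi> i) (Y n)) (\<lambda>i. blinfun_apply (D\<psi> i) (Y n)) \<in> K"
      by (rule K_I[OF cc]) auto
    from sum[OF this] show ?thesis by simp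
  qed
  moreover have "(\<exists>i\<in>I. \<eta> (Inl i) \<noteq> 0) \<or> (\<exists>i<q. \<eta> (Inr i) \<noteq> 0)" using \<eta>(1) by auto
  ultimately show ?thesis
    by (intro exI[of _ "\<lambda>i. \<eta> (Inl i)"] exI[of _ "\<lambda>i. \<eta> (Inr i)"]) blast
qed

section \<open>The endpoint as a function of the needle lengths\<close>

text \<open>
  All constants of one family of needles: a compact set \<open>M\<close> of control values, radius and
  Lipschitz constant of the tube, a velocity bound \<open>C\<close> and a distance \<open>\<eta>\<close> that keeps the
  needles away from \<open>T\<close>, where the control has to be left-continuous.
\<close>

locale needle_family = controlled_trajectory T \<Omega> U F A x\<^sub>0 u\<^sub>0 S\<^sub>0
  for T :: real and \<Omega> :: "'b::banach set" and U :: "'u::t2_space set"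
    and F :: "real \<Rightarrow> 'b \<Rightarrow> 'u \<Rightarrow> 'b" and A :: "real \<Rightarrow> 'u \<Rightarrow> 'b \<Rightarrow>\<^sub>L 'b"
    and x\<^sub>0 :: "real \<Rightarrow> 'b" and u\<^sub>0 :: "real \<Rightarrow> 'u" and S\<^sub>0 :: "real set" +
  fixes M :: "'u set" and \<rho> L C \<eta> :: real and P :: "real \<Rightarrow> 'b \<Rightarrow>\<^sub>L 'b"
    and \<tau> :: "nat \<Rightarrow> real" and \<zeta> :: "nat \<Rightarrow> 'u" and N :: nat
  assumes M: "compact M" "M \<subseteq> U" "u\<^sub>0 ` {0..T} \<subseteq> M" "\<And>i. i < N \<Longrightarrow> \<zeta> i \<in> M"
    and \<rho>: "\<rho> > 0" and L: "L > 0" and tube: "\<And>t. t \<in> {0..T} \<Longrightarrow> cball (x\<^sub>0 t) \<rho> \<subseteq> \<Omega>"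
    and lip_M: "\<And>t z \<xi> \<eta>. t \<in> {0..T} \<Longrightarrow> z \<in> M \<Longrightarrow> \<xi> \<in> cball (x\<^sub>0 t) \<rho> \<Longrightarrow> \<eta> \<in> cball (x\<^sub>0 t) \<rho> \<Longrightarrow>
        norm (F t \<xi> z - F t \<eta> z) \<le> L * norm (\<xi> - \<eta>)"
    and C: "C > 0" "\<And>s z. s \<in> {0..T} \<Longrightarrow> z \<in> M \<Longrightarrow> norm (F s (x\<^sub>0 s) z) \<le> C"
    and P: "continuous_on {0..T} P" "P T = id_blinfun"
      "\<And>t. t \<in> {0..T} \<Longrightarrow> P t = P 0 + integral {0..t} (\<lambda>s. - (P s o\<^sub>L A s (u\<^sub>0 s)))"
    and \<tau>: "\<And>i. i < N \<Longrightarrow> 0 \<le> \<tau> i" "\<And>i j. i \<le> j \<Longrightarrow> j < N \<Longrightarrow> \<tau> i \<le> \<tau> j"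
    and \<eta>: "\<eta> > 0" "\<And>i. i < N \<Longrightarrow> \<tau> i + \<eta> < T"
begin

text \<open>
  The constant that \<open>perturbed_trajectory_exists\<close> produces when the velocity changes by at
  most \<open>2 * C\<close> on the needles; it bounds the deviation from the reference trajectory per unit
  of total length.
\<close>

definition deviation_rate :: real where "deviation_rate = 2 * (2 * C) * exp (2 * (2 * L) * T)"

lemma deviation_rate: "deviation_rate > 0" unfolding deviation_rate_def using C by simp

definition short_needles :: "(nat \<Rightarrow> real) \<Rightarrow> bool" where
  "short_needles a \<longleftrightarrow> (\<forall>i<N. 0 \<le> a i) \<and> sum a {..<N} \<le> min \<eta> (\<rho> / deviation_rate)"

abbreviation needled :: "(nat \<Rightarrow> real) \<Rightarrow> real \<Rightarrow> 'u" where
  "needled a \<equiv> needle_control \<tau> \<zeta> u\<^sub>0 a N"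

lemma partial_sum_bounds:
  assumes "\<And>i. i < N \<Longrightarrow> 0 \<le> (a i :: real)" "n \<le> N"
  shows "0 \<le> sum a {..<n}" "sum a {..<n} \<le> sum a {..<N}"
  using assms by (auto intro!: sum_nonneg sum_mono2)

lemma short_needlesD:
  assumes "short_needles a"
  shows "i < N \<Longrightarrow> 0 \<le> a i" "i < N \<Longrightarrow> \<tau> i + sum a {..<Suc i} < T" "deviation_rate * sum a {..<N} \<le> \<rho>" "0 \<le> sum a {..<N}"
proof -
  have nn: "0 \<le> a i" if "i < N" for i using assms that by (simp add: short_needles_def)
  then show "i < N \<Longrightarrow> 0 \<le> a i" .
  show "0 \<le> sum a {..<N}" using partial_sum_bounds[of a N] nn by blast
  show "deviation_rate * sum a {..<N} \<le> \<rho>" using assms deviation_rate by (simp add: short_needles_def field_simps)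
  show "\<tau> i + sum a {..<Suc i} < T" if i: "i < N"
    using partial_sum_bounds(2)[of a "Suc i"] nn i assms \<eta>(2)[OF i] unfolding short_needles_def by fastforce
qed

lemma needled_normal_pc: "short_needles a \<Longrightarrow> \<exists>S. normal_pc T U S (needled a)"
  using short_needlesD(1,2)[of a] M \<tau>(1) by (intro needle_control_normal_pc[OF u0]) auto

lemma needled_in_M: "s \<in> {0..T} \<Longrightarrow> needled a s \<in> M"
  using needle_control_range[of \<tau> \<zeta> u\<^sub>0 a N s] M(3,4) by auto

lemma needled_diff:
  fixes Q :: "'u \<Rightarrow> 'c::real_vector"
  assumes "short_needles a"
  shows "Q (needled a s) - Q (u\<^sub>0 s) = (\<Sum>i<N. in_needle \<tau> a i s *\<^sub>R (Q (\<zeta> i) - Q (u\<^sub>0 s)))"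
  by (rule needle_control_diff) (use short_needlesD(1)[OF assms] \<tau>(2) in auto)

lemma needle_integral:
  fixes w :: "'c::banach"
  assumes "short_needles a" "i < N"
  shows "((\<lambda>s. in_needle \<tau> a i s *\<^sub>R w) has_integral a i *\<^sub>R w) {0..T}"
  using short_needlesD(1,2)[OF assms(1)] assms(2) \<tau>(1) by (intro in_needle_integral) (auto intro: less_imp_le)

lemma needle_trajectory_exists:
  assumes a: "short_needles a"
  shows "\<exists>x. trajectory x (needled a) \<and> (\<forall>t\<in>{0..T}. norm (x t - x\<^sub>0 t) \<le> deviation_rate * sum a {..<N})"
proof -
  obtain S where S: "normal_pc T U S (needled a)" using needled_normal_pc[OF a] by blast
  let ?d = "\<lambda>s. norm (F s (x\<^sub>0 s) (needled a s) - F s (x\<^sub>0 s) (u\<^sub>0 s))"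
  have "((\<lambda>s. \<Sum>i<N. in_needle \<tau> a i s *\<^sub>R (2 * C)) has_integral (\<Sum>i<N. a i *\<^sub>R (2 * C))) {0..T}"
    by (intro has_integral_sum needle_integral a) auto
  moreover have "?d integrable_on {0..T}"
    by (intro regulated_integrable_full regulated_norm regulated_diff velocity_regulated[OF u0]
          velocity_regulated[OF S] x0_cont x0_\<Omega>)
  moreover have "?d s \<le> (\<Sum>i<N. in_needle \<tau> a i s *\<^sub>R (2 * C))" if s: "s \<in> {0..T}" for s
  proof -
    have "?d s = norm (\<Sum>i<N. in_needle \<tau> a i s *\<^sub>R (F s (x\<^sub>0 s) (\<zeta> i) - F s (x\<^sub>0 s) (u\<^sub>0 s)))"
      by (subst needled_diff[OF a]) (rule refl)
    also have "\<dots> \<le> (\<Sum>i<N. norm (in_needle \<tau> a i s *\<^sub>R (F s (x\<^sub>0 s) (\<zeta> i) - F s (x\<^sub>0 s) (u\<^sub>0 s))))"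
      by (rule norm_sum)
    also have "\<dots> \<le> (\<Sum>i<N. in_needle \<tau> a i s *\<^sub>R (2 * C))"
    proof (rule sum_mono)
      fix i assume "i \<in> {..<N}"
      moreover have "u\<^sub>0 s \<in> M" using M(3) s by blast
      ultimately have "norm (F s (x\<^sub>0 s) (\<zeta> i)) \<le> C" "norm (F s (x\<^sub>0 s) (u\<^sub>0 s)) \<le> C"
        using C(2)[OF s] M(4) by auto
      then have "norm (F s (x\<^sub>0 s) (\<zeta> i) - F s (x\<^sub>0 s) (u\<^sub>0 s)) \<le> 2 * C"
        using norm_triangle_ineq4[of "F s (x\<^sub>0 s) (\<zeta> i)" "F s (x\<^sub>0 s) (u\<^sub>0 s)"] by linarith
      then show "norm (in_needle \<tau> a i s *\<^sub>R (F s (x\<^sub>0 s) (\<zeta> i) - F s (x\<^sub>0 s) (u\<^sub>0 s))) \<le> in_needle \<tau> a i s *\<^sub>R (2 * C)"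
        by (simp add: in_needle_def)
    qed
    finally show ?thesis .
  qed
  ultimately have "integral {0..T} ?d \<le> (\<Sum>i<N. a i *\<^sub>R (2 * C))"
    using has_integral_le[OF integrable_integral] by blast
  also have "\<dots> = sum a {..<N} * (2 * C)" by (simp add: sum_distrib_right)
  finally have "2 * integral {0..T} ?d * exp (2 * (2 * L) * T) \<le> 2 * (sum a {..<N} * (2 * C)) * exp (2 * (2 * L) * T)"
    by (intro mult_right_mono mult_left_mono) auto
  also have "\<dots> = deviation_rate * sum a {..<N}" by (simp add: deviation_rate_def)
  finally have le: "2 * integral {0..T} ?d * exp (2 * (2 * L) * T) \<le> deviation_rate * sum a {..<N}" .
  have vM: "needled a ` {0..T} \<subseteq> M" using needled_in_M by blast
  have "\<exists>x. trajectory x (needled a) \<and> (\<forall>t\<in>{0..T}. norm (x t - x\<^sub>0 t) \<le> 2 * integral {0..T} ?d * exp (2 * (2 * L) * T))"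
    by (rule perturbed_trajectory_exists[OF M(1-3) \<rho> L tube lip_M S vM refl]) (use le short_needlesD(3)[OF a] in auto)
  then show ?thesis using le by (meson order_trans)
qed

definition perturbed :: "(nat \<Rightarrow> real) \<Rightarrow> real \<Rightarrow> 'b" where
  "perturbed a = (SOME x. trajectory x (needled a) \<and> (\<forall>t\<in>{0..T}. norm (x t - x\<^sub>0 t) \<le> deviation_rate * sum a {..<N}))"

lemma perturbed:
  assumes "short_needles a"
  shows "trajectory (perturbed a) (needled a)" "t \<in> {0..T} \<Longrightarrow> norm (perturbed a t - x\<^sub>0 t) \<le> deviation_rate * sum a {..<N}"
    "t \<in> {0..T} \<Longrightarrow> perturbed a t \<in> cball (x\<^sub>0 t) \<rho>" "continuous_on {0..T} (perturbed a)" "perturbed a ` {0..T} \<subseteq> \<Omega>"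
    "t \<in> {0..T} \<Longrightarrow> perturbed a t = x\<^sub>0 0 + integral {0..t} (\<lambda>s. F s (perturbed a s) (needled a s))"
proof -
  note * = someI_ex[OF needle_trajectory_exists[OF assms], folded perturbed_def]
  then show "trajectory (perturbed a) (needled a)" by blast
  then show "continuous_on {0..T} (perturbed a)" "perturbed a ` {0..T} \<subseteq> \<Omega>"
    "t \<in> {0..T} \<Longrightarrow> perturbed a t = x\<^sub>0 0 + integral {0..t} (\<lambda>s. F s (perturbed a s) (needled a s))"
    unfolding trajectory_def by blast+
  show le: "norm (perturbed a t - x\<^sub>0 t) \<le> deviation_rate * sum a {..<N}" if "t \<in> {0..T}" for t using * that by blast
  show "perturbed a t \<in> cball (x\<^sub>0 t) \<rho>" if "t \<in> {0..T}"
    using order_trans[OF le[OF that] short_needlesD(3)[OF assms]] by (simp add: dist_norm norm_minus_commute)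
qed

lemma perturbed_stability:
  assumes a: "short_needles a" and b: "short_needles b"
  shows "norm (perturbed b T - perturbed a T) \<le> 2 * integral {0..T} (\<lambda>s. norm (F s (perturbed a s) (needled b s) - F s (perturbed a s) (needled a s))) * exp (2 * L * T)"
proof -
  obtain Sa where Sa: "normal_pc T U Sa (needled a)" using needled_normal_pc[OF a] by blast
  obtain Sb where Sb: "normal_pc T U Sb (needled b)" using needled_normal_pc[OF b] by blast
  show ?thesis
  proof (rule integral_equation_stability[OF L perturbed(4)[OF b] perturbed(6)[OF b] perturbed(4)[OF a] perturbed(6)[OF a]])
    show "(\<lambda>s. F s (perturbed b s) (needled b s)) integrable_on {0..T}"
      by (intro regulated_integrable_full velocity_regulated[OF Sb] perturbed[OF b])
    show "(\<lambda>s. F s (perturbed a s) (needled a s)) integrable_on {0..T}"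
      by (intro regulated_integrable_full velocity_regulated[OF Sa] perturbed[OF a])
    show "(\<lambda>s. norm (F s (perturbed a s) (needled b s) - F s (perturbed a s) (needled a s))) integrable_on {0..T}"
      by (intro regulated_integrable_full regulated_norm regulated_diff velocity_regulated[OF Sa]
          velocity_regulated[OF Sb] perturbed[OF a])
    fix s assume s: "s \<in> {0..T}"
    have "norm (F s (perturbed b s) (needled b s) - F s (perturbed a s) (needled b s)) \<le> L * norm (perturbed b s - perturbed a s)"
      by (rule lip_M[OF s needled_in_M[OF s] perturbed(3)[OF b s] perturbed(3)[OF a s]])
    moreover have "norm (F s (perturbed b s) (needled b s) - F s (perturbed a s) (needled a s))
        \<le> norm (F s (perturbed b s) (needled b s) - F s (perturbed a s) (needled b s)) + norm (F s (perturbed a s) (needled b s) - F s (perturbed a s) (needled a s))"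
      using norm_triangle_ineq[of "F s (perturbed b s) (needled b s) - F s (perturbed a s) (needled b s)" "F s (perturbed a s) (needled b s) - F s (perturbed a s) (needled a s)"] by simp
    ultimately show "norm (F s (perturbed b s) (needled b s) - F s (perturbed a s) (needled a s))
        \<le> L * norm (perturbed b s - perturbed a s) + norm (F s (perturbed a s) (needled b s) - F s (perturbed a s) (needled a s))" by linarith
  qed (use T in auto)
qed

text \<open>
  The velocities of two families along the same trajectory differ only where the controls
  differ, a set that finally avoids every instant up to finitely many; dominated convergence
  and stability finish the argument.
\<close>

lemma perturbed_endpoint_continuous:
  assumes a: "short_needles a" and b: "\<And>k. short_needles (b k)" and lim: "\<And>i. i < N \<Longrightarrow> (\<lambda>k. b k i) \<longlonglongrightarrow> a i"
  shows "(\<lambda>k. perturbed (b k) T) \<longlonglongrightarrow> perturbed a T"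
proof -
  define E where "E = (\<lambda>i. \<tau> i + sum a {..<i}) ` {..<N} \<union> (\<lambda>i. \<tau> i + sum a {..<Suc i}) ` {..<N}"
  have E: "finite E" by (simp add: E_def)
  define d where "d k s = norm (F s (perturbed a s) (needled (b k) s) - F s (perturbed a s) (needled a s))" for k s
  obtain Sa where Sa: "normal_pc T U Sa (needled a)" using needled_normal_pc[OF a] by blast
  have d_int: "d k integrable_on {0..T}" for k
  proof -
    obtain Sb where Sb: "normal_pc T U Sb (needled (b k))" using needled_normal_pc[OF b] by blast
    show ?thesis unfolding d_def
      by (intro regulated_integrable_full regulated_norm regulated_diff velocity_regulated[OF Sa]
          velocity_regulated[OF Sb] perturbed[OF a])
  qed
  define d' where "d' k s = (if s \<in> E then 0 else d k s)" for k s
  have d'_int: "d' k integrable_on {0..T}" for k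
    by (rule integrable_spike_finite[OF E _ d_int]) (simp add: d'_def)
  have F_le: "norm (F s (perturbed a s) z) \<le> C + L * \<rho>" if s: "s \<in> {0..T}" and z: "z \<in> M" for s z
  proof -
    have "norm (F s (perturbed a s) z - F s (x\<^sub>0 s) z) \<le> L * norm (perturbed a s - x\<^sub>0 s)"
      using \<rho> by (intro lip_M s z perturbed(3)[OF a s]) auto
    also have "\<dots> \<le> L * \<rho>" using L perturbed(3)[OF a s] by (intro mult_left_mono) (auto simp: dist_norm norm_minus_commute)
    finally show ?thesis using C(2)[OF s z] norm_triangle_sub[of "F s (perturbed a s) z" "F s (x\<^sub>0 s) z"] by linarith
  qed
  have "(\<lambda>k. integral {0..T} (d' k)) \<longlonglongrightarrow> integral {0..T} (\<lambda>_. 0)"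
  proof (rule dominated_convergence(2)[OF d'_int, where h = "\<lambda>_. 2 * (C + L * \<rho>)"])
    fix k s assume s: "s \<in> {0..T}"
    have "d k s \<le> norm (F s (perturbed a s) (needled (b k) s)) + norm (F s (perturbed a s) (needled a s))"
      unfolding d_def by (rule norm_triangle_ineq4)
    also have "\<dots> \<le> (C + L * \<rho>) + (C + L * \<rho>)" by (intro add_mono F_le s needled_in_M)
    finally have "d k s \<le> 2 * (C + L * \<rho>)" by simp
    moreover have "0 \<le> d k s" by (simp add: d_def)
    ultimately show "norm (d' k s) \<le> 2 * (C + L * \<rho>)" by (auto simp: d'_def)
  next
    fix s assume "s \<in> {0..T}"
    show "(\<lambda>k. d' k s) \<longlonglongrightarrow> 0"
    proof (cases "s \<in> E")
      case False
      have "\<forall>\<^sub>F k in sequentially. needled (b k) s = needled a s"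
        by (rule needle_control_eventually_const[OF lim]) (use False in \<open>auto simp: E_def\<close>)
      then have "\<forall>\<^sub>F k in sequentially. d' k s = 0" by eventually_elim (simp add: d'_def d_def)
      then show ?thesis by (rule tendsto_eventually)
    qed (simp add: d'_def)
  qed (rule integrable_const_ivl)
  moreover have "integral {0..T} (d' k) = integral {0..T} (d k)" for k
    by (rule integral_spike[OF negligible_finite[OF E]]) (simp add: d'_def)
  ultimately have "(\<lambda>k. integral {0..T} (d k)) \<longlonglongrightarrow> 0" by simp
  then have "(\<lambda>k. 2 * integral {0..T} (d k) * exp (2 * L * T)) \<longlonglongrightarrow> 0"
    by (intro tendsto_mult_left_zero tendsto_mult_right_zero)
  then have "(\<lambda>k. perturbed (b k) T - perturbed a T) \<longlonglongrightarrow> 0"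
    by (rule Lim_null_comparison[rotated])
      (intro always_eventually allI, unfold d_def, rule perturbed_stability[OF a b])
  then show ?thesis by (simp add: LIM_zero_iff)
qed

text \<open>
  Off the needles the only error is the remainder of the linearization at the control
  \<open>u\<^sub>0\<close>. On a needle the deviation \<open>\<kappa>\<close> of the state enters through the Lipschitz
  constant and \<open>\<epsilon>\<close> measures the variation of the velocity jump along the needle.
\<close>

lemma perturbed_linearization_pointwise:
  assumes a: "short_needles a" and s: "s \<in> {0..T}" and p: "norm (P s) \<le> p"
    and z: "norm (perturbed a s - x\<^sub>0 s) \<le> \<kappa>"
    and \<epsilon>: "\<And>i. i < N \<Longrightarrow> in_needle \<tau> a i s \<noteq> 0 \<Longrightarrow>
      norm (blinfun_apply (P s) (F s (x\<^sub>0 s) (\<zeta> i) - F s (x\<^sub>0 s) (u\<^sub>0 s)) - Y i) \<le> \<epsilon>"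
  shows "norm (blinfun_apply (P s) (F s (perturbed a s) (needled a s) - F s (x\<^sub>0 s) (u\<^sub>0 s) - blinfun_apply (A s (u\<^sub>0 s)) (perturbed a s - x\<^sub>0 s))
      - (\<Sum>i<N. in_needle \<tau> a i s *\<^sub>R Y i))
    \<le> p * norm (F s (perturbed a s) (u\<^sub>0 s) - F s (x\<^sub>0 s) (u\<^sub>0 s) - blinfun_apply (A s (u\<^sub>0 s)) (perturbed a s - x\<^sub>0 s))
      + (\<Sum>i<N. in_needle \<tau> a i s *\<^sub>R (p * (2 * L * \<kappa>) + \<epsilon>))"
proof -
  define R where "R = F s (perturbed a s) (u\<^sub>0 s) - F s (x\<^sub>0 s) (u\<^sub>0 s) - blinfun_apply (A s (u\<^sub>0 s)) (perturbed a s - x\<^sub>0 s)"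
  define \<Delta> where "\<Delta> i = F s (perturbed a s) (\<zeta> i) - F s (perturbed a s) (u\<^sub>0 s)" for i
  have p0: "0 \<le> p" using p norm_ge_zero order_trans by blast
  have split: "F s (perturbed a s) (needled a s) - F s (x\<^sub>0 s) (u\<^sub>0 s) - blinfun_apply (A s (u\<^sub>0 s)) (perturbed a s - x\<^sub>0 s)
      = R + (\<Sum>i<N. in_needle \<tau> a i s *\<^sub>R \<Delta> i)"
    using needled_diff[OF a, of "F s (perturbed a s)" s] unfolding R_def \<Delta>_def by (simp add: algebra_simps)
  have "blinfun_apply (P s) (R + (\<Sum>i<N. in_needle \<tau> a i s *\<^sub>R \<Delta> i)) - (\<Sum>i<N. in_needle \<tau> a i s *\<^sub>R Y i)
      = blinfun_apply (P s) R + (\<Sum>i<N. in_needle \<tau> a i s *\<^sub>R (blinfun_apply (P s) (\<Delta> i) - Y i))"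
    by (simp add: blinfun.add_right blinfun.sum_right blinfun.scaleR_right scaleR_diff_right sum_subtractf)
  also have "norm \<dots> \<le> norm (blinfun_apply (P s) R) + (\<Sum>i<N. norm (in_needle \<tau> a i s *\<^sub>R (blinfun_apply (P s) (\<Delta> i) - Y i)))"
    by (intro norm_triangle_le add_left_mono norm_sum)
  also have "\<dots> \<le> p * norm R + (\<Sum>i<N. in_needle \<tau> a i s *\<^sub>R (p * (2 * L * \<kappa>) + \<epsilon>))"
  proof (intro add_mono sum_mono)
    show "norm (blinfun_apply (P s) R) \<le> p * norm R"
      using norm_blinfun[of "P s" R] mult_right_mono[OF p norm_ge_zero[of R]] by linarith
    fix i assume "i \<in> {..<N}"
    then have i: "i < N" by simp
    show "norm (in_needle \<tau> a i s *\<^sub>R (blinfun_apply (P s) (\<Delta> i) - Y i)) \<le> in_needle \<tau> a i s *\<^sub>R (p * (2 * L * \<kappa>) + \<epsilon>)"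
    proof (cases "in_needle \<tau> a i s = 0")
      case False
      define \<psi> where "\<psi> = F s (x\<^sub>0 s) (\<zeta> i) - F s (x\<^sub>0 s) (u\<^sub>0 s)"
      have x0: "x\<^sub>0 s \<in> cball (x\<^sub>0 s) \<rho>" using \<rho> by simp
      have "u\<^sub>0 s \<in> M" using M(3) s by auto
      then have "norm (F s (perturbed a s) (\<zeta> i) - F s (x\<^sub>0 s) (\<zeta> i)) \<le> L * norm (perturbed a s - x\<^sub>0 s)"
        "norm (F s (perturbed a s) (u\<^sub>0 s) - F s (x\<^sub>0 s) (u\<^sub>0 s)) \<le> L * norm (perturbed a s - x\<^sub>0 s)"
        using M(4)[OF i] by (intro lip_M s perturbed(3)[OF a s] x0; simp)+
      moreover have "\<Delta> i - \<psi> = (F s (perturbed a s) (\<zeta> i) - F s (x\<^sub>0 s) (\<zeta> i)) - (F s (perturbed a s) (u\<^sub>0 s) - F s (x\<^sub>0 s) (u\<^sub>0 s))"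
        by (simp add: \<Delta>_def \<psi>_def)
      moreover have "L * norm (perturbed a s - x\<^sub>0 s) \<le> L * \<kappa>" using z L by simp
      ultimately have "norm (\<Delta> i - \<psi>) \<le> 2 * L * \<kappa>"
        using norm_triangle_ineq4[of "F s (perturbed a s) (\<zeta> i) - F s (x\<^sub>0 s) (\<zeta> i)" "F s (perturbed a s) (u\<^sub>0 s) - F s (x\<^sub>0 s) (u\<^sub>0 s)"]
        by simp
      then have "norm (blinfun_apply (P s) (\<Delta> i - \<psi>)) \<le> p * (2 * L * \<kappa>)"
        using norm_blinfun[of "P s" "\<Delta> i - \<psi>"] p p0 mult_mono[OF p _ p0 norm_ge_zero] order_trans by blast
      moreover have "norm (blinfun_apply (P s) \<psi> - Y i) \<le> \<epsilon>" using \<epsilon>[OF i False] by (simp add: \<psi>_def)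
      moreover have "blinfun_apply (P s) (\<Delta> i) - Y i = blinfun_apply (P s) (\<Delta> i - \<psi>) + (blinfun_apply (P s) \<psi> - Y i)"
        by (simp add: blinfun.diff_right)
      ultimately have "norm (blinfun_apply (P s) (\<Delta> i) - Y i) \<le> p * (2 * L * \<kappa>) + \<epsilon>"
        by (metis norm_triangle_le add_mono)
      moreover have "in_needle \<tau> a i s = 1" using False by (auto simp: in_needle_def split: if_splits)
      ultimately show ?thesis by simp
    qed simp
  qed
  finally show ?thesis unfolding split R_def .
qed

text \<open>
  Differentiability at each instant gives pointwise convergence without uniformity in time;
  the Lipschitz bound supplies the dominating constant.
\<close>

lemma remainder_negligible:
  assumes r: "\<And>k. r k > (0::real)" "r \<longlonglongrightarrow> 0" and x: "\<And>k. continuous_on {0..T} (x k)"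
    and \<rho>': "\<And>k t. t \<in> {0..T} \<Longrightarrow> x k t \<in> cball (x\<^sub>0 t) \<rho>"
    and z: "\<And>k t. t \<in> {0..T} \<Longrightarrow> norm (x k t - x\<^sub>0 t) \<le> c * r k"
  shows "(\<lambda>k. integral {0..T} (\<lambda>s. norm (F s (x k s) (u\<^sub>0 s) - F s (x\<^sub>0 s) (u\<^sub>0 s)
    - blinfun_apply (A s (u\<^sub>0 s)) (x k s - x\<^sub>0 s))) / r k) \<longlonglongrightarrow> 0"
proof -
  define R where "R k s = F s (x k s) (u\<^sub>0 s) - F s (x\<^sub>0 s) (u\<^sub>0 s) - blinfun_apply (A s (u\<^sub>0 s)) (x k s - x\<^sub>0 s)" for k s
  obtain B where B: "B > 0" "\<And>s. s \<in> {0..T} \<Longrightarrow> norm (A s (u\<^sub>0 s)) \<le> B"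
    using normal_pc_bounded[OF linearization_normal_pc] by blast
  have c: "0 \<le> c"
  proof -
    have "0 \<le> c * r 0" using order_trans[OF norm_ge_zero z[of 0 0]] T by simp
    then show ?thesis using r(1)[of 0] by (simp add: zero_le_mult_iff)
  qed
  have x\<Omega>: "x k ` {0..T} \<subseteq> \<Omega>" for k using \<rho>' tube by blast
  have int: "(\<lambda>s. norm (R k s) / r k) integrable_on {0..T}" for k
    unfolding R_def
    by (intro integrable_on_divide regulated_integrable_full regulated_norm regulated_diff regulated_blinfun_apply
        velocity_regulated[OF u0] x x\<Omega> x0_cont x0_\<Omega> normal_pc_regulated[OF linearization_normal_pc] continuous_on_regulated)
  have "(\<lambda>k. integral {0..T} (\<lambda>s. norm (R k s) / r k)) \<longlonglongrightarrow> integral {0..T} (\<lambda>_. 0)"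
  proof (rule dominated_convergence(2)[OF int, where h = "\<lambda>_. (L + B) * c"])
    fix k s assume s: "s \<in> {0..T}"
    have "u\<^sub>0 s \<in> M" using M(3) s by auto
    then have 1: "norm (F s (x k s) (u\<^sub>0 s) - F s (x\<^sub>0 s) (u\<^sub>0 s)) \<le> L * norm (x k s - x\<^sub>0 s)"
      using \<rho> by (intro lip_M s \<rho>') auto
    have 2: "norm (blinfun_apply (A s (u\<^sub>0 s)) (x k s - x\<^sub>0 s)) \<le> B * norm (x k s - x\<^sub>0 s)"
      using norm_blinfun[of "A s (u\<^sub>0 s)" "x k s - x\<^sub>0 s"] mult_right_mono[OF B(2)[OF s] norm_ge_zero] order_trans by blast
    have "norm (R k s) \<le> norm (F s (x k s) (u\<^sub>0 s) - F s (x\<^sub>0 s) (u\<^sub>0 s)) + norm (blinfun_apply (A s (u\<^sub>0 s)) (x k s - x\<^sub>0 s))"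
      unfolding R_def by (rule norm_triangle_ineq4)
    also have "\<dots> \<le> (L + B) * norm (x k s - x\<^sub>0 s)" using 1 2 by (simp add: distrib_right)
    also have "\<dots> \<le> (L + B) * (c * r k)" using z[OF s] L B(1) by (intro mult_left_mono) auto
    finally show "norm (norm (R k s) / r k) \<le> (L + B) * c" using r(1)[of k] by (simp add: divide_le_eq mult.assoc)
  next
    fix s assume s: "s \<in> {0..T}"
    have "u\<^sub>0 s \<in> U" using normal_pcD(5)[OF u0 s] .
    then have der: "((\<lambda>\<xi>. F s \<xi> (u\<^sub>0 s)) has_derivative blinfun_apply (A s (u\<^sub>0 s))) (at (x\<^sub>0 s))"
      by (rule A_deriv[OF s])
    have x_lim: "(\<lambda>k. x k s) \<longlonglongrightarrow> x\<^sub>0 s"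
    proof -
      have "(\<lambda>k. c * r k) \<longlonglongrightarrow> 0" using tendsto_mult_left[OF r(2), of c] by simp
      then have "(\<lambda>k. x k s - x\<^sub>0 s) \<longlonglongrightarrow> 0"
        by (rule Lim_null_comparison[rotated]) (use z[OF s] in auto)
      then show ?thesis by (simp add: LIM_zero_iff)
    qed
    show "(\<lambda>k. norm (R k s) / r k) \<longlonglongrightarrow> 0"
    proof (rule tendstoI)
      fix e :: real assume e: "e > 0"
      define e' where "e' = e / (c + 1)"
      have e': "e' > 0" using e c by (simp add: e'_def)
      obtain d where d: "d > 0" "\<And>y. norm (y - x\<^sub>0 s) < d \<Longrightarrow>
          norm (F s y (u\<^sub>0 s) - F s (x\<^sub>0 s) (u\<^sub>0 s) - blinfun_apply (A s (u\<^sub>0 s)) (y - x\<^sub>0 s)) \<le> e' * norm (y - x\<^sub>0 s)"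
        using der e' unfolding has_derivative_at_alt by blast
      have "\<forall>\<^sub>F k in sequentially. dist (x k s) (x\<^sub>0 s) < d" using x_lim d(1) by (rule tendstoD)
      then show "\<forall>\<^sub>F k in sequentially. dist (norm (R k s) / r k) 0 < e"
      proof eventually_elim
        case (elim k)
        then have "norm (R k s) \<le> e' * norm (x k s - x\<^sub>0 s)" unfolding R_def by (intro d(2)) (simp add: dist_norm)
        also have "\<dots> \<le> e' * (c * r k)" using z[OF s] e' by (intro mult_left_mono) auto
        finally have "norm (R k s) / r k \<le> e' * c" using r(1)[of k] by (simp add: divide_le_eq mult.assoc)
        also have "\<dots> < e" using e c by (simp add: e'_def divide_less_eq mult.commute)
        finally show ?case using r(1)[of k] by simp
      qed
    qed
  qed (rule integrable_const_ivl)
  then show ?thesis unfolding R_def by simp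
qed

text \<open>
  The direction in which the endpoint starts to move when needle \<open>i\<close> grows.
\<close>

definition needle_variation :: "nat \<Rightarrow> 'b" where
  "needle_variation i = blinfun_apply (P (\<tau> i)) (F (\<tau> i) (x\<^sub>0 (\<tau> i)) (\<zeta> i) - F (\<tau> i) (x\<^sub>0 (\<tau> i)) (u\<^sub>0 (\<tau> i)))"

lemma needle_velocity_right_continuous:
  assumes i: "i < N"
  shows "((\<lambda>s. blinfun_apply (P s) (F s (x\<^sub>0 s) (\<zeta> i) - F s (x\<^sub>0 s) (u\<^sub>0 s))) \<longlongrightarrow> needle_variation i) (at_right (\<tau> i))"
proof -
  have t: "0 \<le> \<tau> i" "\<tau> i < T" using \<tau>(1)[OF i] \<eta>(2)[OF i] \<eta>(1) by auto
  have "(P \<longlongrightarrow> P (\<tau> i)) (at (\<tau> i) within {0..T})" using P(1) t by (simp add: continuous_on_def)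
  then have 1: "(P \<longlongrightarrow> P (\<tau> i)) (at_right (\<tau> i))" by (rule tendsto_mono[OF at_right_le_within_Icc[OF t(2,1)]])
  have "\<zeta> i \<in> U" using M i by blast
  then have 2: "((\<lambda>s. F s (x\<^sub>0 s) (\<zeta> i)) \<longlongrightarrow> F (\<tau> i) (x\<^sub>0 (\<tau> i)) (\<zeta> i)) (at_right (\<tau> i))"
    using tendsto_along_control[OF at_right_le_within_Icc[OF t(2,1)] _ tendsto_const _ _ x0_cont x0_\<Omega> F_cont, of "\<zeta> i"] t
    by simp
  have 3: "((\<lambda>s. F s (x\<^sub>0 s) (u\<^sub>0 s)) \<longlongrightarrow> F (\<tau> i) (x\<^sub>0 (\<tau> i)) (u\<^sub>0 (\<tau> i))) (at_right (\<tau> i))"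
    using normal_pcD(7)[OF velocity_normal_pc[OF u0 x0_cont x0_\<Omega>] t] .
  show ?thesis unfolding needle_variation_def by (intro blinfun.tendsto tendsto_diff 1 2 3)
qed

lemma needle_width:
  assumes a: "short_needles a" and i: "i < N" and s: "in_needle \<tau> a i s \<noteq> 0"
  shows "\<tau> i \<le> s" "s < \<tau> i + sum a {..<N}"
proof -
  have "0 \<le> sum a {..<i}" "sum a {..<Suc i} \<le> sum a {..<N}"
    using partial_sum_bounds[of a i] partial_sum_bounds[of a "Suc i"] short_needlesD(1)[OF a] i by auto
  moreover have "\<tau> i + sum a {..<i} \<le> s" "s < \<tau> i + sum a {..<Suc i}"
    using s by (auto simp: in_needle_def split: if_splits)
  ultimately show "\<tau> i \<le> s" "s < \<tau> i + sum a {..<N}" by linarith+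
qed

text \<open>
  The pointwise estimate is integrated; the needle number \<open>i\<close> has length \<open>a i\<close>, which turns
  the sum over the needles into the total length.
\<close>

lemma perturbed_endpoint_error:
  assumes a: "short_needles a" and p: "\<And>s. s \<in> {0..T} \<Longrightarrow> norm (P s) \<le> p"
    and z: "\<And>s. s \<in> {0..T} \<Longrightarrow> norm (perturbed a s - x\<^sub>0 s) \<le> \<kappa>"
    and \<epsilon>: "\<And>i s. i < N \<Longrightarrow> \<tau> i \<le> s \<Longrightarrow> s < \<tau> i + sum a {..<N} \<Longrightarrow>
      norm (blinfun_apply (P s) (F s (x\<^sub>0 s) (\<zeta> i) - F s (x\<^sub>0 s) (u\<^sub>0 s)) - needle_variation i) \<le> \<epsilon>"
  shows "norm (perturbed a T - x\<^sub>0 T - (\<Sum>i<N. a i *\<^sub>R needle_variation i)) \<le>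
    p * integral {0..T} (\<lambda>s. norm (F s (perturbed a s) (u\<^sub>0 s) - F s (x\<^sub>0 s) (u\<^sub>0 s) - blinfun_apply (A s (u\<^sub>0 s)) (perturbed a s - x\<^sub>0 s)))
    + sum a {..<N} * (p * (2 * L * \<kappa>) + \<epsilon>)"
proof -
  define R where "R s = norm (F s (perturbed a s) (u\<^sub>0 s) - F s (x\<^sub>0 s) (u\<^sub>0 s) - blinfun_apply (A s (u\<^sub>0 s)) (perturbed a s - x\<^sub>0 s))" for s
  define \<Theta> where "\<Theta> s = blinfun_apply (P s) (F s (perturbed a s) (needled a s) - F s (x\<^sub>0 s) (u\<^sub>0 s)
      - blinfun_apply (A s (u\<^sub>0 s)) (perturbed a s - x\<^sub>0 s)) - (\<Sum>i<N. in_needle \<tau> a i s *\<^sub>R needle_variation i)" for s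
  have R: "R integrable_on {0..T}" unfolding R_def
    by (intro regulated_integrable_full regulated_norm regulated_diff regulated_blinfun_apply
        velocity_regulated[OF u0] perturbed[OF a] x0_cont x0_\<Omega> normal_pc_regulated[OF linearization_normal_pc] continuous_on_regulated)
  have \<Theta>: "(\<Theta> has_integral perturbed a T - x\<^sub>0 T - (\<Sum>i<N. a i *\<^sub>R needle_variation i)) {0..T}"
    unfolding \<Theta>_def
    by (intro has_integral_diff endpoint_deviation[OF P perturbed(1)[OF a]] has_integral_sum needle_integral a) auto
  have bound: "((\<lambda>s. p * R s + (\<Sum>i<N. in_needle \<tau> a i s *\<^sub>R (p * (2 * L * \<kappa>) + \<epsilon>)))
      has_integral p * integral {0..T} R + (\<Sum>i<N. a i *\<^sub>R (p * (2 * L * \<kappa>) + \<epsilon>))) {0..T}"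
    using R by (intro has_integral_add has_integral_mult_right integrable_integral has_integral_sum needle_integral a) auto
  have "norm (integral {0..T} \<Theta>) \<le> integral {0..T} (\<lambda>s. p * R s + (\<Sum>i<N. in_needle \<tau> a i s *\<^sub>R (p * (2 * L * \<kappa>) + \<epsilon>)))"
  proof (rule Henstock_Kurzweil_Integration.integral_norm_bound_integral)
    fix s assume s: "s \<in> {0..T}"
    show "norm (\<Theta> s) \<le> p * R s + (\<Sum>i<N. in_needle \<tau> a i s *\<^sub>R (p * (2 * L * \<kappa>) + \<epsilon>))"
      unfolding \<Theta>_def R_def
      by (rule perturbed_linearization_pointwise[OF a s p[OF s] z[OF s]]) (use \<epsilon> needle_width[OF a] in blast)
  qed (use \<Theta> bound in auto)
  also have "\<dots> = p * integral {0..T} R + (\<Sum>i<N. a i *\<^sub>R (p * (2 * L * \<kappa>) + \<epsilon>))"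
    using bound by (rule integral_unique)
  also have "(\<Sum>i<N. a i *\<^sub>R (p * (2 * L * \<kappa>) + \<epsilon>)) = sum a {..<N} * (p * (2 * L * \<kappa>) + \<epsilon>)"
    by (simp add: sum_distrib_right)
  finally show ?thesis using integral_unique[OF \<Theta>] by (simp add: R_def[abs_def])
qed

text \<open>
  Divided by \<open>r k\<close> the error has three parts: the remainder of the linearization, which is
  negligible; the deviation of the state on the needles, which is of second order; and the
  variation of the velocity jump on the needles, which is small by continuity from the right.
\<close>

lemma perturbed_endpoint_derivative_short:
  assumes r: "\<And>k. r k > (0::real)" "r \<longlonglongrightarrow> 0" and b: "\<And>k i. i < N \<Longrightarrow> 0 \<le> b k i"
    and lim: "\<And>i. i < N \<Longrightarrow> (\<lambda>k. b k i) \<longlonglongrightarrow> a i"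
    and short_needles: "\<And>k. short_needles (\<lambda>i. r k * b k i)"
    and B: "B > 0" "\<And>k. sum (b k) {..<N} \<le> B"
  shows "(\<lambda>k. (perturbed (\<lambda>i. r k * b k i) T - x\<^sub>0 T) /\<^sub>R r k) \<longlonglongrightarrow> (\<Sum>i<N. a i *\<^sub>R needle_variation i)"
proof -
  define w where "w k i = r k * b k i" for k i
  have sw: "short_needles (w k)" for k using short_needles unfolding w_def .
  have w_sum: "sum (w k) {..<N} = r k * sum (b k) {..<N}" for k by (simp add: w_def sum_distrib_left)
  have "compact (P ` {0..T})" using P(1) by (intro compact_continuous_image) auto
  then have "bounded (P ` {0..T})" by (rule compact_imp_bounded)
  then obtain p where p: "p > 0" "\<And>s. s \<in> {0..T} \<Longrightarrow> norm (P s) \<le> p"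
    unfolding bounded_pos by auto
  have z: "norm (perturbed (w k) s - x\<^sub>0 s) \<le> deviation_rate * B * r k" if "s \<in> {0..T}" for k s
  proof -
    have "sum (w k) {..<N} \<le> B * r k" using B(2)[of k] r(1)[of k] by (simp add: w_sum mult.commute)
    then have "deviation_rate * sum (w k) {..<N} \<le> deviation_rate * (B * r k)" using deviation_rate by simp
    then show ?thesis using perturbed(2)[OF sw that, of k] by (simp add: mult.assoc)
  qed
  define Q where "Q k = integral {0..T} (\<lambda>s. norm (F s (perturbed (w k) s) (u\<^sub>0 s) - F s (x\<^sub>0 s) (u\<^sub>0 s)
    - blinfun_apply (A s (u\<^sub>0 s)) (perturbed (w k) s - x\<^sub>0 s)))" for k
  have Q: "(\<lambda>k. Q k / r k) \<longlonglongrightarrow> 0"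
    unfolding Q_def by (rule remainder_negligible[OF r perturbed(4)[OF sw] perturbed(3)[OF sw] z])
  have "(\<lambda>k. (perturbed (w k) T - x\<^sub>0 T) /\<^sub>R r k - (\<Sum>i<N. b k i *\<^sub>R needle_variation i)) \<longlonglongrightarrow> 0"
  proof (rule tendstoI)
    fix e :: real assume e: "e > 0"
    \<comment> \<open>the needles together contribute \<open>B * \<epsilon>\<close>, one half of
      \<open>e\<close>\<close>
    define \<epsilon> where "\<epsilon> = e / (2 * B)"
    have \<epsilon>: "\<epsilon> > 0" "B * \<epsilon> = e / 2" using e B by (auto simp: \<epsilon>_def)
    have "\<exists>\<theta>>0. \<forall>s. \<tau> i \<le> s \<and> s < \<tau> i + \<theta> \<longrightarrow>
        norm (blinfun_apply (P s) (F s (x\<^sub>0 s) (\<zeta> i) - F s (x\<^sub>0 s) (u\<^sub>0 s)) - needle_variation i) \<le> \<epsilon>" if i: "i < N" for i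
    proof -
      let ?\<psi> = "\<lambda>s. blinfun_apply (P s) (F s (x\<^sub>0 s) (\<zeta> i) - F s (x\<^sub>0 s) (u\<^sub>0 s))"
      have "\<forall>\<^sub>F s in at_right (\<tau> i). dist (?\<psi> s) (needle_variation i) < \<epsilon>"
        using needle_velocity_right_continuous[OF i] \<epsilon>(1) by (rule tendstoD)
      then obtain c where c: "c > \<tau> i" "\<And>s. \<tau> i < s \<Longrightarrow> s < c \<Longrightarrow> dist (?\<psi> s) (needle_variation i) < \<epsilon>"
        by (auto simp: eventually_at_right_field)
      have "norm (?\<psi> s - needle_variation i) \<le> \<epsilon>" if s: "\<tau> i \<le> s" "s < \<tau> i + (c - \<tau> i)" for s
      proof (cases "s = \<tau> i")
        case True
        then show ?thesis using \<epsilon>(1) by (simp add: needle_variation_def)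
      next
        case False
        then show ?thesis using c(2)[of s] s by (simp add: dist_norm)
      qed
      then show ?thesis using c(1) by (intro exI[of _ "c - \<tau> i"]) auto
    qed
    then obtain \<theta> where \<theta>: "\<And>i. i < N \<Longrightarrow> \<theta> i > 0" "\<And>i s. i < N \<Longrightarrow> \<tau> i \<le> s \<Longrightarrow> s < \<tau> i + \<theta> i \<Longrightarrow>
        norm (blinfun_apply (P s) (F s (x\<^sub>0 s) (\<zeta> i) - F s (x\<^sub>0 s) (u\<^sub>0 s)) - needle_variation i) \<le> \<epsilon>"
      by metis
    have "(\<lambda>k. r k * B) \<longlonglongrightarrow> 0" using tendsto_mult_right[OF r(2), of B] by simp
    then have "\<forall>\<^sub>F k in sequentially. r k * B < \<theta> i" if "i < N" for i
      using \<theta>(1)[OF that] by (rule order_tendstoD(2))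
    then have "\<forall>\<^sub>F k in sequentially. \<forall>i\<in>{..<N}. r k * B < \<theta> i"
      by (intro eventually_ball_finite) auto
    moreover have "(\<lambda>k. p * (Q k / r k) + B * (p * (2 * L * (deviation_rate * B * r k)))) \<longlonglongrightarrow> p * 0 + B * (p * (2 * L * (deviation_rate * B * 0)))"
      by (intro tendsto_intros Q r(2))
    then have "\<forall>\<^sub>F k in sequentially. p * (Q k / r k) + B * (p * (2 * L * (deviation_rate * B * r k))) < e / 2"
      using e by (intro order_tendstoD(2)) auto
    ultimately show "\<forall>\<^sub>F k in sequentially. dist ((perturbed (w k) T - x\<^sub>0 T) /\<^sub>R r k - (\<Sum>i<N. b k i *\<^sub>R needle_variation i)) 0 < e"
    proof eventually_elim
      case (elim k)
      have sumB: "sum (w k) {..<N} \<le> r k * B" using B(2)[of k] r(1)[of k] by (simp add: w_sum)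
      define D where "D = perturbed (w k) T - x\<^sub>0 T - (\<Sum>i<N. w k i *\<^sub>R needle_variation i)"
      have "norm D \<le> p * Q k + sum (w k) {..<N} * (p * (2 * L * (deviation_rate * B * r k)) + \<epsilon>)"
        unfolding D_def Q_def
      proof (rule perturbed_endpoint_error[OF sw p(2) z])
        fix i s assume i: "i < N" and s: "\<tau> i \<le> s" "s < \<tau> i + sum (w k) {..<N}"
        have "r k * B < \<theta> i" using elim(1) i by auto
        then have "s < \<tau> i + \<theta> i" using s(2) sumB by linarith
        then show "norm (blinfun_apply (P s) (F s (x\<^sub>0 s) (\<zeta> i) - F s (x\<^sub>0 s) (u\<^sub>0 s)) - needle_variation i) \<le> \<epsilon>"
          by (rule \<theta>(2)[OF i s(1)])
      qed
      also have "\<dots> \<le> p * Q k + (r k * B) * (p * (2 * L * (deviation_rate * B * r k)) + \<epsilon>)"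
        using p(1) L deviation_rate B(1) r(1)[of k] \<epsilon>(1) by (intro add_left_mono mult_right_mono sumB add_nonneg_nonneg mult_nonneg_nonneg) auto
      also have "\<dots> = r k * (p * (Q k / r k) + B * (p * (2 * L * (deviation_rate * B * r k))) + B * \<epsilon>)"
        using r(1)[of k] by (simp add: algebra_simps)
      also have "\<dots> < r k * e"
      proof (rule mult_strict_left_mono[OF _ r(1)])
        show "p * (Q k / r k) + B * (p * (2 * L * (deviation_rate * B * r k))) + B * \<epsilon> < e"
          using elim(2) unfolding \<epsilon>(2) by linarith
      qed
      finally have "norm D < r k * e" .
      moreover have "(perturbed (w k) T - x\<^sub>0 T) /\<^sub>R r k - (\<Sum>i<N. b k i *\<^sub>R needle_variation i) = D /\<^sub>R r k"
      proof -
        have "r k \<noteq> 0" using r(1)[of k] by simp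
        then show ?thesis unfolding D_def w_def
          by (simp add: scaleR_diff_right scaleR_sum_right mult.assoc[symmetric])
      qed
      moreover have "norm (D /\<^sub>R r k) = norm D / r k" using r(1)[of k] by (simp add: divide_inverse_commute)
      ultimately show ?case using r(1)[of k] by (simp add: pos_divide_less_eq mult.commute del: norm_scaleR)
    qed
  qed
  moreover have "(\<lambda>k. \<Sum>i<N. b k i *\<^sub>R needle_variation i) \<longlonglongrightarrow> (\<Sum>i<N. a i *\<^sub>R needle_variation i)"
    by (intro tendsto_intros lim) auto
  ultimately have "(\<lambda>k. ((perturbed (w k) T - x\<^sub>0 T) /\<^sub>R r k - (\<Sum>i<N. b k i *\<^sub>R needle_variation i)) + (\<Sum>i<N. b k i *\<^sub>R needle_variation i))
      \<longlonglongrightarrow> 0 + (\<Sum>i<N. a i *\<^sub>R needle_variation i)"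
    by (rule tendsto_add)
  then show ?thesis by (simp add: w_def[abs_def])
qed

text \<open>
  Only finitely many members of the sequence can violate the length bounds.
\<close>

lemma perturbed_endpoint_derivative:
  assumes r: "\<And>k. r k > (0::real)" "r \<longlonglongrightarrow> 0" and b: "\<And>k i. i < N \<Longrightarrow> 0 \<le> b k i"
    and lim: "\<And>i. i < N \<Longrightarrow> (\<lambda>k. b k i) \<longlonglongrightarrow> a i"
  shows "(\<lambda>k. (perturbed (\<lambda>i. r k * b k i) T - x\<^sub>0 T) /\<^sub>R r k) \<longlonglongrightarrow> (\<Sum>i<N. a i *\<^sub>R needle_variation i)"
proof -
  have s_lim: "(\<lambda>k. sum (b k) {..<N}) \<longlonglongrightarrow> sum a {..<N}" by (intro tendsto_sum lim) auto
  then have "Bseq (\<lambda>k. sum (b k) {..<N})" by (intro convergent_imp_Bseq convergentI)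
  then obtain B where B: "B > 0" "\<And>k. norm (sum (b k) {..<N}) \<le> B" by (auto elim: BseqE)
  have B': "sum (b k) {..<N} \<le> B" for k
    using abs_le_D1[OF B(2)[of k, unfolded real_norm_def]] .
  have "(\<lambda>k. r k * sum (b k) {..<N}) \<longlonglongrightarrow> 0 * sum a {..<N}" by (intro tendsto_mult r s_lim)
  moreover have "min \<eta> (\<rho> / deviation_rate) > 0" using \<eta> \<rho> deviation_rate by simp
  ultimately have "\<forall>\<^sub>F k in sequentially. r k * sum (b k) {..<N} < min \<eta> (\<rho> / deviation_rate)"
    by (intro order_tendstoD(2)) auto
  then obtain k0 where k0: "\<And>k. k \<ge> k0 \<Longrightarrow> r k * sum (b k) {..<N} < min \<eta> (\<rho> / deviation_rate)"
    unfolding eventually_sequentially by blast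
  have sm: "short_needles (\<lambda>i. r (k + k0) * b (k + k0) i)" for k
    using k0[of "k + k0"] b r(1)[of "k + k0"] unfolding short_needles_def
    by (auto simp: sum_distrib_left[symmetric] less_imp_le)
  have "(\<lambda>k. (perturbed (\<lambda>i. r (k + k0) * b (k + k0) i) T - x\<^sub>0 T) /\<^sub>R r (k + k0)) \<longlonglongrightarrow> (\<Sum>i<N. a i *\<^sub>R needle_variation i)"
    by (rule perturbed_endpoint_derivative_short[OF r(1) LIMSEQ_ignore_initial_segment[OF r(2)] b
          LIMSEQ_ignore_initial_segment[OF lim] sm B(1) B'])
  then show ?thesis by (rule LIMSEQ_offset)
qed

lemma endpoint_map_perturbed:
  "\<exists>\<delta>>0. endpoint_map {..<N} needle_variation {x T |x u. trajectory x u} (x\<^sub>0 T) \<delta> (\<lambda>a. perturbed a T)"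
proof -
  define m where "m = min \<eta> (\<rho> / deviation_rate)"
  have m: "m > 0" using \<eta> \<rho> deviation_rate by (simp add: m_def)
  \<comment> \<open>a box of this side contains only families of total length at most \<open>m\<close>,
    also for \<open>N = 0\<close>\<close>
  define \<delta> where "\<delta> = m / (real N + 1)"
  have sm: "short_needles a" if "\<forall>n\<in>{..<N}. 0 \<le> a n \<and> a n \<le> \<delta>" for a
  proof -
    have "sum a {..<N} \<le> (\<Sum>i<N. \<delta>)" by (rule sum_mono) (use that in auto)
    also have "\<dots> \<le> m" using m by (simp add: \<delta>_def field_simps)
    finally show ?thesis using that by (simp add: short_needles_def m_def)
  qed
  have "endpoint_map {..<N} needle_variation {x T |x u. trajectory x u} (x\<^sub>0 T) \<delta> (\<lambda>a. perturbed a T)"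
    unfolding endpoint_map_def
  proof (intro conjI allI impI)
    fix a assume "\<forall>n\<in>{..<N}. 0 \<le> a n \<and> a n \<le> \<delta>"
    then show "perturbed a T \<in> {x T |x u. trajectory x u}" using perturbed(1)[OF sm] by blast
  next
    fix b :: "nat \<Rightarrow> nat \<Rightarrow> real" and a
    assume *: "\<forall>k. \<forall>n\<in>{..<N}. 0 \<le> b k n \<and> b k n \<le> \<delta>" "\<forall>n\<in>{..<N}. 0 \<le> a n \<and> a n \<le> \<delta>"
      "\<forall>n\<in>{..<N}. (\<lambda>k. b k n) \<longlonglongrightarrow> a n"
    then show "(\<lambda>k. perturbed (b k) T) \<longlonglongrightarrow> perturbed a T" by (intro perturbed_endpoint_continuous sm) auto
  next
    fix r :: "nat \<Rightarrow> real" and b :: "nat \<Rightarrow> nat \<Rightarrow> real" and a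
    assume "\<forall>k. r k > 0" "r \<longlonglongrightarrow> 0" "\<forall>k. \<forall>n\<in>{..<N}. 0 \<le> b k n" "\<forall>n\<in>{..<N}. (\<lambda>k. b k n) \<longlonglongrightarrow> a n"
    then show "(\<lambda>k. (perturbed (\<lambda>n. r k * b k n) T - x\<^sub>0 T) /\<^sub>R r k) \<longlonglongrightarrow> (\<Sum>n\<in>{..<N}. a n *\<^sub>R needle_variation n)"
      by (intro perturbed_endpoint_derivative) auto
  qed
  moreover have "\<delta> > 0" using m by (simp add: \<delta>_def)
  ultimately show ?thesis by blast
qed

end

lemma endpoint_map_reindex:
  assumes e: "endpoint_map I Y R e\<^sub>0 \<delta> e" and f: "bij_betw f I J" and Y: "\<And>i. i \<in> I \<Longrightarrow> Y' (f i) = Y i"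
  shows "endpoint_map J Y' R e\<^sub>0 \<delta> (\<lambda>a. e (\<lambda>i. a (f i)))"
proof -
  have J: "J = f ` I" using f by (simp add: bij_betw_def)
  have sum: "(\<Sum>n\<in>J. a n *\<^sub>R Y' n) = (\<Sum>i\<in>I. a (f i) *\<^sub>R Y i)" for a
    using sum.reindex_bij_betw[OF f, of "\<lambda>n. a n *\<^sub>R Y' n"] Y by simp
  show ?thesis
    using e unfolding endpoint_map_def sum unfolding J by (simp add: ball_simps)
qed

context controlled_trajectory
begin

text \<open>
  A finite set of pairs of an instant and a control value is listed by increasing instants,
  which makes it a family of needles; repeated instants are allowed.
\<close>

lemma endpoint_variation:
  fixes P :: "real \<Rightarrow> 'b \<Rightarrow>\<^sub>L 'b"
  assumes P: "continuous_on {0..T} P" "P T = id_blinfun"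
      "\<And>t. t \<in> {0..T} \<Longrightarrow> P t = P 0 + integral {0..t} (\<lambda>s. - (P s o\<^sub>L A s (u\<^sub>0 s)))"
    and J: "finite J" "J \<subseteq> {0..<T} \<times> U"
  shows "\<exists>\<delta>>0. \<exists>e. endpoint_map J (\<lambda>(t, z). blinfun_apply (P t) (F t (x\<^sub>0 t) z - F t (x\<^sub>0 t) (u\<^sub>0 t)))
    {x T |x u. trajectory x u} (x\<^sub>0 T) \<delta> e"
proof -
  obtain xs where xs: "set xs = J" "distinct xs" using finite_distinct_list[OF J(1)] by blast
  define ps where "ps = sort_key fst xs"
  have ps: "set ps = J" "distinct ps" "sorted (map fst ps)" using xs by (simp_all add: ps_def)
  define N where "N = length ps"
  define \<tau> where "\<tau> i = fst (ps ! i)" for i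
  define \<zeta> where "\<zeta> i = snd (ps ! i)" for i
  have mem: "ps ! i \<in> J" if "i < N" for i using that ps(1) nth_mem[of i ps] by (simp add: N_def)
  have \<tau>: "0 \<le> \<tau> i" "\<tau> i < T" and \<zeta>: "\<zeta> i \<in> U" if "i < N" for i
    using subsetD[OF J(2) mem[OF that]] by (auto simp: \<tau>_def \<zeta>_def mem_Times_iff)
  have mono: "\<tau> i \<le> \<tau> j" if "i \<le> j" "j < N" for i j
    using sorted_nth_mono[OF ps(3), of i j] that by (simp add: \<tau>_def N_def)
  obtain M\<^sub>0 where M\<^sub>0: "compact M\<^sub>0" "M\<^sub>0 \<subseteq> U" "u\<^sub>0 ` {0..T} \<subseteq> M\<^sub>0"
    using normal_pc_compact_range[OF u0] by blast
  define M where "M = M\<^sub>0 \<union> \<zeta> ` {..<N}"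
  have M: "compact M" "M \<subseteq> U" "u\<^sub>0 ` {0..T} \<subseteq> M" "\<And>i. i < N \<Longrightarrow> \<zeta> i \<in> M"
  proof -
    show "compact M" unfolding M_def by (intro compact_Un M\<^sub>0(1) finite_imp_compact) simp
  qed (use M\<^sub>0 \<zeta> in \<open>auto simp: M_def\<close>)
  obtain \<rho> L where \<rho>: "\<rho> > 0" and L: "L > 0" and tube: "\<forall>t\<in>{0..T}. cball (x\<^sub>0 t) \<rho> \<subseteq> \<Omega> \<and>
      (\<forall>\<zeta>\<in>M. \<forall>\<xi>\<in>cball (x\<^sub>0 t) \<rho>. \<forall>\<eta>\<in>cball (x\<^sub>0 t) \<rho>. norm (F t \<xi> \<zeta> - F t \<eta> \<zeta>) \<le> L * norm (\<xi> - \<eta>))"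
    using lip[OF M(1,2)] by blast
  have tube1: "cball (x\<^sub>0 t) \<rho> \<subseteq> \<Omega>" if "t \<in> {0..T}" for t
    using tube that by blast
  have tube2: "norm (F t \<xi> z - F t y z) \<le> L * norm (\<xi> - y)"
    if "t \<in> {0..T}" "z \<in> M" "\<xi> \<in> cball (x\<^sub>0 t) \<rho>" "y \<in> cball (x\<^sub>0 t) \<rho>" for t z \<xi> y
    using tube that by blast
  have "continuous_on ({0..T} \<times> M) (\<lambda>p. (\<lambda>(t, \<xi>, \<zeta>). F t \<xi> \<zeta>) (fst p, x\<^sub>0 (fst p), snd p))"
  proof (rule continuous_on_compose2[OF F_cont])
    show "continuous_on ({0..T} \<times> M) (\<lambda>p. (fst p, x\<^sub>0 (fst p), snd p))"
      by (intro continuous_intros continuous_on_compose2[OF x0_cont]) auto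
  qed (use x0_\<Omega> M(2) in auto)
  then have "compact ((\<lambda>p. F (fst p) (x\<^sub>0 (fst p)) (snd p)) ` ({0..T} \<times> M))"
    using M(1) by (intro compact_continuous_image compact_Times) auto
  then have "bounded ((\<lambda>p. F (fst p) (x\<^sub>0 (fst p)) (snd p)) ` ({0..T} \<times> M))" by (rule compact_imp_bounded)
  then obtain C where C: "C > 0" "\<And>s z. s \<in> {0..T} \<Longrightarrow> z \<in> M \<Longrightarrow> norm (F s (x\<^sub>0 s) z) \<le> C"
    unfolding bounded_pos by auto
  define m where "m = N - 1"
  \<comment> \<open>the last needle starts strictly before \<open>T\<close>; half of the remaining time
    is left for the total length\<close>
  define \<eta> where "\<eta> = (if N = 0 then 1 else (T - \<tau> m) / 2)"
  have \<eta>: "\<eta> > 0" using \<tau>(2)[of m] by (auto simp: \<eta>_def m_def)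
  have \<tau>\<eta>: "\<tau> i + \<eta> < T" if "i < N" for i
  proof -
    have "\<tau> i \<le> \<tau> m" "\<tau> m < T" using mono[of i m] \<tau>(2)[of m] that by (auto simp: m_def)
    moreover have "\<eta> = (T - \<tau> m) / 2" using that by (simp add: \<eta>_def)
    ultimately show ?thesis by (auto simp: field_simps)
  qed
  interpret needle_family T \<Omega> U F A x\<^sub>0 u\<^sub>0 S\<^sub>0 M \<rho> L C \<eta> P \<tau> \<zeta> N
    by unfold_locales (fact M \<rho> L tube1 tube2 C P \<tau>(1) mono \<eta> \<tau>\<eta>)+
  obtain \<delta> where \<delta>: "\<delta> > 0" "endpoint_map {..<N} needle_variation {x T |x u. trajectory x u} (x\<^sub>0 T) \<delta> (\<lambda>a. perturbed a T)"
    using endpoint_map_perturbed by blast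
  have bij: "bij_betw ((!) ps) {..<N} J" using bij_betw_nth[OF ps(2)] ps(1) by (simp add: N_def)
  have "endpoint_map J (\<lambda>(t, z). blinfun_apply (P t) (F t (x\<^sub>0 t) z - F t (x\<^sub>0 t) (u\<^sub>0 t)))
    {x T |x u. trajectory x u} (x\<^sub>0 T) \<delta> (\<lambda>a. perturbed (\<lambda>i. a (ps ! i)) T)"
    by (rule endpoint_map_reindex[OF \<delta>(2) bij]) (simp add: needle_variation_def \<tau>_def \<zeta>_def case_prod_beta)
  then show ?thesis using \<delta>(1) by blast
qed

end

section \<open>Hadamard differentials and maximized functions\<close>

lemma has_hadamard_diff_add:
  assumes "has_hadamard_diff F L x" "has_hadamard_diff G L' x"
  shows "has_hadamard_diff (\<lambda>y. F y + G y) (L + L') x"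
proof -
  have eq: "(F (x + \<theta> *\<^sub>R w) + G (x + \<theta> *\<^sub>R w) - (F x + G x)) /\<^sub>R \<theta>
      = (F (x + \<theta> *\<^sub>R w) - F x) /\<^sub>R \<theta> + (G (x + \<theta> *\<^sub>R w) - G x) /\<^sub>R \<theta>" for \<theta> w
    by (simp add: scaleR_diff_right scaleR_add_right)
  show ?thesis
    using assms unfolding has_hadamard_diff_def has_gateaux_diff_def case_prod_beta eq blinfun.add_left
    by (auto intro: tendsto_add)
qed

lemma has_hadamard_diff_blinfun: "has_hadamard_diff (blinfun_apply L) L x"
proof -
  have lim: "((\<lambda>p. (blinfun_apply L (x + fst p *\<^sub>R snd p) - blinfun_apply L x) /\<^sub>R fst p) \<longlongrightarrow> blinfun_apply L v)
      (at_right 0 \<times>\<^sub>F nhds v)" for v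
  proof (rule Lim_transform_eventually)
    show "((\<lambda>p. blinfun_apply L (snd p)) \<longlongrightarrow> blinfun_apply L v) (at_right 0 \<times>\<^sub>F nhds v)"
      by (intro blinfun.tendsto tendsto_const filterlim_snd)
    have "\<forall>\<^sub>F \<theta> in at_right (0::real). \<theta> \<noteq> 0" by (simp add: eventually_at_filter)
    then have "\<forall>\<^sub>F p in at_right (0::real) \<times>\<^sub>F nhds v. fst p \<noteq> 0"
      by (rule eventually_compose_filterlim) (rule filterlim_fst)
    then show "\<forall>\<^sub>F p in at_right 0 \<times>\<^sub>F nhds v. blinfun_apply L (snd p) = (blinfun_apply L (x + fst p *\<^sub>R snd p) - blinfun_apply L x) /\<^sub>R fst p"
      by eventually_elim (simp add: blinfun.add_right blinfun.scaleR_right)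
  qed
  have g: "((\<lambda>\<theta>. (blinfun_apply L (x + \<theta> *\<^sub>R v) - blinfun_apply L x) /\<^sub>R \<theta>) \<longlongrightarrow> blinfun_apply L v) (at_right 0)" for v
  proof -
    have "filterlim (\<lambda>\<theta>. (\<theta>, v)) (at_right (0::real) \<times>\<^sub>F nhds v) (at_right 0)"
      by (intro filterlim_Pair filterlim_ident tendsto_const)
    from filterlim_compose[OF lim this] show ?thesis by simp
  qed
  show ?thesis unfolding has_hadamard_diff_def has_gateaux_diff_def case_prod_beta using lim g by blast
qed

lemma has_hadamard_diff_compose_blinfun:
  assumes "has_hadamard_diff G L (blinfun_apply B x)"
  shows "has_hadamard_diff (\<lambda>y. G (blinfun_apply B y)) (L o\<^sub>L B) x"
proof -
  have lim: "((\<lambda>p. (G (blinfun_apply B x + fst p *\<^sub>R snd p) - G (blinfun_apply B x)) /\<^sub>R fst p) \<longlongrightarrow> blinfun_apply L v)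
      (at_right 0 \<times>\<^sub>F nhds v)" for v
    using assms unfolding has_hadamard_diff_def case_prod_beta by blast
  have "filterlim (\<lambda>p. (fst p, blinfun_apply B (snd p))) (at_right 0 \<times>\<^sub>F nhds (blinfun_apply B v)) (at_right 0 \<times>\<^sub>F nhds v)" for v
    by (intro filterlim_Pair filterlim_fst blinfun.tendsto tendsto_const filterlim_snd)
  from filterlim_compose[OF lim this]
  have "((\<lambda>p. (G (blinfun_apply B (x + fst p *\<^sub>R snd p)) - G (blinfun_apply B x)) /\<^sub>R fst p) \<longlongrightarrow> blinfun_apply (L o\<^sub>L B) v)
      (at_right 0 \<times>\<^sub>F nhds v)" for v
    by (simp add: blinfun.add_right blinfun.scaleR_right)
  moreover have "has_gateaux_diff (\<lambda>y. G (blinfun_apply B y)) (L o\<^sub>L B) x"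
    using assms unfolding has_hadamard_diff_def has_gateaux_diff_def
    by (simp add: blinfun.add_right blinfun.scaleR_right)
  ultimately show ?thesis unfolding has_hadamard_diff_def case_prod_beta by blast
qed

text \<open>
  For \<open>y k\<close> tending to \<open>x\<close> the quotients by a step slightly larger than the square root of the
  distance tend to \<open>0\<close>, so the sequential form of the differential applies with direction \<open>0\<close>.
\<close>

lemma has_hadamard_diff_isCont:
  assumes F: "has_hadamard_diff F L x"
  shows "isCont F x"
  unfolding continuous_at_sequentially
proof (intro allI impI)
  fix y assume y: "y \<longlonglongrightarrow> x"
  \<comment> \<open>the second summand keeps the step positive when \<open>y k = x\<close>\<close>
  define r where "r k = sqrt (norm (y k - x)) + inverse (real (Suc k))" for k
  have r: "r k > 0" for k unfolding r_def by (intro add_nonneg_pos) auto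
  have n0: "(\<lambda>k. norm (y k - x)) \<longlonglongrightarrow> 0" using y by (simp add: LIM_zero tendsto_norm_zero)
  have s0: "(\<lambda>k. sqrt (norm (y k - x))) \<longlonglongrightarrow> 0" using tendsto_real_sqrt[OF n0] by simp
  have r0: "r \<longlonglongrightarrow> 0"
    unfolding r_def using tendsto_add[OF s0 LIMSEQ_inverse_real_of_nat] by simp
  have "(\<lambda>k. (y k - x) /\<^sub>R r k) \<longlonglongrightarrow> 0"
  proof (rule Lim_null_comparison[OF _ s0], rule always_eventually, rule allI)
    fix k
    have "norm (y k - x) = sqrt (norm (y k - x)) * sqrt (norm (y k - x))" by simp
    also have "\<dots> \<le> sqrt (norm (y k - x)) * r k" unfolding r_def by (intro mult_left_mono) auto
    finally show "norm ((y k - x) /\<^sub>R r k) \<le> sqrt (norm (y k - x))"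
      using r[of k] by (simp add: divide_inverse_commute[symmetric] divide_le_eq)
  qed
  from has_hadamard_diff_sequentially[OF F r r0 this]
  have "(\<lambda>k. (F (y k) - F x) /\<^sub>R r k) \<longlonglongrightarrow> 0" by simp
  from tendsto_scaleR[OF r0 this] have "(\<lambda>k. r k *\<^sub>R ((F (y k) - F x) /\<^sub>R r k)) \<longlonglongrightarrow> 0" by simp
  moreover have "r k *\<^sub>R ((F (y k) - F x) /\<^sub>R r k) = F (y k) - F x" for k using r[of k] by simp
  ultimately have "(\<lambda>k. F (y k) - F x) \<longlonglongrightarrow> 0" by simp
  then show "(F \<circ> y) \<longlonglongrightarrow> F x" by (simp add: LIM_zero_iff o_def)
qed

text \<open>
  At a jump let \<open>l\<close> be the left limit of the control. Maximality before \<open>t\<close> gives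
  \<open>h t (u t) \<le> h t l\<close> in the limit, and maximality at \<open>t\<close> gives the reverse inequality, so
  the maximized function does not jump. The terminal instant is reached by the same passage to
  the limit.
\<close>

lemma maximized_along_control:
  fixes h :: "real \<Rightarrow> 'u::t2_space \<Rightarrow> real"
  assumes T: "T > 0" and u: "normal_pc T U S u"
    and h: "continuous_on ({0..T} \<times> U) (\<lambda>(s, z). h s z)"
    and max: "\<And>t z. 0 \<le> t \<Longrightarrow> t < T \<Longrightarrow> z \<in> U \<Longrightarrow> h t z \<le> h t (u t)"
  shows "t \<in> {0..T} \<Longrightarrow> z \<in> U \<Longrightarrow> h t z \<le> h t (u t)"
    and "continuous_on {0..T} (\<lambda>s. h s (u s))"
proof -
  note D = normal_pcD[OF u]
  have h': "continuous_on ({0..T} \<times> UNIV \<times> U) (\<lambda>p. (\<lambda>(s, z). h s z) (fst p, snd (snd p)))"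
    by (rule continuous_on_compose2[OF h]) (auto intro!: continuous_intros)
  have lim: "((\<lambda>s. h s (w s)) \<longlongrightarrow> h t l) F"
    if "F \<le> at t within {0..T}" "t \<in> {0..T}" "(w \<longlongrightarrow> l) F" "l \<in> U" "\<And>s. s \<in> {0..T} \<Longrightarrow> w s \<in> U" for F t w l
    using tendsto_along_control[OF that continuous_on_const[of _ "0::real"] _ h'] by simp
  have before: "h t z \<le> h t l" if t: "0 < t" "t \<le> T" and z: "z \<in> U" and l: "l \<in> U" "(u \<longlongrightarrow> l) (at_left t)" for t z l
  proof (rule tendsto_le)
    show "((\<lambda>s. h s (u s)) \<longlongrightarrow> h t l) (at_left t)"
      using t l D(5) by (intro lim at_left_le_within_Icc) auto
    show "((\<lambda>s. h s z) \<longlongrightarrow> h t z) (at_left t)"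
      using lim[of "at_left t" t "\<lambda>_. z" z] at_left_le_within_Icc[OF t] t z by auto
    have "\<forall>\<^sub>F s in at_left t. s \<in> {0<..<t}" using t(1) by (rule eventually_at_left_real)
    then show "\<forall>\<^sub>F s in at_left t. h s z \<le> h s (u s)" by eventually_elim (use max z t in auto)
  qed simp
  show le: "h t z \<le> h t (u t)" if "t \<in> {0..T}" "z \<in> U" for t z
    using max[of t z] before[of T z "u T"] D(5)[of T] D(9) T that by (cases "t = T") auto
  have left: "((\<lambda>s. h s (u s)) \<longlongrightarrow> h t (u t)) (at_left t)" if t: "0 < t" "t \<le> T" for t
  proof -
    obtain l where l: "l \<in> U" "(u \<longlongrightarrow> l) (at_left t)" using D(8)[OF t] by blast
    have "h t l \<le> h t (u t)" using le l t by auto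
    moreover have "h t (u t) \<le> h t l" using before[OF t _ l] D(5) t by auto
    moreover have "((\<lambda>s. h s (u s)) \<longlongrightarrow> h t l) (at_left t)"
      using t l D(5) by (intro lim at_left_le_within_Icc) auto
    ultimately show ?thesis by simp
  qed
  have right: "((\<lambda>s. h s (u s)) \<longlongrightarrow> h t (u t)) (at_right t)" if t: "0 \<le> t" "t < T" for t
    using t D(5) D(7)[OF t] by (intro lim at_right_le_within_Icc) auto
  show "continuous_on {0..T} (\<lambda>s. h s (u s))"
    unfolding continuous_on_def
  proof
    fix t assume "t \<in> {0..T}"
    then consider "t = 0" | "t = T" | "0 < t" "t < T" by fastforce
    then show "((\<lambda>s. h s (u s)) \<longlongrightarrow> h t (u t)) (at t within {0..T})"
    proof cases
      case 1
      then show ?thesis using right[of 0] T by (simp add: at_within_Icc_at_right)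
    next
      case 2
      then show ?thesis using left[of T] T by (simp add: at_within_Icc_at_left)
    next
      case 3
      then show ?thesis using left[of t] right[of t] by (simp add: at_within_Icc_at filterlim_at_split)
    qed
  qed
qed

section \<open>Reduction to a problem with endpoint cost\<close>

lemma gateaux_tube_lipschitz:
  fixes f :: "real \<Rightarrow> 'a::real_normed_vector \<Rightarrow> 'u::topological_space \<Rightarrow> 'b::real_normed_vector"
  assumes T: "T \<ge> 0" and \<Omega>: "open \<Omega>" and x\<^sub>0: "continuous_on {0..T} x\<^sub>0" "x\<^sub>0 ` {0..T} \<subseteq> \<Omega>"
    and M: "compact M" "M \<subseteq> U"
    and diff: "\<forall>t\<in>{0..T}. \<forall>\<xi>\<in>\<Omega>. \<forall>\<zeta>\<in>U. gateaux_differentiable (\<lambda>\<eta>. f t \<eta> \<zeta>) \<xi>"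
    and bdd: "\<forall>K M. compact K \<and> K \<noteq> {} \<and> K \<subseteq> \<Omega> \<and> compact M \<and> M \<noteq> {} \<and> M \<subseteq> U \<longrightarrow>
           bdd_above ((\<lambda>(t, \<xi>, \<zeta>). norm (D_G (\<lambda>\<eta>. f t \<eta> \<zeta>) \<xi>)) ` ({0..T} \<times> K \<times> M))"
  shows "\<exists>\<rho>>0. \<exists>L>0. \<forall>t\<in>{0..T}. cball (x\<^sub>0 t) \<rho> \<subseteq> \<Omega> \<and>
        (\<forall>\<zeta>\<in>M. \<forall>\<xi>\<in>cball (x\<^sub>0 t) \<rho>. \<forall>\<eta>\<in>cball (x\<^sub>0 t) \<rho>. norm (f t \<xi> \<zeta> - f t \<eta> \<zeta>) \<le> L * norm (\<xi> - \<eta>))"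
proof -
  define V where "V \<xi> = (\<lambda>(t, \<zeta>). norm (D_G (\<lambda>\<eta>. f t \<eta> \<zeta>) \<xi>)) ` ({0..T} \<times> M)" for \<xi>
  have "\<exists>\<rho>>0. \<exists>B>0. \<forall>k\<in>x\<^sub>0 ` {0..T}. \<forall>\<xi>\<in>cball k \<rho>. \<xi> \<in> \<Omega> \<and> (\<forall>v\<in>V \<xi>. v \<le> B)"
  proof (rule bounded_on_tube[OF _ _ x\<^sub>0(2) \<Omega>])
    show "compact (x\<^sub>0 ` {0..T})" using x\<^sub>0(1) by (intro compact_continuous_image) auto
    show "x\<^sub>0 ` {0..T} \<noteq> {}" using T by simp
    fix K' assume K': "compact K'" "K' \<noteq> {}" "K' \<subseteq> \<Omega>"
    show "bdd_above (\<Union>\<xi>\<in>K'. V \<xi>)"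
    proof (cases "M = {}")
      case True
      then show ?thesis by (simp add: V_def)
    next
      case False
      have "(\<Union>\<xi>\<in>K'. V \<xi>) \<subseteq> (\<lambda>(t, \<xi>, \<zeta>). norm (D_G (\<lambda>\<eta>. f t \<eta> \<zeta>) \<xi>)) ` ({0..T} \<times> K' \<times> M)"
        unfolding V_def by force
      then show ?thesis using bdd K' M False by (meson bdd_above_mono)
    qed
  qed
  then obtain \<rho> B where \<rho>: "\<rho> > 0" "B > 0"
    and "\<forall>k\<in>x\<^sub>0 ` {0..T}. \<forall>\<xi>\<in>cball k \<rho>. \<xi> \<in> \<Omega> \<and> (\<forall>v\<in>V \<xi>. v \<le> B)"
    by blast
  then have tube: "\<xi> \<in> \<Omega> \<and> (\<forall>v\<in>V \<xi>. v \<le> B)" if "t \<in> {0..T}" "\<xi> \<in> cball (x\<^sub>0 t) \<rho>" for t \<xi>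
    using that by blast
  have lip: "norm (f t \<xi> \<zeta> - f t \<eta> \<zeta>) \<le> B * norm (\<xi> - \<eta>)"
    if t: "t \<in> {0..T}" and \<zeta>: "\<zeta> \<in> M" and \<xi>: "\<xi> \<in> cball (x\<^sub>0 t) \<rho>" "\<eta> \<in> cball (x\<^sub>0 t) \<rho>" for t \<zeta> \<xi> \<eta>
  proof (rule gateaux_lipschitz[OF convex_cball \<xi>])
    fix y assume y: "y \<in> cball (x\<^sub>0 t) \<rho>"
    show "gateaux_differentiable (\<lambda>\<eta>. f t \<eta> \<zeta>) y" using diff t \<zeta> M tube[OF t y] by blast
    have "norm (D_G (\<lambda>\<eta>. f t \<eta> \<zeta>) y) \<in> V y" using t \<zeta> unfolding V_def by force
    then show "norm (D_G (\<lambda>\<eta>. f t \<eta> \<zeta>) y) \<le> B" using tube[OF t y] by blast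
  qed
  show ?thesis
  proof (rule exI[of _ \<rho>], rule conjI[OF \<rho>(1)], rule exI[of _ B], rule conjI[OF \<rho>(2)], intro ballI conjI)
    fix t assume t: "t \<in> {0..T}"
    show "cball (x\<^sub>0 t) \<rho> \<subseteq> \<Omega>" using tube[OF t] by blast
    fix \<zeta> \<xi> \<eta> assume "\<zeta> \<in> M" "\<xi> \<in> cball (x\<^sub>0 t) \<rho>" "\<eta> \<in> cball (x\<^sub>0 t) \<rho>"
    then show "norm (f t \<xi> \<zeta> - f t \<eta> \<zeta>) \<le> B * norm (\<xi> - \<eta>)" by (rule lip[OF t])
  qed
qed

definition inl_blinfun :: "'a::real_normed_vector \<Rightarrow>\<^sub>L ('a \<times> 'b::real_normed_vector)" where
  "inl_blinfun = Blinfun (\<lambda>x. (x, 0))"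

definition inr_blinfun :: "'b::real_normed_vector \<Rightarrow>\<^sub>L ('a::real_normed_vector \<times> 'b)" where
  "inr_blinfun = Blinfun (\<lambda>y. (0, y))"

lemma inl_blinfun_apply [simp]: "blinfun_apply inl_blinfun x = (x, 0)"
  unfolding inl_blinfun_def
  by (subst bounded_linear_Blinfun_apply) (auto intro!: bounded_linear_Pair bounded_linear_ident bounded_linear_zero)

lemma inr_blinfun_apply [simp]: "blinfun_apply inr_blinfun y = (0, y)"
  unfolding inr_blinfun_def
  by (subst bounded_linear_Blinfun_apply) (auto intro!: bounded_linear_Pair bounded_linear_ident bounded_linear_zero)

text \<open>
  The state derivative of the augmented dynamics: the added coordinate does not influence the
  velocity.
\<close>

definition augmented_blinfun ::
    "('a::real_normed_vector \<Rightarrow>\<^sub>L 'a) \<Rightarrow> ('a \<Rightarrow>\<^sub>L real) \<Rightarrow> ('a \<times> real) \<Rightarrow>\<^sub>L ('a \<times> real)" where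
  "augmented_blinfun D d = (inl_blinfun o\<^sub>L (D o\<^sub>L fst_blinfun)) + (inr_blinfun o\<^sub>L (d o\<^sub>L fst_blinfun))"

lemma augmented_blinfun_apply [simp]:
  "blinfun_apply (augmented_blinfun D d) p = (blinfun_apply D (fst p), blinfun_apply d (fst p))"
  by (simp add: augmented_blinfun_def blinfun.add_left)

lemma has_integral_Pair:
  fixes f :: "real \<Rightarrow> 'a::real_normed_vector" and g :: "real \<Rightarrow> 'b::real_normed_vector"
  assumes "(f has_integral a) S" "(g has_integral b) S"
  shows "((\<lambda>s. (f s, g s)) has_integral (a, b)) S"
proof -
  have 1: "((\<lambda>s. (f s, 0 :: 'b)) has_integral (a, 0)) S"
    using has_integral_linear[OF assms(1) blinfun.bounded_linear_right[of inl_blinfun]] by (simp add: o_def)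
  have 2: "((\<lambda>s. (0 :: 'a, g s)) has_integral (0, b)) S"
    using has_integral_linear[OF assms(2) blinfun.bounded_linear_right[of inr_blinfun]] by (simp add: o_def)
  show ?thesis using has_integral_add[OF 1 2] by simp
qed

text \<open>
  The hypotheses on the dynamics and on the running reward are symmetric and combine to those
  of the augmented dynamics.
\<close>

lemma augmented_controlled_trajectory:
  fixes f :: "real \<Rightarrow> 'a::banach \<Rightarrow> 'u::t2_space \<Rightarrow> 'a" and f0 :: "real \<Rightarrow> 'a \<Rightarrow> 'u \<Rightarrow> real"
  assumes T: "T > 0" and \<Omega>: "open \<Omega>"
    and f0: "continuous_on ({0..T} \<times> \<Omega> \<times> U) (\<lambda>(t, \<xi>, \<zeta>). f0 t \<xi> \<zeta>)"
      "\<forall>t\<in>{0..T}. \<forall>\<xi>\<in>\<Omega>. \<forall>\<zeta>\<in>U. gateaux_differentiable (\<lambda>\<eta>. f0 t \<eta> \<zeta>) \<xi>"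
      "\<forall>t\<in>{0..T}. \<forall>\<zeta>\<in>U. (\<lambda>\<eta>. f0 t \<eta> \<zeta>) differentiable (at (x\<^sub>0 t))"
      "continuous_on ({0..T} \<times> U) (\<lambda>(t, \<zeta>). D_F (\<lambda>\<eta>. f0 t \<eta> \<zeta>) (x\<^sub>0 t))"
      "\<forall>K M. compact K \<and> K \<noteq> {} \<and> K \<subseteq> \<Omega> \<and> compact M \<and> M \<noteq> {} \<and> M \<subseteq> U \<longrightarrow>
           bdd_above ((\<lambda>(t, \<xi>, \<zeta>). norm (D_G (\<lambda>\<eta>. f0 t \<eta> \<zeta>) \<xi>)) ` ({0..T} \<times> K \<times> M))"
    and f: "continuous_on ({0..T} \<times> \<Omega> \<times> U) (\<lambda>(t, \<xi>, \<zeta>). f t \<xi> \<zeta>)"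
      "\<forall>t\<in>{0..T}. \<forall>\<xi>\<in>\<Omega>. \<forall>\<zeta>\<in>U. gateaux_differentiable (\<lambda>\<eta>. f t \<eta> \<zeta>) \<xi>"
      "\<forall>t\<in>{0..T}. \<forall>\<zeta>\<in>U. (\<lambda>\<eta>. f t \<eta> \<zeta>) differentiable (at (x\<^sub>0 t))"
      "continuous_on ({0..T} \<times> U) (\<lambda>(t, \<zeta>). D_F (\<lambda>\<eta>. f t \<eta> \<zeta>) (x\<^sub>0 t))"
      "\<forall>K M. compact K \<and> K \<noteq> {} \<and> K \<subseteq> \<Omega> \<and> compact M \<and> M \<noteq> {} \<and> M \<subseteq> U \<longrightarrow>
           bdd_above ((\<lambda>(t, \<xi>, \<zeta>). norm (D_G (\<lambda>\<eta>. f t \<eta> \<zeta>) \<xi>)) ` ({0..T} \<times> K \<times> M))"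
    and u0: "normal_pc T U S\<^sub>0 u\<^sub>0"
    and x\<^sub>0: "continuous_on {0..T} x\<^sub>0" "x\<^sub>0 ` {0..T} \<subseteq> \<Omega>"
      "\<And>t. t \<in> {0..T} \<Longrightarrow> ((\<lambda>s. f s (x\<^sub>0 s) (u\<^sub>0 s)) has_integral x\<^sub>0 t - x\<^sub>0 0) {0..t}"
  shows "controlled_trajectory T (\<Omega> \<times> UNIV) U (\<lambda>t p \<zeta>. (f t (fst p) \<zeta>, f0 t (fst p) \<zeta>))
    (\<lambda>t \<zeta>. augmented_blinfun (D_F (\<lambda>\<eta>. f t \<eta> \<zeta>) (x\<^sub>0 t)) (D_F (\<lambda>\<eta>. f0 t \<eta> \<zeta>) (x\<^sub>0 t)))
    (\<lambda>t. (x\<^sub>0 t, integral {0..t} (\<lambda>s. f0 s (x\<^sub>0 s) (u\<^sub>0 s)))) u\<^sub>0 S\<^sub>0"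
proof
  have f0_pc: "normal_pc T UNIV S\<^sub>0 (\<lambda>s. f0 s (x\<^sub>0 s) (u\<^sub>0 s))"
    using normal_pc_compose[OF u0 T x\<^sub>0(1,2) f0(1)] by simp
  have f0_int: "(\<lambda>s. f0 s (x\<^sub>0 s) (u\<^sub>0 s)) integrable_on {0..t}" if "t \<in> {0..T}" for t
    using that by (intro normal_pc_integrable[OF f0_pc]) auto
  show "T > 0" by (rule T)
  have fc: "continuous_on ({0..T} \<times> (\<Omega> \<times> UNIV) \<times> U) (\<lambda>q. (\<lambda>(t, \<xi>, \<zeta>). f t \<xi> \<zeta>) (fst q, fst (fst (snd q)), snd (snd q)))"
    by (rule continuous_on_compose2[OF f(1)]) (auto intro!: continuous_intros)
  have f0c: "continuous_on ({0..T} \<times> (\<Omega> \<times> UNIV) \<times> U) (\<lambda>q. (\<lambda>(t, \<xi>, \<zeta>). f0 t \<xi> \<zeta>) (fst q, fst (fst (snd q)), snd (snd q)))"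
    by (rule continuous_on_compose2[OF f0(1)]) (auto intro!: continuous_intros)
  show "continuous_on ({0..T} \<times> (\<Omega> \<times> UNIV) \<times> U) (\<lambda>(t, p, \<zeta>). (f t (fst p) \<zeta>, f0 t (fst p) \<zeta>))"
    using continuous_on_Pair[OF fc f0c] by (simp add: case_prod_beta)
  show "normal_pc T U S\<^sub>0 u\<^sub>0" by (rule u0)
  show "continuous_on {0..T} (\<lambda>t. (x\<^sub>0 t, integral {0..t} (\<lambda>s. f0 s (x\<^sub>0 s) (u\<^sub>0 s))))"
    using T by (intro continuous_on_Pair x\<^sub>0 indefinite_integral_continuous_1 f0_int) auto
  show "(\<lambda>t. (x\<^sub>0 t, integral {0..t} (\<lambda>s. f0 s (x\<^sub>0 s) (u\<^sub>0 s)))) ` {0..T} \<subseteq> \<Omega> \<times> UNIV"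
    using x\<^sub>0(2) by auto
  show "(x\<^sub>0 t, integral {0..t} (\<lambda>s. f0 s (x\<^sub>0 s) (u\<^sub>0 s))) = (x\<^sub>0 0, integral {0..0} (\<lambda>s. f0 s (x\<^sub>0 s) (u\<^sub>0 s))) +
      integral {0..t} (\<lambda>s. (f s (fst (x\<^sub>0 s, integral {0..s} (\<lambda>s. f0 s (x\<^sub>0 s) (u\<^sub>0 s)))) (u\<^sub>0 s),
        f0 s (fst (x\<^sub>0 s, integral {0..s} (\<lambda>s. f0 s (x\<^sub>0 s) (u\<^sub>0 s)))) (u\<^sub>0 s)))" if t: "t \<in> {0..T}" for t
    using integral_unique[OF has_integral_Pair[OF x\<^sub>0(3)[OF t] integrable_integral[OF f0_int[OF t]]]] by simp
  show "((\<lambda>p. (f t (fst p) \<zeta>, f0 t (fst p) \<zeta>)) has_derivative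
      blinfun_apply (augmented_blinfun (D_F (\<lambda>\<eta>. f t \<eta> \<zeta>) (x\<^sub>0 t)) (D_F (\<lambda>\<eta>. f0 t \<eta> \<zeta>) (x\<^sub>0 t))))
      (at (x\<^sub>0 t, integral {0..t} (\<lambda>s. f0 s (x\<^sub>0 s) (u\<^sub>0 s))))" if t: "t \<in> {0..T}" and \<zeta>: "\<zeta> \<in> U" for t \<zeta>
  proof -
    let ?X = "(x\<^sub>0 t, integral {0..t} (\<lambda>s. f0 s (x\<^sub>0 s) (u\<^sub>0 s)))"
    have "((\<lambda>\<eta>. f t \<eta> \<zeta>) has_derivative blinfun_apply (D_F (\<lambda>\<eta>. f t \<eta> \<zeta>) (x\<^sub>0 t))) (at (fst ?X))"
      using f(3) t \<zeta> by (simp add: has_derivative_D_F)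
    from has_derivative_compose[OF has_derivative_fst[OF has_derivative_ident] this]
    have 1: "((\<lambda>p. f t (fst p) \<zeta>) has_derivative (\<lambda>p. blinfun_apply (D_F (\<lambda>\<eta>. f t \<eta> \<zeta>) (x\<^sub>0 t)) (fst p))) (at ?X)" .
    have "((\<lambda>\<eta>. f0 t \<eta> \<zeta>) has_derivative blinfun_apply (D_F (\<lambda>\<eta>. f0 t \<eta> \<zeta>) (x\<^sub>0 t))) (at (fst ?X))"
      using f0(3) t \<zeta> by (simp add: has_derivative_D_F)
    from has_derivative_compose[OF has_derivative_fst[OF has_derivative_ident] this]
    have 2: "((\<lambda>p. f0 t (fst p) \<zeta>) has_derivative (\<lambda>p. blinfun_apply (D_F (\<lambda>\<eta>. f0 t \<eta> \<zeta>) (x\<^sub>0 t)) (fst p))) (at ?X)" .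
    show ?thesis using has_derivative_Pair[OF 1 2] by (simp add: augmented_blinfun_apply[abs_def])
  qed
  show "continuous_on ({0..T} \<times> U)
      (\<lambda>(t, \<zeta>). augmented_blinfun (D_F (\<lambda>\<eta>. f t \<eta> \<zeta>) (x\<^sub>0 t)) (D_F (\<lambda>\<eta>. f0 t \<eta> \<zeta>) (x\<^sub>0 t)))"
    using f(4) f0(4) unfolding augmented_blinfun_def case_prod_beta
    by (intro continuous_on_add bounded_bilinear.continuous_on[OF bounded_bilinear_blinfun_compose] continuous_on_const)
  show "\<exists>\<rho>>0. \<exists>L>0. \<forall>t\<in>{0..T}. cball (x\<^sub>0 t, integral {0..t} (\<lambda>s. f0 s (x\<^sub>0 s) (u\<^sub>0 s))) \<rho> \<subseteq> \<Omega> \<times> UNIV \<and>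
      (\<forall>\<zeta>\<in>M. \<forall>\<xi>\<in>cball (x\<^sub>0 t, integral {0..t} (\<lambda>s. f0 s (x\<^sub>0 s) (u\<^sub>0 s))) \<rho>.
        \<forall>\<eta>\<in>cball (x\<^sub>0 t, integral {0..t} (\<lambda>s. f0 s (x\<^sub>0 s) (u\<^sub>0 s))) \<rho>.
        norm ((f t (fst \<xi>) \<zeta>, f0 t (fst \<xi>) \<zeta>) - (f t (fst \<eta>) \<zeta>, f0 t (fst \<eta>) \<zeta>)) \<le> L * norm (\<xi> - \<eta>))"
    if M: "compact M" "M \<subseteq> U" for M
  proof -
    obtain \<rho>1 L1 where 1: "\<rho>1 > 0" "L1 > 0" "\<And>t. t \<in> {0..T} \<Longrightarrow> cball (x\<^sub>0 t) \<rho>1 \<subseteq> \<Omega>"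
      "\<And>t \<zeta> \<xi> \<eta>. t \<in> {0..T} \<Longrightarrow> \<zeta> \<in> M \<Longrightarrow> \<xi> \<in> cball (x\<^sub>0 t) \<rho>1 \<Longrightarrow> \<eta> \<in> cball (x\<^sub>0 t) \<rho>1 \<Longrightarrow>
        norm (f t \<xi> \<zeta> - f t \<eta> \<zeta>) \<le> L1 * norm (\<xi> - \<eta>)"
      using gateaux_tube_lipschitz[OF less_imp_le[OF T] \<Omega> x\<^sub>0(1,2) M f(2,5)] by blast
    obtain \<rho>2 L2 where 2: "\<rho>2 > 0" "L2 > 0"
      "\<And>t \<zeta> \<xi> \<eta>. t \<in> {0..T} \<Longrightarrow> \<zeta> \<in> M \<Longrightarrow> \<xi> \<in> cball (x\<^sub>0 t) \<rho>2 \<Longrightarrow> \<eta> \<in> cball (x\<^sub>0 t) \<rho>2 \<Longrightarrow>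
        norm (f0 t \<xi> \<zeta> - f0 t \<eta> \<zeta>) \<le> L2 * norm (\<xi> - \<eta>)"
      using gateaux_tube_lipschitz[OF less_imp_le[OF T] \<Omega> x\<^sub>0(1,2) M f0(2,5)] by blast
    have fst_ball: "fst p \<in> cball (x\<^sub>0 t) \<rho>1" "fst p \<in> cball (x\<^sub>0 t) \<rho>2"
      if "p \<in> cball (x\<^sub>0 t, y) (min \<rho>1 \<rho>2)" for p :: "'a \<times> real" and t y
    proof -
      have "dist (x\<^sub>0 t) (fst p) \<le> dist (x\<^sub>0 t, y) p" using dist_fst_le[of "(x\<^sub>0 t, y)" p] by simp
      then show "fst p \<in> cball (x\<^sub>0 t) \<rho>1" "fst p \<in> cball (x\<^sub>0 t) \<rho>2" using that by auto
    qed
    have pos: "0 < min \<rho>1 \<rho>2" "0 < L1 + L2" using 1(1,2) 2(1,2) by auto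
    show ?thesis
    proof (rule exI[of _ "min \<rho>1 \<rho>2"], rule conjI[OF pos(1)], rule exI[of _ "L1 + L2"],
        rule conjI[OF pos(2)], intro ballI conjI)
      fix t assume t: "t \<in> {0..T}"
      let ?X = "(x\<^sub>0 t, integral {0..t} (\<lambda>s. f0 s (x\<^sub>0 s) (u\<^sub>0 s)))"
      show "cball ?X (min \<rho>1 \<rho>2) \<subseteq> \<Omega> \<times> UNIV"
      proof
        fix p assume "p \<in> cball ?X (min \<rho>1 \<rho>2)"
        then have "fst p \<in> \<Omega>" using fst_ball(1) 1(3)[OF t] by blast
        then show "p \<in> \<Omega> \<times> UNIV" by (simp add: mem_Times_iff)
      qed
      fix \<zeta> p r assume \<zeta>: "\<zeta> \<in> M" and p: "p \<in> cball ?X (min \<rho>1 \<rho>2)" and r: "r \<in> cball ?X (min \<rho>1 \<rho>2)"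
      have "norm ((f t (fst p) \<zeta>, f0 t (fst p) \<zeta>) - (f t (fst r) \<zeta>, f0 t (fst r) \<zeta>))
          \<le> norm (f t (fst p) \<zeta> - f t (fst r) \<zeta>) + norm (f0 t (fst p) \<zeta> - f0 t (fst r) \<zeta>)"
        using norm_Pair_le[of "f t (fst p) \<zeta> - f t (fst r) \<zeta>" "f0 t (fst p) \<zeta> - f0 t (fst r) \<zeta>"] by simp
      also have "\<dots> \<le> L1 * norm (fst p - fst r) + L2 * norm (fst p - fst r)"
        by (intro add_mono 1(4)[OF t \<zeta>] 2(3)[OF t \<zeta>] fst_ball[OF p] fst_ball[OF r])
      also have "\<dots> = (L1 + L2) * norm (fst (p - r))" by (simp add: distrib_right)
      also have "\<dots> \<le> (L1 + L2) * norm (p - r)" 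
        by (rule mult_left_mono[OF norm_fst_le[of "fst (p - r)" "snd (p - r)", unfolded prod.collapse]])
          (use 1(2) 2(2) in simp)
      finally show "norm ((f t (fst p) \<zeta>, f0 t (fst p) \<zeta>) - (f t (fst r) \<zeta>, f0 t (fst r) \<zeta>)) \<le> (L1 + L2) * norm (p - r)" .
    qed
  qed
qed

lemma PC1_I:
  assumes "continuous_on {0..T} x" "x ` {0..T} \<subseteq> W" "PC1_subdivision T x S"
  shows "x \<in> PC1 T W"
  using assms unfolding PC1_def by blast

lemma augmented_trajectory_admissible:
  fixes f :: "real \<Rightarrow> 'a::banach \<Rightarrow> 'u::t2_space \<Rightarrow> 'a" and f0 :: "real \<Rightarrow> 'a \<Rightarrow> 'u \<Rightarrow> real"
  assumes T: "T > 0" and u: "normal_pc T U S u"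
    and f: "continuous_on ({0..T} \<times> \<Omega> \<times> U) (\<lambda>(t, \<xi>, \<zeta>). f t \<xi> \<zeta>)"
    and f0: "continuous_on ({0..T} \<times> \<Omega> \<times> U) (\<lambda>(t, \<xi>, \<zeta>). f0 t \<xi> \<zeta>)"
    and X: "continuous_on {0..T} X" "X ` {0..T} \<subseteq> \<Omega> \<times> UNIV"
      "\<And>t. t \<in> {0..T} \<Longrightarrow> X t = (\<xi>0, 0) + integral {0..t} (\<lambda>s. (f s (fst (X s)) (u s), f0 s (fst (X s)) (u s)))"
  shows "(\<lambda>t. fst (X t)) \<in> PC1 T \<Omega>" "fst (X 0) = \<xi>0"
    "t \<in> {0..T} \<Longrightarrow> ext_deriv T (\<lambda>t. fst (X t)) t = f t (fst (X t)) (u t)"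
    "snd (X T) = integral {0..T} (\<lambda>t. f0 t (fst (X t)) (u t))"
proof -
  let ?x = "\<lambda>t. fst (X t)"
  have x: "continuous_on {0..T} ?x" "?x ` {0..T} \<subseteq> \<Omega>"
    using X(2) by (auto intro!: continuous_intros X(1))
  have f_pc: "normal_pc T UNIV S (\<lambda>s. f s (?x s) (u s))" using normal_pc_compose[OF u T x f] by simp
  have f0_pc: "normal_pc T UNIV S (\<lambda>s. f0 s (?x s) (u s))" using normal_pc_compose[OF u T x f0] by simp
  have X_eq: "X t = (\<xi>0 + integral {0..t} (\<lambda>s. f s (?x s) (u s)), integral {0..t} (\<lambda>s. f0 s (?x s) (u s)))"
    if t: "t \<in> {0..T}" for t
  proof -
    have "(\<lambda>s. f s (?x s) (u s)) integrable_on {0..t}" "(\<lambda>s. f0 s (?x s) (u s)) integrable_on {0..t}"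
      using t by (auto intro!: normal_pc_integrable[OF f_pc] normal_pc_integrable[OF f0_pc])
    from integral_unique[OF has_integral_Pair[OF this[THEN integrable_integral]]] X(3)[OF t]
    show ?thesis by simp
  qed
  show start: "fst (X 0) = \<xi>0" using X_eq[of 0] T by simp
  have x_eq: "?x t = ?x 0 + integral {0..t} (\<lambda>s. f s (?x s) (u s))" if "t \<in> {0..T}" for t
    using X_eq[OF that] start by simp
  note prim = primitive_of_normal_pc[where x = ?x, OF f_pc T x_eq]
  show "?x \<in> PC1 T \<Omega>" using PC1_I[OF x prim(2)] by blast
  show "t \<in> {0..T} \<Longrightarrow> ext_deriv T ?x t = f t (?x t) (u t)" using prim(3) by blast
  show "snd (X T) = integral {0..T} (\<lambda>t. f0 t (?x t) (u t))" using X_eq[of T] T by simp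
qed

text \<open>
  The vector \<open>(0, 1)\<close> is annihilated by the augmented derivative, hence fixed by \<open>P t\<close>; so the
  second component of the costate is the constant \<open>\<nu>\<close>, and the first component satisfies
  the adjoint equation with \<open>\<nu>\<close> as the weight of the running reward.
\<close>

lemma costate_equation:
  fixes P :: "real \<Rightarrow> ('a::banach \<times> real) \<Rightarrow>\<^sub>L ('a \<times> real)" and \<pi> :: "('a \<times> real) \<Rightarrow>\<^sub>L real"
  assumes T: "T > 0" and P: "continuous_on {0..T} P" "P T = id_blinfun"
      "\<And>t. t \<in> {0..T} \<Longrightarrow> P t = P 0 + integral {0..t} (\<lambda>s. - (P s o\<^sub>L augmented_blinfun (D s) (d s)))"
    and reg: "\<And>Q :: real \<Rightarrow> ('a \<times> real) \<Rightarrow>\<^sub>L ('a \<times> real). continuous_on {0..T} Q \<Longrightarrow>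
        (\<lambda>s. - (Q s o\<^sub>L augmented_blinfun (D s) (d s))) integrable_on {0..T}"
    and p: "p = (\<lambda>t. (\<pi> o\<^sub>L P t) o\<^sub>L inl_blinfun)" and \<nu>: "\<nu> = blinfun_apply \<pi> (0, 1)" and t: "t \<in> {0..T}"
  shows "blinfun_apply \<pi> (blinfun_apply (P t) (v, c)) = blinfun_apply (p t) v + c * \<nu>"
    and "p t = p 0 + integral {0..t} (\<lambda>s. - ((p s o\<^sub>L D s) + \<nu> *\<^sub>R d s))"
proof -
  have int: "((\<lambda>s. - (P s o\<^sub>L augmented_blinfun (D s) (d s))) has_integral P t - P 0) {0..t}" if t: "t \<in> {0..T}" for t
  proof -
    have "(\<lambda>s. - (P s o\<^sub>L augmented_blinfun (D s) (d s))) integrable_on {0..t}"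
      by (rule integrable_on_subinterval[OF reg[OF P(1)]]) (use t in auto)
    then show ?thesis using P(3)[OF t] by (simp add: has_integral_integral)
  qed
  have const: "blinfun_apply (P t) (0, 1) = (0, 1)" if t: "t \<in> {0..T}" for t
  proof -
    have eq: "blinfun_apply (P r) (0, 1) = blinfun_apply (P 0) (0, 1)" if r: "r \<in> {0..T}" for r
    proof -
      have zero: "blinfun_apply (- (P s o\<^sub>L augmented_blinfun (D s) (d s))) (0, 1) = 0" for s
        by (simp add: blinfun.minus_left flip: zero_prod_def)
      have "((\<lambda>s. blinfun_apply (- (P s o\<^sub>L augmented_blinfun (D s) (d s))) (0, 1)) has_integral
          blinfun_apply (P r - P 0) (0, 1)) {0..r}"
        using has_integral_linear[OF int[OF r] blinfun.bounded_linear_left[of "(0, 1)"]] by (simp add: o_def)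
      then have "((\<lambda>s. 0) has_integral blinfun_apply (P r - P 0) (0, 1)) {0..r}" unfolding zero .
      from has_integral_unique[OF this has_integral_0] show ?thesis by (simp add: blinfun.diff_left)
    qed
    show ?thesis using eq[OF t] eq[of T] P(2) T by simp
  qed
  have split: "blinfun_apply \<pi> (blinfun_apply (P s) (v, c)) = blinfun_apply (p s) v + c * \<nu>"
    if s: "s \<in> {0..T}" for s v c
  proof -
    have "blinfun_apply \<pi> (blinfun_apply (P s) ((v, 0) + c *\<^sub>R (0, 1)))
        = blinfun_apply \<pi> (blinfun_apply (P s) (v, 0)) + c *\<^sub>R blinfun_apply \<pi> (blinfun_apply (P s) (0, 1))"
      by (simp only: blinfun.add_right blinfun.scaleR_right)
    moreover have "(v, 0) + c *\<^sub>R (0, 1) = (v, c)" by simp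
    moreover have "blinfun_apply \<pi> (blinfun_apply (P s) (v, 0)) = blinfun_apply (p s) v" by (simp add: p)
    ultimately show ?thesis by (simp only: const[OF s] \<nu> real_scaleR_def)
  qed
  then show "blinfun_apply \<pi> (blinfun_apply (P t) (v, c)) = blinfun_apply (p t) v + c * \<nu>" using t by blast
  have lin: "bounded_linear (\<lambda>Q :: ('a \<times> real) \<Rightarrow>\<^sub>L ('a \<times> real). (\<pi> o\<^sub>L Q) o\<^sub>L (inl_blinfun :: 'a \<Rightarrow>\<^sub>L _))"
    by (intro bounded_linear_compose[OF bounded_bilinear.bounded_linear_left[OF bounded_bilinear_blinfun_compose]
          bounded_bilinear.bounded_linear_right[OF bounded_bilinear_blinfun_compose]])
  have image: "((\<lambda>s. (\<pi> o\<^sub>L (- (P s o\<^sub>L augmented_blinfun (D s) (d s)))) o\<^sub>L inl_blinfun) has_integral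
      (\<pi> o\<^sub>L (P t - P 0)) o\<^sub>L inl_blinfun) {0..t}"
    using has_integral_linear[OF int[OF t] lin] by (simp add: o_def)
  have endpoint: "(\<pi> o\<^sub>L (P t - P 0)) o\<^sub>L inl_blinfun = p t - p 0"
    unfolding p by (rule blinfun_eqI) (simp add: blinfun.diff_left blinfun.diff_right)
  have integrand: "(\<pi> o\<^sub>L (- (P s o\<^sub>L augmented_blinfun (D s) (d s)))) o\<^sub>L inl_blinfun = - ((p s o\<^sub>L D s) + \<nu> *\<^sub>R d s)"
    if "s \<in> {0..t}" for s
  proof (rule blinfun_eqI)
    fix v
    have "s \<in> {0..T}" using that t by auto
    from split[OF this, of "blinfun_apply (D s) v" "blinfun_apply (d s) v"]
    show "blinfun_apply ((\<pi> o\<^sub>L (- (P s o\<^sub>L augmented_blinfun (D s) (d s)))) o\<^sub>L inl_blinfun) v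
        = blinfun_apply (- ((p s o\<^sub>L D s) + \<nu> *\<^sub>R d s)) v"
      by (simp add: blinfun.minus_left blinfun.minus_right blinfun.add_left blinfun.diff_left blinfun.scaleR_left mult.commute)
  qed
  have "((\<lambda>s. - ((p s o\<^sub>L D s) + \<nu> *\<^sub>R d s)) has_integral p t - p 0) {0..t}"
    by (rule has_integral_eq[OF integrand image[unfolded endpoint]])
  then show "p t = p 0 + integral {0..t} (\<lambda>s. - ((p s o\<^sub>L D s) + \<nu> *\<^sub>R d s))"
    by (simp add: integral_unique)
qed

theorem theorem2p1:
  fixes T :: real and \<Omega> :: "'a::banach set" and \<xi>0 :: 'a and U :: "'u::t2_space set"
    and m q :: nat
    and f :: "real \<Rightarrow> 'a \<Rightarrow> 'u \<Rightarrow> 'a" and f0 :: "real \<Rightarrow> 'a \<Rightarrow> 'u \<Rightarrow> real"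
    and g h :: "nat \<Rightarrow> 'a \<Rightarrow> real"
    and x0 :: "real \<Rightarrow> 'a" and u0 :: "real \<Rightarrow> 'u"
  assumes "T > 0" and "open \<Omega>" and "\<Omega> \<noteq> {}" and "\<xi>0 \<in> \<Omega>" and "m \<ge> 1" and "q \<ge> 1"
    and "bolza_solution T \<Omega> U \<xi>0 f f0 m g q h x0 u0"
    and "continuous_on ({0..T} \<times> \<Omega> \<times> U) (\<lambda>(t, \<xi>, \<zeta>). f0 t \<xi> \<zeta>)"
    and "\<forall>t\<in>{0..T}. \<forall>\<xi>\<in>\<Omega>. \<forall>\<zeta>\<in>U. gateaux_differentiable (\<lambda>\<eta>. f0 t \<eta> \<zeta>) \<xi>"
    and "\<forall>t\<in>{0..T}. \<forall>\<zeta>\<in>U. (\<lambda>\<eta>. f0 t \<eta> \<zeta>) differentiable (at (x0 t))"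
    and "continuous_on ({0..T} \<times> U) (\<lambda>(t, \<zeta>). D_F (\<lambda>\<eta>. f0 t \<eta> \<zeta>) (x0 t))"
    and "\<forall>K M. compact K \<and> K \<noteq> {} \<and> K \<subseteq> \<Omega> \<and> compact M \<and> M \<noteq> {} \<and> M \<subseteq> U \<longrightarrow>
           bdd_above ((\<lambda>(t, \<xi>, \<zeta>). norm (D_G (\<lambda>\<eta>. f0 t \<eta> \<zeta>) \<xi>)) ` ({0..T} \<times> K \<times> M))"
    and "continuous_on ({0..T} \<times> \<Omega> \<times> U) (\<lambda>(t, \<xi>, \<zeta>). f t \<xi> \<zeta>)"
    and "\<forall>t\<in>{0..T}. \<forall>\<xi>\<in>\<Omega>. \<forall>\<zeta>\<in>U. gateaux_differentiable (\<lambda>\<eta>. f t \<eta> \<zeta>) \<xi>"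
    and "\<forall>t\<in>{0..T}. \<forall>\<zeta>\<in>U. (\<lambda>\<eta>. f t \<eta> \<zeta>) differentiable (at (x0 t))"
    and "continuous_on ({0..T} \<times> U) (\<lambda>(t, \<zeta>). D_F (\<lambda>\<eta>. f t \<eta> \<zeta>) (x0 t))"
    and "\<forall>K M. compact K \<and> K \<noteq> {} \<and> K \<subseteq> \<Omega> \<and> compact M \<and> M \<noteq> {} \<and> M \<subseteq> U \<longrightarrow>
           bdd_above ((\<lambda>(t, \<xi>, \<zeta>). norm (D_G (\<lambda>\<eta>. f t \<eta> \<zeta>) \<xi>)) ` ({0..T} \<times> K \<times> M))"
    and "\<forall>\<alpha>\<in>{0..m}. hadamard_differentiable (g \<alpha>) (x0 T)"
    and "\<forall>\<beta>\<in>{1..q}. (\<exists>V. open V \<and> x0 T \<in> V \<and> V \<subseteq> \<Omega> \<and> continuous_on V (h \<beta>)) \<and>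
           hadamard_differentiable (h \<beta>) (x0 T)"
  shows "\<exists>(l :: nat \<Rightarrow> real) (\<mu> :: nat \<Rightarrow> real) (p :: real \<Rightarrow> 'a \<Rightarrow>\<^sub>L real).
    p \<in> PC1 T UNIV \<and>
    ((\<exists>\<alpha>\<in>{0..m}. l \<alpha> \<noteq> 0) \<or> (\<exists>\<beta>\<in>{1..q}. \<mu> \<beta> \<noteq> 0)) \<and>
    (\<forall>\<alpha>\<in>{0..m}. l \<alpha> \<ge> 0) \<and>
    (\<forall>\<alpha>\<in>{1..m}. l \<alpha> * g \<alpha> (x0 T) = 0) \<and>
    (\<Sum>\<alpha>=0..m. l \<alpha> *\<^sub>R D_H (g \<alpha>) (x0 T)) + (\<Sum>\<beta>=1..q. \<mu> \<beta> *\<^sub>R D_H (h \<beta>) (x0 T)) = p T \<and>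
    (\<forall>t\<in>{0..T}. ext_deriv T p t = - D_F (\<lambda>\<eta>. H_B f0 f t \<eta> (u0 t) (p t) (l 0)) (x0 t)) \<and>
    (\<forall>t\<in>{0..T}. \<forall>\<zeta>\<in>U.
       H_B f0 f t (x0 t) (u0 t) (p t) (l 0) \<ge> H_B f0 f t (x0 t) \<zeta> (p t) (l 0)) \<and>
    continuous_on {0..T} (\<lambda>t. H_B f0 f t (x0 t) (u0 t) (p t) (l 0))"
proof -
  note T = assms(1) and \<Omega> = assms(2) and sol = assms(7) and f0 = assms(8-12) and f = assms(13-17)
    and g_diff = assms(18) and h_diff = assms(19)
  have adm: "bolza_admissible T \<Omega> U \<xi>0 f m g q h x0 u0"
    and opt: "\<And>x u. bolza_admissible T \<Omega> U \<xi>0 f m g q h x u \<Longrightarrow>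
        bolza_objective T f0 g x u \<le> bolza_objective T f0 g x0 u0"
    using sol by (auto simp: bolza_solution_def)
  have x0_PC1: "x0 \<in> PC1 T \<Omega>" and u0_NPC: "u0 \<in> NPC0_R T U" and x0_start: "x0 0 = \<xi>0"
    and x0_ode: "\<And>t. t \<in> {0..T} \<Longrightarrow> ext_deriv T x0 t = f t (x0 t) (u0 t)"
    and g_x0: "\<And>\<alpha>. \<alpha> \<in> {1..m} \<Longrightarrow> g \<alpha> (x0 T) \<ge> 0" and h_x0: "\<And>\<beta>. \<beta> \<in> {1..q} \<Longrightarrow> h \<beta> (x0 T) = 0"
    using adm by (auto simp: bolza_admissible_def)
  have x0: "continuous_on {0..T} x0" "x0 ` {0..T} \<subseteq> \<Omega>" using x0_PC1 by (auto simp: PC1_def)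
  obtain S0 where u0: "normal_pc T U S0 u0" using u0_NPC NPC0_R_iff_normal_pc[OF T] by blast
  define Df where "Df t \<zeta> = D_F (\<lambda>\<eta>. f t \<eta> \<zeta>) (x0 t)" for t \<zeta>
  define Df0 where "Df0 t \<zeta> = D_F (\<lambda>\<eta>. f0 t \<eta> \<zeta>) (x0 t)" for t \<zeta>
  define F where "F t p \<zeta> = (f t (fst p) \<zeta>, f0 t (fst p) \<zeta>)" for t and p :: "'a \<times> real" and \<zeta>
  define A where "A t \<zeta> = augmented_blinfun (Df t \<zeta>) (Df0 t \<zeta>)" for t \<zeta>
  define X0 where "X0 t = (x0 t, integral {0..t} (\<lambda>s. f0 s (x0 s) (u0 s)))" for t
  have X0_start: "X0 0 = (\<xi>0, 0)" by (simp add: X0_def x0_start)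
  have fst_X0 [simp]: "fst (X0 t) = x0 t" for t by (simp add: X0_def)
  interpret ct: controlled_trajectory T "\<Omega> \<times> UNIV" U F A X0 u0 S0
    using augmented_controlled_trajectory[OF T \<Omega> f0 f u0 x0 PC1_integral_ext_deriv[OF T x0_PC1 x0_ode]]
    unfolding F_def[abs_def] A_def[abs_def] X0_def[abs_def] Df_def[abs_def] Df0_def[abs_def] .
  obtain P where P: "continuous_on {0..T} P" "P T = id_blinfun"
    "\<And>t. t \<in> {0..T} \<Longrightarrow> P t = P 0 + integral {0..t} (\<lambda>s. - (P s o\<^sub>L A s (u0 s)))"
    using ct.transition_operator by blast
  define Y where "Y = (\<lambda>(t, z). blinfun_apply (P t) (F t (X0 t) z - F t (X0 t) (u0 t)))"
  define R where "R = {X T |X u. ct.trajectory X u}"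
  have family: "\<exists>\<delta>>0. \<exists>e. endpoint_map J Y R (X0 T) \<delta> e" if "finite J" "J \<subseteq> {0..<T} \<times> U" for J
    unfolding Y_def R_def by (rule ct.endpoint_variation[OF P that])
  define I where "I = insert 0 {\<alpha>\<in>{1..m}. g \<alpha> (x0 T) = 0}"
  have I: "finite I" "I \<subseteq> {0..m}" by (auto simp: I_def)
  define \<phi> where "\<phi> i p = (if i = 0 then snd p else 0) + g i (fst p)" for i :: nat and p :: "'a \<times> real"
  define D\<phi> where "D\<phi> i = (if i = 0 then snd_blinfun else 0) + (D_H (g i) (x0 T) o\<^sub>L fst_blinfun)" for i :: nat
  define \<psi> where "\<psi> i p = h (Suc i) (fst p)" for i and p :: "'a \<times> real"
  define D\<psi> where "D\<psi> i = (D_H (h (Suc i)) (x0 T) o\<^sub>L fst_blinfun :: ('a \<times> real) \<Rightarrow>\<^sub>L real)" for i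
  have g_had: "has_hadamard_diff (g i) (D_H (g i) (x0 T)) (x0 T)" if "i \<in> {0..m}" for i
    using g_diff that D_H_eq unfolding hadamard_differentiable_def by metis
  have h_had: "has_hadamard_diff (h i) (D_H (h i) (x0 T)) (x0 T)" if "i \<in> {1..q}" for i
    using h_diff that D_H_eq unfolding hadamard_differentiable_def by metis
  have d\<phi>: "has_hadamard_diff (\<phi> i) (D\<phi> i) (X0 T)" if "i \<in> I" for i
  proof -
    have "has_hadamard_diff (\<lambda>p. blinfun_apply (if i = 0 then snd_blinfun else 0) p + g i (blinfun_apply fst_blinfun p)) (D\<phi> i) (X0 T)"
      unfolding D\<phi>_def using g_had[of i] that I(2)
      by (intro has_hadamard_diff_add has_hadamard_diff_blinfun has_hadamard_diff_compose_blinfun) auto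
    moreover have "\<phi> i = (\<lambda>p. blinfun_apply (if i = 0 then snd_blinfun else 0) p + g i (blinfun_apply fst_blinfun p))"
      by (auto simp: \<phi>_def)
    ultimately show ?thesis by simp
  qed
  have d\<psi>: "has_hadamard_diff (\<psi> i) (D\<psi> i) (X0 T)" if "i < q" for i
  proof -
    have "has_hadamard_diff (\<lambda>p. h (Suc i) (blinfun_apply fst_blinfun p)) (D\<psi> i) (X0 T)"
      unfolding D\<psi>_def using h_had[of "Suc i"] that by (intro has_hadamard_diff_compose_blinfun) auto
    then show ?thesis by (simp add: \<psi>_def[abs_def])
  qed
  have "\<exists>V. \<beta> \<in> {1..q} \<longrightarrow> open V \<and> x0 T \<in> V \<and> continuous_on V (h \<beta>)" for \<beta>
    using h_diff by blast
  then obtain Vh where Vh: "\<And>\<beta>. \<beta> \<in> {1..q} \<Longrightarrow> open (Vh \<beta>) \<and> x0 T \<in> Vh \<beta> \<and> continuous_on (Vh \<beta>) (h \<beta>)"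
    by metis
  have "\<exists>V. \<alpha> \<in> {1..m} - I \<longrightarrow> open V \<and> x0 T \<in> V \<and> (\<forall>y\<in>V. g \<alpha> y > 0)" for \<alpha>
  proof (cases "\<alpha> \<in> {1..m} - I")
    case True
    then have "g \<alpha> (x0 T) > 0" using g_x0[of \<alpha>] by (auto simp: I_def less_le)
    moreover have "(g \<alpha> \<longlongrightarrow> g \<alpha> (x0 T)) (nhds (x0 T))"
      using has_hadamard_diff_isCont[OF g_had[of \<alpha>]] True by (simp add: isCont_def tendsto_at_iff_tendsto_nhds)
    ultimately have "\<forall>\<^sub>F y in nhds (x0 T). g \<alpha> y > 0" by (rule order_tendstoD(1)[rotated])
    then show ?thesis unfolding eventually_nhds by blast
  qed blast
  then obtain Vg where Vg: "\<And>\<alpha>. \<alpha> \<in> {1..m} - I \<Longrightarrow> open (Vg \<alpha>) \<and> x0 T \<in> Vg \<alpha> \<and> (\<forall>y\<in>Vg \<alpha>. g \<alpha> y > 0)"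
    by metis
  \<comment> \<open>near \<open>x0 T\<close> the inactive inequality constraints hold
    automatically\<close>
  define W where "W = (\<Inter>\<beta>\<in>{1..q}. Vh \<beta>) \<inter> (\<Inter>\<alpha>\<in>{1..m} - I. Vg \<alpha>)"
  have W: "open W" "x0 T \<in> W" unfolding W_def using Vh Vg by (auto intro!: open_Int open_INT)
  have W_V: "open (W \<times> (UNIV :: real set))" "X0 T \<in> W \<times> UNIV" using W by (auto simp: open_Times X0_def)
  have \<psi>_cont: "continuous_on (W \<times> UNIV) (\<psi> i)" if "i < q" for i
  proof -
    have cont: "continuous_on (Vh (Suc i)) (h (Suc i))" and sub: "W \<subseteq> Vh (Suc i)"
      using Vh[of "Suc i"] that by (auto simp: W_def)
    have "continuous_on (W \<times> UNIV) (\<lambda>p :: 'a \<times> real. h (Suc i) (fst p))"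
      by (rule continuous_on_compose2[OF cont continuous_on_fst[OF continuous_on_id]]) (use sub in auto)
    then show ?thesis unfolding \<psi>_def .
  qed
  \<comment>
    \<open>optimality, seen from the endpoints: close to the optimal one no endpoint improves all of the functions\<close>
  have no_better: False
    if X: "e \<in> R \<inter> (W \<times> UNIV)" and better: "\<forall>i\<in>I. \<phi> i e > \<phi> i (X0 T)" and eq: "\<forall>i<q. \<psi> i e = \<psi> i (X0 T)" for e
  proof -
    obtain X u where e: "e = X T" and traj: "ct.trajectory X u" using X by (auto simp: R_def)
    obtain S where u: "normal_pc T U S u" using traj by (auto simp: ct.trajectory_def)
    have X': "continuous_on {0..T} X" "X ` {0..T} \<subseteq> \<Omega> \<times> UNIV"
      "\<And>t. t \<in> {0..T} \<Longrightarrow> X t = (\<xi>0, 0) + integral {0..t} (\<lambda>s. (f s (fst (X s)) (u s), f0 s (fst (X s)) (u s)))"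
      using traj X0_start by (auto simp: ct.trajectory_def F_def)
    note x = augmented_trajectory_admissible[OF T u f(1) f0(1) X']
    have WX: "fst (X T) \<in> W" using X e by auto
    have "g \<alpha> (fst (X T)) \<ge> 0" if \<alpha>: "\<alpha> \<in> {1..m}" for \<alpha>
    proof (cases "\<alpha> \<in> I")
      case True
      then show ?thesis using better \<alpha> e by (auto simp: I_def \<phi>_def less_imp_le)
    next
      case False
      then show ?thesis using Vg[of \<alpha>] WX \<alpha> by (auto simp: W_def less_imp_le)
    qed
    moreover have "h \<beta> (fst (X T)) = 0" if \<beta>: "\<beta> \<in> {1..q}" for \<beta>
    proof -
      obtain i where i: "\<beta> = Suc i" "i < q" using \<beta> by (cases \<beta>) auto
      then show ?thesis using eq e h_x0[OF \<beta>] by (auto simp: \<psi>_def)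
    qed
    moreover have "u \<in> NPC0_R T U" using NPC0_R_iff_normal_pc[OF T] u by blast
    ultimately have "bolza_admissible T \<Omega> U \<xi>0 f m g q h (\<lambda>t. fst (X t)) u"
      unfolding bolza_admissible_def using x by auto
    from opt[OF this] have "snd (X T) + g 0 (fst (X T)) \<le> snd (X0 T) + g 0 (x0 T)"
      using x(4) by (simp add: bolza_objective_def X0_def)
    moreover have "snd (X T) + g 0 (fst (X T)) > snd (X0 T) + g 0 (x0 T)"
      using better e by (auto simp: I_def \<phi>_def)
    ultimately show False by simp
  qed
  have "\<exists>l' \<mu>'. ((\<exists>i\<in>I. l' i \<noteq> 0) \<or> (\<exists>i<q. \<mu>' i \<noteq> 0)) \<and> (\<forall>i\<in>I. 0 \<le> l' i) \<and>
    (\<forall>n\<in>{0..<T} \<times> U. (\<Sum>i\<in>I. l' i * blinfun_apply (D\<phi> i) (Y n)) + (\<Sum>i<q. \<mu>' i * blinfun_apply (D\<psi> i) (Y n)) \<le> 0)"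
    by (rule multiplier_rule[where \<phi> = \<phi> and \<psi> = \<psi> and q = q, OF I(1) family d\<phi> d\<psi> W_V \<psi>_cont no_better])
  then obtain l' \<mu>' where multipliers: "((\<exists>i\<in>I. l' i \<noteq> 0) \<or> (\<exists>i<q. \<mu>' i \<noteq> 0)) \<and> (\<forall>i\<in>I. 0 \<le> l' i) \<and>
    (\<forall>n\<in>{0..<T} \<times> U. (\<Sum>i\<in>I. l' i * blinfun_apply (D\<phi> i) (Y n)) + (\<Sum>i<q. \<mu>' i * blinfun_apply (D\<psi> i) (Y n)) \<le> 0)"
    by (elim exE) (rule that)
  note nz = multipliers[THEN conjunct1] and l'_nn = multipliers[THEN conjunct2, THEN conjunct1]
    and var = multipliers[THEN conjunct2, THEN conjunct2]
  \<comment>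
    \<open>inactive constraints get the multiplier zero, which is complementary slackness\<close>
  define l where "l \<alpha> = (if \<alpha> \<in> I then l' \<alpha> else 0)" for \<alpha>
  define \<mu> where "\<mu> \<beta> = \<mu>' (\<beta> - 1)" for \<beta>
  define \<pi> where "\<pi> = (\<Sum>i\<in>I. l' i *\<^sub>R D\<phi> i) + (\<Sum>i<q. \<mu>' i *\<^sub>R D\<psi> i)"
  have \<pi>_apply: "blinfun_apply \<pi> w = (\<Sum>i\<in>I. l' i * blinfun_apply (D\<phi> i) w) + (\<Sum>i<q. \<mu>' i * blinfun_apply (D\<psi> i) w)" for w
    by (simp add: \<pi>_def blinfun.add_left blinfun.sum_left blinfun.scaleR_left)
  define p where "p t = (\<pi> o\<^sub>L P t) o\<^sub>L inl_blinfun" for t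
  then have p_eq: "p = (\<lambda>t. (\<pi> o\<^sub>L P t) o\<^sub>L inl_blinfun)" by (rule ext)
  have l0: "l 0 = blinfun_apply \<pi> (0, 1)"
  proof -
    have "(\<Sum>i\<in>I. l' i * blinfun_apply (D\<phi> i) (0, 1)) = (\<Sum>i\<in>I. if i = 0 then l' 0 else 0)"
      by (intro sum.cong) (auto simp: D\<phi>_def blinfun.add_left)
    also have "\<dots> = l' 0" using I(1) by (simp add: I_def)
    finally show ?thesis by (simp add: \<pi>_apply D\<psi>_def l_def I_def)
  qed
  have reg: "(\<lambda>s. - (Q s o\<^sub>L augmented_blinfun (Df s (u0 s)) (Df0 s (u0 s)))) integrable_on {0..T}"
    if "continuous_on {0..T} Q" for Q :: "real \<Rightarrow> ('a \<times> real) \<Rightarrow>\<^sub>L ('a \<times> real)"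
  proof -
    have "regulated T (\<lambda>s. - (Q s o\<^sub>L A s (u0 s)))"
      by (rule regulated_map2[OF continuous_on_regulated[OF that] normal_pc_regulated[OF ct.linearization_normal_pc]],
        rule exI, rule tendsto_minus, erule (1) bounded_bilinear.tendsto[OF bounded_bilinear_blinfun_compose])
    then show ?thesis unfolding A_def by (rule ct.regulated_integrable_full)
  qed
  note costate = costate_equation[OF T P(1,2) P(3)[unfolded A_def] reg p_eq l0]
  have p_cont: "continuous_on {0..T} p"
    unfolding p_def
    by (intro bounded_bilinear.continuous_on[OF bounded_bilinear_blinfun_compose] continuous_on_const P(1))
  have p_pc: "normal_pc T UNIV S0 (\<lambda>s. - ((p s o\<^sub>L Df s (u0 s)) + l 0 *\<^sub>R Df0 s (u0 s)))"
  proof -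
    have Df: "continuous_on ({0..T} \<times> UNIV \<times> U) (\<lambda>r. (\<lambda>(t, \<zeta>). D_F (\<lambda>\<eta>. f t \<eta> \<zeta>) (x0 t)) (fst r, snd (snd r)))"
      by (rule continuous_on_compose2[OF f(4)]) (auto intro!: continuous_intros)
    have Df0: "continuous_on ({0..T} \<times> UNIV \<times> U) (\<lambda>r. (\<lambda>(t, \<zeta>). D_F (\<lambda>\<eta>. f0 t \<eta> \<zeta>) (x0 t)) (fst r, snd (snd r)))"
      by (rule continuous_on_compose2[OF f0(4)]) (auto intro!: continuous_intros)
    have "continuous_on ({0..T} \<times> UNIV \<times> U) (\<lambda>r. - ((fst (snd r) o\<^sub>L Df (fst r) (snd (snd r))) + l 0 *\<^sub>R Df0 (fst r) (snd (snd r))))"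
      using Df Df0 unfolding Df_def Df0_def case_prod_conv
      by (intro continuous_on_minus continuous_on_add continuous_on_scaleR continuous_on_const
          bounded_bilinear.continuous_on[OF bounded_bilinear_blinfun_compose] continuous_on_fst continuous_on_snd continuous_on_id)
    from normal_pc_compose[OF u0 T p_cont subset_UNIV this] show ?thesis by simp
  qed
  note p_prim = primitive_of_normal_pc[where x = p, OF p_pc T costate(2)]
  have H_deriv: "D_F (\<lambda>\<eta>. H_B f0 f t \<eta> (u0 t) (p t) (l 0)) (x0 t) = (p t o\<^sub>L Df t (u0 t)) + l 0 *\<^sub>R Df0 t (u0 t)"
    if t: "t \<in> {0..T}" for t
  proof (rule D_F_eq)
    have "u0 t \<in> U" using normal_pcD(5)[OF u0 t] .
    then have 1: "((\<lambda>\<eta>. f t \<eta> (u0 t)) has_derivative blinfun_apply (Df t (u0 t))) (at (x0 t))"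
      and 2: "((\<lambda>\<eta>. f0 t \<eta> (u0 t)) has_derivative blinfun_apply (Df0 t (u0 t))) (at (x0 t))"
      using f(3) f0(3) t by (auto simp: Df_def Df0_def has_derivative_D_F)
    have "((\<lambda>\<eta>. l 0 * f0 t \<eta> (u0 t) + blinfun_apply (p t) (f t \<eta> (u0 t))) has_derivative
        (\<lambda>v. l 0 * blinfun_apply (Df0 t (u0 t)) v + blinfun_apply (p t) (blinfun_apply (Df t (u0 t)) v))) (at (x0 t))"
      by (intro has_derivative_add has_derivative_mult_right 2 bounded_linear.has_derivative[OF blinfun.bounded_linear_right 1])
    moreover have "blinfun_apply ((p t o\<^sub>L Df t (u0 t)) + l 0 *\<^sub>R Df0 t (u0 t)) =
        (\<lambda>v. l 0 * blinfun_apply (Df0 t (u0 t)) v + blinfun_apply (p t) (blinfun_apply (Df t (u0 t)) v))"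
      by (rule ext) (simp add: blinfun.add_left blinfun.scaleR_left)
    ultimately show "((\<lambda>\<eta>. H_B f0 f t \<eta> (u0 t) (p t) (l 0)) has_derivative
        blinfun_apply ((p t o\<^sub>L Df t (u0 t)) + l 0 *\<^sub>R Df0 t (u0 t))) (at (x0 t))"
      by (simp add: H_B_def)
  qed
  have H_cont: "continuous_on ({0..T} \<times> U) (\<lambda>(s, z). H_B f0 f s (x0 s) z (p s) (l 0))"
  proof -
    have x0': "continuous_on ({0..T} \<times> U) (\<lambda>r. (fst r, x0 (fst r), snd r))"
      by (intro continuous_intros continuous_on_compose2[OF x0(1)]) auto
    have 1: "continuous_on ({0..T} \<times> U) (\<lambda>r. (\<lambda>(t, \<xi>, \<zeta>). f t \<xi> \<zeta>) (fst r, x0 (fst r), snd r))"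
      by (rule continuous_on_compose2[OF f(1) x0']) (use x0(2) in auto)
    have 2: "continuous_on ({0..T} \<times> U) (\<lambda>r. (\<lambda>(t, \<xi>, \<zeta>). f0 t \<xi> \<zeta>) (fst r, x0 (fst r), snd r))"
      by (rule continuous_on_compose2[OF f0(1) x0']) (use x0(2) in auto)
    have 3: "continuous_on ({0..T} \<times> U) (\<lambda>r. p (fst r))"
      by (rule continuous_on_compose2[OF p_cont]) (auto intro!: continuous_intros)
    show ?thesis unfolding H_B_def case_prod_beta
      using 1 2 3 by (intro continuous_on_add continuous_on_mult continuous_on_const blinfun.continuous_on) auto
  qed
  \<comment>
    \<open>the functional is nonpositive on the needle variations, and transported by \<open>P\<close> it
    is the costate\<close>
  have H_max: "H_B f0 f t (x0 t) z (p t) (l 0) \<le> H_B f0 f t (x0 t) (u0 t) (p t) (l 0)"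
    if t: "0 \<le> t" "t < T" and z: "z \<in> U" for t z
  proof -
    have "blinfun_apply \<pi> (Y (t, z)) \<le> 0" using var t z by (simp add: \<pi>_apply)
    moreover have "blinfun_apply \<pi> (Y (t, z)) = blinfun_apply (p t) (f t (x0 t) z - f t (x0 t) (u0 t))
        + (f0 t (x0 t) z - f0 t (x0 t) (u0 t)) * l 0"
      using costate(1)[of t] t unfolding Y_def F_def by simp
    ultimately show ?thesis by (simp add: H_B_def blinfun.diff_right algebra_simps)
  qed
  note H = maximized_along_control[where h = "\<lambda>t z. H_B f0 f t (x0 t) z (p t) (l 0)", OF T u0 H_cont H_max]
  have transversality: "(\<Sum>\<alpha>=0..m. l \<alpha> *\<^sub>R D_H (g \<alpha>) (x0 T)) + (\<Sum>\<beta>=1..q. \<mu> \<beta> *\<^sub>R D_H (h \<beta>) (x0 T)) = p T"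
  proof (rule blinfun_eqI)
    fix v
    have "(\<Sum>\<alpha>=0..m. l \<alpha> * blinfun_apply (D_H (g \<alpha>) (x0 T)) v) = (\<Sum>\<alpha>\<in>I. l' \<alpha> * blinfun_apply (D\<phi> \<alpha>) (v, 0))"
    proof (rule sum.mono_neutral_cong_right)
      show "l x * blinfun_apply (D_H (g x) (x0 T)) v = l' x * blinfun_apply (D\<phi> x) (v, 0)" if "x \<in> I" for x
        using that by (simp add: l_def D\<phi>_def blinfun.add_left)
    qed (use I in \<open>auto simp: l_def\<close>)
    moreover have "(\<Sum>\<beta>=1..q. \<mu> \<beta> * blinfun_apply (D_H (h \<beta>) (x0 T)) v) = (\<Sum>i<q. \<mu>' i * blinfun_apply (D\<psi> i) (v, 0))"
      by (simp add: sum.atLeast1_atMost_eq \<mu>_def D\<psi>_def)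
    ultimately show "blinfun_apply ((\<Sum>\<alpha>=0..m. l \<alpha> *\<^sub>R D_H (g \<alpha>) (x0 T)) + (\<Sum>\<beta>=1..q. \<mu> \<beta> *\<^sub>R D_H (h \<beta>) (x0 T))) v
        = blinfun_apply (p T) v"
      by (simp add: p_def P(2) \<pi>_apply blinfun.add_left blinfun.sum_left blinfun.scaleR_left)
  qed
  have nonzero: "(\<exists>\<alpha>\<in>{0..m}. l \<alpha> \<noteq> 0) \<or> (\<exists>\<beta>\<in>{1..q}. \<mu> \<beta> \<noteq> 0)"
    using nz
  proof
    assume "\<exists>i\<in>I. l' i \<noteq> 0"
    then show ?thesis using I(2) by (auto simp: l_def)
  next
    assume "\<exists>i<q. \<mu>' i \<noteq> 0"
    then obtain i where "i < q" "\<mu>' i \<noteq> 0" by blast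
    then have "Suc i \<in> {1..q}" "\<mu> (Suc i) \<noteq> 0" by (auto simp: \<mu>_def)
    then show ?thesis by blast
  qed
  show ?thesis
  proof (rule exI[of _ l], rule exI[of _ \<mu>], rule exI[of _ p], intro conjI)
    show "p \<in> PC1 T UNIV" using PC1_I[OF p_cont subset_UNIV p_prim(2)] .
    show "\<forall>\<alpha>\<in>{0..m}. l \<alpha> \<ge> 0" using l'_nn by (simp add: l_def)
    show "\<forall>\<alpha>\<in>{1..m}. l \<alpha> * g \<alpha> (x0 T) = 0" by (auto simp: l_def I_def)
    show "\<forall>t\<in>{0..T}. ext_deriv T p t = - D_F (\<lambda>\<eta>. H_B f0 f t \<eta> (u0 t) (p t) (l 0)) (x0 t)"
      using p_prim(3) H_deriv by simp
    show "\<forall>t\<in>{0..T}. \<forall>\<zeta>\<in>U. H_B f0 f t (x0 t) (u0 t) (p t) (l 0) \<ge> H_B f0 f t (x0 t) \<zeta> (p t) (l 0)"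
      using H(1) by blast
    show "continuous_on {0..T} (\<lambda>t. H_B f0 f t (x0 t) (u0 t) (p t) (l 0))" by (rule H(2))
  qed (fact transversality nonzero)+
qed

end
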